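(* Let $(G,S)$ be a pair such that either (a) $G=H_3(\mathbb{Z})$ and $S$ is any finite symmetric generating set of $G$; or (b) $G=H_{2m+1}(\mathbb{Z})$ for some $m\ge1$ and $S$ is a cubical-like generating set of $G$. Then there exist real constants $C,M>0$ and $D_0>0$ such that, for all real $D\ge D_0$ and all integers $n\ge C\cdot D^4$, the element $g=z^n$ satisfies $$\|gh\|_S\le\|g\|_S+M\qquad\text{for all }h\in G\text{ such that }\|h\|_S\le D.$$
   Context: Let $H_3(\mathbb{Z})=\langle x,y\mid[x,y]\text{ central}\rangle$ and $z=[x,y]$. The group $H_{2m+1}(\mathbb{Z})$ is the centrally amalgamated direct product of $m$ copies $G_1,\dots,G_m$ of $H_3(\mathbb{Z})$ along the common center $Z=\langle z\rangle$, i.e. the quotient of $\prod_{i=1}^mG_i$ by the subgroup generated by all $\iota_i(c)\iota_j(c)^{-1}$, $c\in Z$, where $\iota_i\colon Z\hookrightarrow G_i$ identifies $Z$ with the center of $G_i$; $z$ also denotes the corresponding central element of $H_{2m+1}(\mathbb{Z})$. A cubical-like generating set of $H_{2m+1}(\mathbb{Z})$ is the image of a set $\prod_{i=1}^m(S_i\cup\{e\})$, where each $S_i$ is a finite symmetric generating set of $G_i$. $\|\cdot\|_S$ is the word length with respect to $S$. *)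

theory Defs
  imports Complex_Main "HOL-Algebra.Algebra"
begin

section \<open>Groups given by generators and relators\<close>

text \<open>A word is a list of signed letters: \<open>(a, True)\<close> stands for the generator \<open>a\<close>
  and \<open>(a, False)\<close> for its formal inverse.\<close>

type_synonym 'a word = "('a \<times> bool) list"

definition word_inv :: "'a word \<Rightarrow> 'a word" where
  "word_inv w = rev (map (\<lambda>(a, s). (a, \<not> s)) w)"

definition word_comm :: "'a word \<Rightarrow> 'a word \<Rightarrow> 'a word" where
  "word_comm u v = u @ v @ word_inv u @ word_inv v"

inductive pres_eq :: "'a word set \<Rightarrow> 'a word \<Rightarrow> 'a word \<Rightarrow> bool" for R where
  pres_refl: "pres_eq R u u"
| pres_sym: "pres_eq R u v \<Longrightarrow> pres_eq R v u"
| pres_trans: "pres_eq R u v \<Longrightarrow> pres_eq R v w \<Longrightarrow> pres_eq R u w"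
| pres_ctxt: "pres_eq R u v \<Longrightarrow> pres_eq R (p @ u @ q) (p @ v @ q)"
| pres_cancel: "pres_eq R [(a, s), (a, \<not> s)] []"
| pres_relator: "r \<in> R \<Longrightarrow> pres_eq R r []"

definition pres_class :: "'a word set \<Rightarrow> 'a word \<Rightarrow> 'a word set" where
  "pres_class R u = {v. pres_eq R u v}"

definition pres_group :: "'a word set \<Rightarrow> 'a word set monoid" where
  "pres_group R = \<lparr>carrier = range (pres_class R),
     monoid.mult = (\<lambda>A B. \<Union>u\<in>A. \<Union>v\<in>B. pres_class R (u @ v)),
     one = pres_class R []\<rparr>"

lemma pres_class_eq_iff: "pres_class R u = pres_class R v \<longleftrightarrow> pres_eq R u v"
  unfolding pres_class_def by (blast intro: pres_refl pres_sym pres_trans)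

lemma pres_eq_append:
  assumes "pres_eq R u u'" "pres_eq R v v'"
  shows "pres_eq R (u @ v) (u' @ v')"
proof -
  have "pres_eq R (u @ v) (u' @ v)" using pres_ctxt[OF assms(1), of "[]" v] by simp
  moreover have "pres_eq R (u' @ v) (u' @ v')" using pres_ctxt[OF assms(2), of u' "[]"] by simp
  ultimately show ?thesis by (rule pres_trans)
qed

lemma carrier_pres_group: "carrier (pres_group R) = range (pres_class R)"
  by (simp add: pres_group_def)

lemma one_pres_group: "\<one>\<^bsub>pres_group R\<^esub> = pres_class R []"
  by (simp add: pres_group_def)

lemma mult_pres_group:
  "pres_class R u \<otimes>\<^bsub>pres_group R\<^esub> pres_class R v = pres_class R (u @ v)"
proof -
  have "pres_class R (u' @ v') = pres_class R (u @ v)"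
    if "u' \<in> pres_class R u" "v' \<in> pres_class R v" for u' v'
    using that pres_eq_append[of R u u' v v'] pres_class_eq_iff[of R "u @ v" "u' @ v'"]
    by (auto simp: pres_class_def)
  then have "(\<Union>u'\<in>pres_class R u. \<Union>v'\<in>pres_class R v. pres_class R (u' @ v'))
      = (\<Union>u'\<in>pres_class R u. \<Union>v'\<in>pres_class R v. pres_class R (u @ v))"
    by (intro SUP_cong refl)
  moreover have "u \<in> pres_class R u" "v \<in> pres_class R v"
    by (simp_all add: pres_class_def pres_refl)
  then have "(\<Union>u'\<in>pres_class R u. \<Union>v'\<in>pres_class R v. pres_class R (u @ v)) = pres_class R (u @ v)"
    by blast
  ultimately show ?thesis by (simp add: pres_group_def)
qed

lemma pres_eq_word_inv: "pres_eq R (word_inv w @ w) []"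
proof (induction w)
  case Nil
  show ?case by (simp add: word_inv_def pres_refl)
next
  case (Cons l w)
  obtain a s where l: "l = (a, s)" by (cases l)
  have "pres_eq R (word_inv w @ [(a, \<not> s), (a, \<not> \<not> s)] @ w) (word_inv w @ [] @ w)"
    by (rule pres_ctxt[OF pres_cancel])
  then have "pres_eq R (word_inv (l # w) @ l # w) (word_inv w @ w)"
    by (simp add: word_inv_def l)
  then show ?case using Cons.IH by (rule pres_trans)
qed

lemma group_pres_group: "group (pres_group R)"
proof (rule groupI)
  fix x y assume "x \<in> carrier (pres_group R)" "y \<in> carrier (pres_group R)"
  then show "x \<otimes>\<^bsub>pres_group R\<^esub> y \<in> carrier (pres_group R)"
    by (auto simp: carrier_pres_group mult_pres_group)
next
  fix x assume "x \<in> carrier (pres_group R)"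
  then obtain u where u: "x = pres_class R u" by (auto simp: carrier_pres_group)
  have "pres_class R (word_inv u) \<otimes>\<^bsub>pres_group R\<^esub> x = \<one>\<^bsub>pres_group R\<^esub>"
    by (simp add: u mult_pres_group one_pres_group pres_class_eq_iff pres_eq_word_inv)
  then show "\<exists>y\<in>carrier (pres_group R). y \<otimes>\<^bsub>pres_group R\<^esub> x = \<one>\<^bsub>pres_group R\<^esub>"
    by (auto simp: carrier_pres_group)
qed (auto simp: carrier_pres_group mult_pres_group one_pres_group)

lemma inv_pres_group: "inv\<^bsub>pres_group R\<^esub> (pres_class R u) = pres_class R (word_inv u)"
proof (rule group.inv_equality[OF group_pres_group])
  show "pres_class R (word_inv u) \<otimes>\<^bsub>pres_group R\<^esub> pres_class R u = \<one>\<^bsub>pres_group R\<^esub>"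
    by (simp add: mult_pres_group one_pres_group pres_class_eq_iff pres_eq_word_inv)
qed (simp_all add: carrier_pres_group)


section \<open>The discrete Heisenberg groups\<close>

datatype heis_gen = gen_x | gen_y

text \<open>The relators express that the commutator of the two generators commutes with every
  word, i.e. that it is central.\<close>

definition heis_relators :: "heis_gen word set" where
  "heis_relators = range (word_comm (word_comm [(gen_x, True)] [(gen_y, True)]))"

definition H3 :: "heis_gen word set monoid" where
  "H3 = pres_group heis_relators"

definition H3_x :: "heis_gen word set" where
  "H3_x = pres_class heis_relators [(gen_x, True)]"

definition H3_y :: "heis_gen word set" where
  "H3_y = pres_class heis_relators [(gen_y, True)]"

definition H3_z :: "heis_gen word set" where
  "H3_z = H3_x \<otimes>\<^bsub>H3\<^esub> H3_y \<otimes>\<^bsub>H3\<^esub> inv\<^bsub>H3\<^esub> H3_x \<otimes>\<^bsub>H3\<^esub> inv\<^bsub>H3\<^esub> H3_y"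

definition H3_pow :: "nat \<Rightarrow> (nat \<Rightarrow> heis_gen word set) monoid" where
  "H3_pow m = product_group {..<m} (\<lambda>_. H3)"

definition H3_inj :: "nat \<Rightarrow> nat \<Rightarrow> heis_gen word set \<Rightarrow> (nat \<Rightarrow> heis_gen word set)" where
  "H3_inj m i c = (\<lambda>k\<in>{..<m}. if k = i then c else \<one>\<^bsub>H3\<^esub>)"

definition heis_amalg :: "nat \<Rightarrow> (nat \<Rightarrow> heis_gen word set) set" where
  "heis_amalg m = generate (H3_pow m)
     {H3_inj m i c \<otimes>\<^bsub>H3_pow m\<^esub> inv\<^bsub>H3_pow m\<^esub> (H3_inj m j c) | i j c.
        i < m \<and> j < m \<and> c \<in> generate H3 {H3_z}}"

text \<open>\<open>Heis m\<close> is the group usually denoted \<open>H\<close> with index \<open>2m+1\<close>.\<close>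

definition Heis :: "nat \<Rightarrow> (nat \<Rightarrow> heis_gen word set) set monoid" where
  "Heis m = H3_pow m Mod heis_amalg m"

definition Heis_proj :: "nat \<Rightarrow> (nat \<Rightarrow> heis_gen word set) \<Rightarrow> (nat \<Rightarrow> heis_gen word set) set" where
  "Heis_proj m f = heis_amalg m #>\<^bsub>H3_pow m\<^esub> f"

text \<open>In the quotient the copies of the centre are identified, so taking the first factor
  (which exists for \<open>m \<ge> 1\<close>) is no restriction.\<close>

definition Heis_z :: "nat \<Rightarrow> (nat \<Rightarrow> heis_gen word set) set" where
  "Heis_z m = Heis_proj m (H3_inj m 0 H3_z)"

lemma group_H3: "group H3"
  unfolding H3_def by (rule group_pres_group)

lemma group_H3_pow: "group (H3_pow m)"
  unfolding H3_pow_def by (simp add: group_H3)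

lemma H3_z_word:
  "H3_z = pres_class heis_relators (word_comm [(gen_x, True)] [(gen_y, True)])"
  by (simp add: H3_z_def H3_x_def H3_y_def H3_def mult_pres_group inv_pres_group word_comm_def)

lemma H3_z_closed: "H3_z \<in> carrier H3"
  by (simp add: H3_z_word H3_def carrier_pres_group)

lemma H3_z_central:
  assumes "g \<in> carrier H3"
  shows "H3_z \<otimes>\<^bsub>H3\<^esub> g = g \<otimes>\<^bsub>H3\<^esub> H3_z"
proof -
  interpret H: group H3 by (rule group_H3)
  let ?z = "word_comm [(gen_x, True)] [(gen_y, True)] :: heis_gen word"
  obtain w where w: "g = pres_class heis_relators w"
    using assms by (auto simp: H3_def carrier_pres_group)
  have "pres_eq heis_relators (word_comm ?z w) []"
    by (rule pres_relator) (simp add: heis_relators_def)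
  then have "H3_z \<otimes>\<^bsub>H3\<^esub> g \<otimes>\<^bsub>H3\<^esub> (inv\<^bsub>H3\<^esub> H3_z \<otimes>\<^bsub>H3\<^esub> inv\<^bsub>H3\<^esub> g) = \<one>\<^bsub>H3\<^esub>"
    unfolding w H3_z_word H3_def inv_pres_group mult_pres_group one_pres_group pres_class_eq_iff
    by (simp add: word_comm_def)
  moreover have "inv\<^bsub>H3\<^esub> H3_z \<otimes>\<^bsub>H3\<^esub> inv\<^bsub>H3\<^esub> g = inv\<^bsub>H3\<^esub> (g \<otimes>\<^bsub>H3\<^esub> H3_z)"
    using assms H3_z_closed by (simp add: H.inv_mult_group)
  ultimately show ?thesis
    using assms H3_z_closed H.inv_equality[of "H3_z \<otimes>\<^bsub>H3\<^esub> g" "inv\<^bsub>H3\<^esub> (g \<otimes>\<^bsub>H3\<^esub> H3_z)"]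
    by simp
qed

lemma generate_H3_z_central:
  assumes "c \<in> generate H3 {H3_z}" "g \<in> carrier H3"
  shows "c \<otimes>\<^bsub>H3\<^esub> g = g \<otimes>\<^bsub>H3\<^esub> c"
proof -
  interpret H: group H3 by (rule group_H3)
  note cl = H.generate_in_carrier[of "{H3_z}"]
  show ?thesis using assms
  proof (induction arbitrary: g rule: generate.induct)
    case one
    then show ?case by simp
  next
    case (incl h)
    then show ?case by (simp add: H3_z_central)
  next
    case (inv h)
    then have h: "h = H3_z" by simp
    have "inv\<^bsub>H3\<^esub> h \<otimes>\<^bsub>H3\<^esub> g = inv\<^bsub>H3\<^esub> h \<otimes>\<^bsub>H3\<^esub> (g \<otimes>\<^bsub>H3\<^esub> h) \<otimes>\<^bsub>H3\<^esub> inv\<^bsub>H3\<^esub> h"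
      using inv H3_z_closed by (simp add: h H.m_assoc)
    also have "g \<otimes>\<^bsub>H3\<^esub> h = h \<otimes>\<^bsub>H3\<^esub> g" using inv by (simp add: h H3_z_central)
    finally show ?case using inv H3_z_closed by (simp add: h H.m_assoc[symmetric])
  next
    case (eng h1 h2)
    have cl: "h1 \<in> carrier H3" "h2 \<in> carrier H3" "g \<in> carrier H3"
      using cl eng.hyps eng.prems H3_z_closed by auto
    have "h1 \<otimes>\<^bsub>H3\<^esub> h2 \<otimes>\<^bsub>H3\<^esub> g = h1 \<otimes>\<^bsub>H3\<^esub> (h2 \<otimes>\<^bsub>H3\<^esub> g)" by (rule H.m_assoc[OF cl])
    also have "h2 \<otimes>\<^bsub>H3\<^esub> g = g \<otimes>\<^bsub>H3\<^esub> h2" by (rule eng.IH(2)[OF cl(3)])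
    also have "h1 \<otimes>\<^bsub>H3\<^esub> (g \<otimes>\<^bsub>H3\<^esub> h2) = h1 \<otimes>\<^bsub>H3\<^esub> g \<otimes>\<^bsub>H3\<^esub> h2" using cl by (simp only: H.m_assoc)
    also have "h1 \<otimes>\<^bsub>H3\<^esub> g = g \<otimes>\<^bsub>H3\<^esub> h1" by (rule eng.IH(1)[OF cl(3)])
    also have "g \<otimes>\<^bsub>H3\<^esub> h1 \<otimes>\<^bsub>H3\<^esub> h2 = g \<otimes>\<^bsub>H3\<^esub> (h1 \<otimes>\<^bsub>H3\<^esub> h2)" using cl by (simp only: H.m_assoc)
    finally show ?case .
  qed
qed

lemma heis_amalg_normal: "heis_amalg m \<lhd> H3_pow m"
proof -
  interpret H: group H3 by (rule group_H3)
  interpret P: group "H3_pow m" by (rule group_H3_pow)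
  have Z: "c \<in> carrier H3" if "c \<in> generate H3 {H3_z}" for c
    using H.generate_in_carrier[of "{H3_z}"] that H3_z_closed by auto
  have inj: "H3_inj m i c \<in> carrier (H3_pow m)" if "c \<in> generate H3 {H3_z}" for i c
    using Z[OF that] by (auto simp: H3_inj_def H3_pow_def)
  have comm: "H3_inj m i c \<otimes>\<^bsub>H3_pow m\<^esub> g = g \<otimes>\<^bsub>H3_pow m\<^esub> H3_inj m i c"
    if "c \<in> generate H3 {H3_z}" "g \<in> carrier (H3_pow m)" for i c g
  proof -
    have "g k \<in> carrier H3" if "k < m" for k
      using \<open>g \<in> carrier (H3_pow m)\<close> that by (auto simp: H3_pow_def PiE_iff)
    then have "H3_inj m i c k \<otimes>\<^bsub>H3\<^esub> g k = g k \<otimes>\<^bsub>H3\<^esub> H3_inj m i c k" if "k \<in> {..<m}" for k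
      using that generate_H3_z_central[OF \<open>c \<in> generate H3 {H3_z}\<close>, of "g k"]
      by (cases "k = i") (simp_all add: H3_inj_def)
    then show ?thesis
      unfolding H3_pow_def mult_product_group by (intro restrict_ext)
  qed
  show ?thesis unfolding heis_amalg_def
  proof (rule P.normal_generateI)
    show "{H3_inj m i c \<otimes>\<^bsub>H3_pow m\<^esub> inv\<^bsub>H3_pow m\<^esub> (H3_inj m j c) | i j c.
        i < m \<and> j < m \<and> c \<in> generate H3 {H3_z}} \<subseteq> carrier (H3_pow m)"
      using inj by auto
    fix h g
    assume "h \<in> {H3_inj m i c \<otimes>\<^bsub>H3_pow m\<^esub> inv\<^bsub>H3_pow m\<^esub> (H3_inj m j c) | i j c.
        i < m \<and> j < m \<and> c \<in> generate H3 {H3_z}}" and g: "g \<in> carrier (H3_pow m)"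
    then obtain i j c where h: "h = H3_inj m i c \<otimes>\<^bsub>H3_pow m\<^esub> inv\<^bsub>H3_pow m\<^esub> (H3_inj m j c)"
      and c: "c \<in> generate H3 {H3_z}" and ij: "i < m" "j < m" by auto
    let ?a = "H3_inj m i c" and ?b = "H3_inj m j c"
    have cl: "?a \<in> carrier (H3_pow m)" "?b \<in> carrier (H3_pow m)" using inj c by auto
    have b: "inv\<^bsub>H3_pow m\<^esub> ?b \<otimes>\<^bsub>H3_pow m\<^esub> inv\<^bsub>H3_pow m\<^esub> g
        = inv\<^bsub>H3_pow m\<^esub> g \<otimes>\<^bsub>H3_pow m\<^esub> inv\<^bsub>H3_pow m\<^esub> ?b"
      using comm[OF c g] cl g by (simp add: P.inv_mult_group[symmetric])
    have "g \<otimes>\<^bsub>H3_pow m\<^esub> h \<otimes>\<^bsub>H3_pow m\<^esub> inv\<^bsub>H3_pow m\<^esub> g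
        = ?a \<otimes>\<^bsub>H3_pow m\<^esub> g \<otimes>\<^bsub>H3_pow m\<^esub> (inv\<^bsub>H3_pow m\<^esub> ?b \<otimes>\<^bsub>H3_pow m\<^esub> inv\<^bsub>H3_pow m\<^esub> g)"
      using cl g by (simp add: h P.m_assoc[symmetric] comm[OF c g])
    also have "\<dots> = ?a \<otimes>\<^bsub>H3_pow m\<^esub> (g \<otimes>\<^bsub>H3_pow m\<^esub> inv\<^bsub>H3_pow m\<^esub> g) \<otimes>\<^bsub>H3_pow m\<^esub> inv\<^bsub>H3_pow m\<^esub> ?b"
      unfolding b using cl g by (simp only: P.m_assoc P.m_closed P.inv_closed)
    also have "\<dots> = h" using cl g by (simp add: h)
    finally show "g \<otimes>\<^bsub>H3_pow m\<^esub> h \<otimes>\<^bsub>H3_pow m\<^esub> inv\<^bsub>H3_pow m\<^esub> g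
        \<in> {H3_inj m i c \<otimes>\<^bsub>H3_pow m\<^esub> inv\<^bsub>H3_pow m\<^esub> (H3_inj m j c) | i j c.
        i < m \<and> j < m \<and> c \<in> generate H3 {H3_z}}"
      using h ij c by auto
  qed
qed

lemma group_Heis: "group (Heis m)"
  unfolding Heis_def by (rule normal.factorgroup_is_group[OF heis_amalg_normal])


section \<open>Generating sets and word length\<close>

definition fin_sym_generating :: "('a, 'b) monoid_scheme \<Rightarrow> 'a set \<Rightarrow> bool" where
  "fin_sym_generating G S \<longleftrightarrow> finite S \<and> S \<subseteq> carrier G \<and> (\<forall>s\<in>S. inv\<^bsub>G\<^esub> s \<in> S) \<and>
     generate G S = carrier G"

definition cubical_like :: "nat \<Rightarrow> (nat \<Rightarrow> heis_gen word set) set set \<Rightarrow> bool" where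
  "cubical_like m S \<longleftrightarrow> (\<exists>T. (\<forall>i<m. fin_sym_generating H3 (T i)) \<and>
     S = Heis_proj m ` (\<Pi>\<^sub>E i\<in>{..<m}. T i \<union> {\<one>\<^bsub>H3\<^esub>}))"

text \<open>Meaningful for elements that are products of elements of \<open>S\<close>; this is all of the group
  when \<open>S\<close> is symmetric and generating.\<close>

definition word_length :: "('a, 'b) monoid_scheme \<Rightarrow> 'a set \<Rightarrow> 'a \<Rightarrow> nat" where
  "word_length G S g = (LEAST k. \<exists>ws. length ws = k \<and> set ws \<subseteq> S \<and>
     foldr (\<otimes>\<^bsub>G\<^esub>) ws \<one>\<^bsub>G\<^esub> = g)"

end

theory Submission
  imports Defs "HOL-Library.Product_Plus"
begin

text \<open>In coordinates an element of the Heisenberg group is a pair of a vector of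
\<open>\<int>\<^sup>2\<close> and an integer: the vector is the endpoint of the planar path traced by a word,
and the integer is twice the signed area swept by that path, plus contributions of the single letters. The
product adds both entries and adds the determinant of the two vectors to the second one. In these coordinates
\<open>z\<close> to the power \<open>n\<close> is a closed path of doubled area \<open>2 * n\<close>, and
\<open>H\<close> with index \<open>2m+1\<close> consists of \<open>m\<close> vectors with one common integer, so
that a word in a cubical-like generating set is an \<open>m\<close>-tuple of planar words of equal length
(padded by the identity) whose areas add up.

Let a word of length \<open>k\<close> represent \<open>z\<close> to the power \<open>n\<close>, and let
\<open>h\<close> have word length at most \<open>D\<close>, so that its vector \<open>v\<close> has size
\<open>O(D)\<close> and its integer has size \<open>O(D^2)\<close>. The assumption \<open>n \<ge> C *
D^4\<close>, together with \<open>n = O(k^2)\<close>, bounds \<open>D^2\<close> by a small multiple of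
\<open>k\<close>. It is enough to find a path of length \<open>k + O(1)\<close> which ends at \<open>v\<close>
and loses only \<open>O(k)\<close> area: inserting a bounded number of letters at one place of the path and
their inverses at a place far away wins any required multiple of \<open>k\<close> (\<open>enlarge_area\<close>),
a discrete intermediate value argument on the permutations of the letters lowers the area to within a bounded
distance of the required value (\<open>permute_to_area\<close>), and a bounded number of central letters repairs
the rest.

To find that path, permute the letters of the closed path so that its area is maximal. Exchanging two adjacent
blocks cannot increase the area, and this says that the path is convex: it lies on the left of each of its steps
(\<open>area_max_blocks\<close>, \<open>area_max_left\<close>). Start the path at the vertex where \<open>-
v\<close> is a supporting direction. If the area is quadratic in \<open>k\<close>, the path cannot be squeezed
into a strip whose width is a small multiple of \<open>k\<close> (\<open>area_pinched\<close>), and this forces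
the direction \<open>- v\<close> to lie in the cone spanned by a letter that is frequent among the last
\<open>O(D)\<close> steps and a letter that is frequent among the first \<open>O(D)\<close> steps. Deleting
suitable numbers of copies of these two letters moves the endpoint to \<open>v\<close>, up to a bounded error.
All changes happen in a window of length \<open>O(D)\<close> around one vertex of the closed path, so the area
changes by \<open>O(D^2)\<close>, which is \<open>O(k)\<close> (\<open>shift_endpoint_by_deletion\<close>). This
is where the fourth power of \<open>D\<close> comes from.

For several factors the same is done in each of them, after replacing the closed path of a factor by one of
quadratic area if it encloses less. The sum of the areas can then be tuned by permuting the letters in all
factors.\<close>

section \<open>Letters, displacement and area\<close>

type_synonym letter = "(int \<times> int) \<times> int"

definition cross :: "int \<times> int \<Rightarrow> int \<times> int \<Rightarrow> int" where
  "cross u v = fst u * snd v - snd u * fst v"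

definition dot :: "int \<times> int \<Rightarrow> int \<times> int \<Rightarrow> int" where
  "dot u v = fst u * fst v + snd u * snd v"

definition nrm1 :: "int \<times> int \<Rightarrow> int" where
  "nrm1 v = \<bar>fst v\<bar> + \<bar>snd v\<bar>"

text \<open>A letter \<open>(p, t)\<close> stands for a Heisenberg element in the coordinates \<open>(p, t)(q,
s) = (p + q, t + s + cross p q)\<close>. The pair of \<open>disp ws\<close> and \<open>area ws\<close> is the
product of the letters of \<open>ws\<close>. The inverse of a letter is its negative.\<close>

definition disp :: "letter list \<Rightarrow> int \<times> int" where
  "disp ws = sum_list (map fst ws)"

fun area :: "letter list \<Rightarrow> int" where
  "area [] = 0"
| "area (l # ws) = snd l + cross (fst l) (disp ws) + area ws"

definition word_neg :: "letter list \<Rightarrow> letter list" where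
  "word_neg ws = map uminus (rev ws)"

lemma cross_simps:
  "cross (u + v) w = cross u w + cross v w" "cross w (u + v) = cross w u + cross w v"
  "cross (u - v) w = cross u w - cross v w" "cross w (u - v) = cross w u - cross w v"
  "cross (- u) w = - cross u w" "cross w (- u) = - cross w u"
  "cross 0 w = 0" "cross w 0 = 0" "cross w w = 0"
  by (simp_all add: cross_def algebra_simps)

lemma cross_swap: "cross u v = - cross v u"
  by (simp add: cross_def)

lemma abs_cross_le: "\<bar>cross u v\<bar> \<le> nrm1 u * nrm1 v"
proof -
  have "\<bar>cross u v\<bar> \<le> \<bar>fst u\<bar> * \<bar>snd v\<bar> + \<bar>snd u\<bar> * \<bar>fst v\<bar>"
    unfolding cross_def by (metis abs_mult abs_triangle_ineq4)
  also have "\<dots> \<le> nrm1 u * nrm1 v"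
    by (simp add: nrm1_def algebra_simps)
  finally show ?thesis by simp
qed

lemma abs_dot_le: "\<bar>dot u v\<bar> \<le> nrm1 u * nrm1 v"
proof -
  have "\<bar>dot u v\<bar> \<le> \<bar>fst u\<bar> * \<bar>fst v\<bar> + \<bar>snd u\<bar> * \<bar>snd v\<bar>"
    unfolding dot_def by (metis abs_mult abs_triangle_ineq)
  also have "\<dots> \<le> nrm1 u * nrm1 v"
    by (simp add: nrm1_def algebra_simps)
  finally show ?thesis by simp
qed

lemma nrm1_le_dot: "nrm1 f \<le> dot f f"
proof -
  have "\<bar>a\<bar> \<le> a * a" for a :: int
  proof (cases "a = 0")
    case False
    then have "1 * \<bar>a\<bar> \<le> \<bar>a\<bar> * \<bar>a\<bar>" by (intro mult_right_mono) auto
    then show ?thesis by simp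
  qed simp
  from this[of "fst f"] this[of "snd f"] show ?thesis by (simp add: nrm1_def dot_def)
qed

lemma nrm1_props: "nrm1 0 = 0" "0 \<le> nrm1 u" "nrm1 (- u) = nrm1 u" "nrm1 (u + v) \<le> nrm1 u + nrm1 v"
  by (auto simp: nrm1_def)

lemma nrm1_pos: "v \<noteq> 0 \<Longrightarrow> 1 \<le> nrm1 v"
  by (cases v) (auto simp: nrm1_def zero_prod_def)

lemma disp_simps [simp]:
  "disp [] = 0" "disp (l # ws) = fst l + disp ws" "disp (u @ v) = disp u + disp v"
  by (simp_all add: disp_def)

lemma disp_rev [simp]: "disp (rev ws) = disp ws"
  by (induction ws) (auto simp: add.commute)

lemma disp_mset: "mset u = mset v \<Longrightarrow> disp u = disp v"
  unfolding disp_def by (metis mset_map sum_mset_sum_list)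

lemma area_append [simp]: "area (u @ v) = area u + area v + cross (disp u) (disp v)"
  by (induction u) (auto simp: cross_simps)

text \<open>Reversing the order of the letters keeps the endpoint and reflects the planar path, so only the
contributions of the single letters survive in the sum of both areas.\<close>

lemma area_rev: "area (rev ws) = 2 * sum_list (map snd ws) - area ws"
  by (induction ws) (auto simp: cross_simps cross_swap[of "disp _"])

lemma disp_word_neg [simp]: "disp (word_neg ws) = - disp ws"
  by (induction ws) (auto simp: word_neg_def)

lemma area_word_neg [simp]: "area (word_neg ws) = - area ws"
proof (induction ws)
  case (Cons l ws)
  have "word_neg (l # ws) = word_neg ws @ [- l]" by (simp add: word_neg_def)
  then show ?case using Cons by (simp add: cross_simps cross_swap[of "disp ws"])
qed (simp add: word_neg_def)

lemma length_word_neg [simp]: "length (word_neg ws) = length ws"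
  by (simp add: word_neg_def)

definition word_power :: "nat \<Rightarrow> letter list \<Rightarrow> letter list" where
  "word_power n w = concat (replicate n w)"

lemma word_power_simps [simp]: "word_power 0 w = []" "word_power (Suc n) w = w @ word_power n w"
  by (simp_all add: word_power_def)

lemma disp_word_power: "disp (word_power n w) = (int n * fst (disp w), int n * snd (disp w))"
  by (induction n) (auto simp: algebra_simps zero_prod_def prod_eq_iff)

lemma area_word_power: "area (word_power n w) = int n * area w"
proof (induction n)
  case (Suc n)
  have "cross (disp w) (disp (word_power n w)) = 0"
    by (simp add: disp_word_power cross_def algebra_simps)
  then show ?case using Suc by (simp add: algebra_simps)
qed simp

lemma length_word_power: "length (word_power n w) = n * length w"
  by (induction n) auto

lemma set_word_power: "set (word_power n w) \<subseteq> set w"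
  by (induction n) auto

section \<open>Paths in strips\<close>

locale letters =
  fixes A :: "letter set" and \<beta> :: int
  assumes finite_A: "finite A" and beta_ge: "\<beta> \<ge> 1"
    and nrm_letter: "l \<in> A \<Longrightarrow> nrm1 (fst l) \<le> \<beta>"
    and abs_letter: "l \<in> A \<Longrightarrow> \<bar>snd l\<bar> \<le> \<beta>"
begin

lemma nrm_disp: "set w \<subseteq> A \<Longrightarrow> nrm1 (disp w) \<le> \<beta> * int (length w)"
proof (induction w)
  case (Cons l w)
  then have "nrm1 (disp w) \<le> \<beta> * int (length w)" "nrm1 (fst l) \<le> \<beta>"
    using nrm_letter[of l] by auto
  then show ?case using nrm1_props(4)[of "fst l" "disp w"] by (simp add: algebra_simps)
qed (simp add: nrm1_props)

lemma abs_cross_letters: "l \<in> A \<Longrightarrow> l' \<in> A \<Longrightarrow> \<bar>cross (fst l) (fst l')\<bar> \<le> \<beta> * \<beta>"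
  using abs_cross_le[of "fst l" "fst l'"] mult_mono[OF nrm_letter nrm_letter, of l l'] beta_ge
    nrm1_props(2) by (smt (verit))

lemma abs_area: "set w \<subseteq> A \<Longrightarrow> \<bar>area w\<bar> \<le> 2 * \<beta>\<^sup>2 * (int (length w))\<^sup>2"
proof (induction w)
  case (Cons l w)
  let ?n = "int (length w)"
  have l: "nrm1 (fst l) \<le> \<beta>" "\<bar>snd l\<bar> \<le> \<beta>" using Cons.prems nrm_letter abs_letter by auto
  have w: "nrm1 (disp w) \<le> \<beta> * ?n" using nrm_disp Cons.prems by simp
  have "\<bar>cross (fst l) (disp w)\<bar> \<le> \<beta> * (\<beta> * ?n)"
    using abs_cross_le[of "fst l" "disp w"] mult_mono[OF l(1) w] beta_ge nrm1_props(2)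
    by (smt (verit))
  moreover have "\<beta> \<le> \<beta>\<^sup>2" using beta_ge by (simp add: power2_eq_square)
  moreover have "\<beta>\<^sup>2 * ?n \<ge> 0" by simp
  ultimately have "\<bar>area (l # w)\<bar> \<le> \<beta>\<^sup>2 + \<beta>\<^sup>2 * ?n + 2 * \<beta>\<^sup>2 * ?n\<^sup>2"
    using Cons l(2) by (simp add: power2_eq_square)
  also have "\<dots> \<le> 2 * \<beta>\<^sup>2 * (1 + ?n)\<^sup>2"
  proof -
    have "0 \<le> \<beta>\<^sup>2 * (1 + 3 * ?n)" by simp
    then show ?thesis by (simp add: power2_eq_square algebra_simps)
  qed
  finally show ?case by (simp add: algebra_simps)
qed simp

lemma area_rev_le: "set w \<subseteq> A \<Longrightarrow> area (rev w) \<le> 2 * \<beta> * int (length w) - area w"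
proof -
  assume "set w \<subseteq> A"
  then have "sum_list (map snd w) \<le> \<beta> * int (length w)"
  proof (induction w)
    case (Cons l w)
    then show ?case using abs_letter[of l] by (simp add: algebra_simps)
  qed simp
  then show ?thesis by (simp add: area_rev)
qed

text \<open>A path of length \<open>N\<close> inside a strip \<open>\<bar>cross f x\<bar> \<le> E\<close> sweeps
an area of order \<open>N * E\<close>. For the endpoint \<open>x\<close> of a path, the quantity \<open>dot f f
* area - dot f x * cross f x\<close> is, up to sign and scaling, the area between the path and the line through
the origin in direction \<open>f\<close>. By the identity \<open>dot f f * cross x s = dot f x * cross f s -
cross f x * dot f s\<close> a step \<open>s\<close> changes it by \<open>- dot f s\<close> times the sum of the
values of \<open>cross f\<close> at the two ends of the step, apart from the letter's own contribution.\<close>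

lemma area_strip:
  assumes u: "set u \<subseteq> A" and E: "E \<ge> 0"
    and strip: "\<And>P Q. u = P @ Q \<Longrightarrow> \<bar>cross f (disp P)\<bar> \<le> E"
  shows "dot f f * area u \<le> dot f (disp u) * cross f (disp u)
    + dot f f * (\<beta> * (1 + 2 * E)) * int (length u)"
  using u strip
proof (induction u rule: rev_induct)
  case (snoc l u)
  let ?P = "disp u" and ?s = "fst l"
  have IH: "dot f f * area u \<le> dot f ?P * cross f ?P + dot f f * (\<beta> * (1 + 2 * E)) * int (length u)"
    using snoc.prems by (intro snoc.IH) (auto intro: snoc.prems(2)[of _ "_ @ [l]"])
  have strip: "\<bar>cross f ?P\<bar> \<le> E" "\<bar>cross f (?P + ?s)\<bar> \<le> E"
    using snoc.prems(2)[of u "[l]"] snoc.prems(2)[of "u @ [l]" "[]"] by auto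
  have l: "nrm1 ?s \<le> \<beta>" "\<bar>snd l\<bar> \<le> \<beta>" using snoc.prems nrm_letter abs_letter by auto
  have q: "0 \<le> dot f f" using nrm1_le_dot[of f] nrm1_props(2)[of f] by linarith
  have "\<bar>dot f ?s\<bar> \<le> dot f f * \<beta>"
    using abs_dot_le[of f ?s] mult_mono[OF nrm1_le_dot[of f] l(1) q nrm1_props(2)] by linarith
  then have "\<bar>dot f ?s * (cross f ?P + cross f (?P + ?s))\<bar> \<le> (dot f f * \<beta>) * (2 * E)"
    unfolding abs_mult using strip by (intro mult_mono) auto
  moreover have "dot f f * snd l \<le> dot f f * \<beta>" using q l(2) by (intro mult_left_mono) auto
  moreover have "dot f f * area (u @ [l]) - dot f (?P + ?s) * cross f (?P + ?s)
      = dot f f * area u - dot f ?P * cross f ?P + dot f f * snd l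
        - dot f ?s * (cross f ?P + cross f (?P + ?s))"
    by (simp add: cross_def dot_def algebra_simps)
  ultimately show ?case using IH by (simp add: algebra_simps)
qed (simp add: cross_simps)

corollary closed_area_strip:
  assumes "set u \<subseteq> A" "E \<ge> 0" "\<And>P Q. u = P @ Q \<Longrightarrow> \<bar>cross f (disp P)\<bar> \<le> E" "disp u = 0" "f \<noteq> 0"
  shows "area u \<le> \<beta> * (1 + 2 * E) * int (length u)"
proof -
  have "dot f f > 0" using nrm1_le_dot[of f] nrm1_pos[OF assms(5)] by linarith
  moreover have "dot f f * area u \<le> dot f f * (\<beta> * (1 + 2 * E) * int (length u))"
    using area_strip[OF assms(1-3)] assms(4) by (simp add: cross_simps mult.assoc)
  ultimately show ?thesis by simp
qed

text \<open>If three half planes \<open>cross a x \<ge> 0\<close>, \<open>cross b x \<ge> 0\<close>,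
\<open>cross c x \<ge> 0\<close> have normals with a nontrivial nonnegative dependency, then a path that
satisfies all three up to \<open>E\<close> lies in a strip. The dependency is the identity \<open>cross b c * a
+ cross c a * b + cross a b * c = 0\<close>, whose coefficients are integers, so a positive one is at least
1.\<close>

lemma area_pinched:
  assumes u: "set u \<subseteq> A" "disp u = 0" and E: "E \<ge> 0"
    and abc: "a \<noteq> 0" "b \<noteq> 0" "c \<noteq> 0"
    and half: "\<And>P Q. u = P @ Q \<Longrightarrow> cross a (disp P) \<ge> - E"
      "\<And>P Q. u = P @ Q \<Longrightarrow> cross b (disp P) \<ge> - E"
      "\<And>P Q. u = P @ Q \<Longrightarrow> cross c (disp P) \<ge> - E"
    and nn: "0 \<le> cross a b" "0 \<le> cross b c" "0 \<le> cross c a"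
    and H: "cross a b \<le> H" "cross b c \<le> H" "cross c a \<le> H"
    and pos: "0 < cross a b \<or> 0 < cross b c \<or> 0 < cross c a"
  shows "area u \<le> \<beta> * (1 + 4 * (H * E)) * int (length u)"
proof -
  have key: "area u \<le> \<beta> * (1 + 4 * (H * E)) * int (length u)"
    if abc: "a \<noteq> 0" and half: "\<And>P Q. u = P @ Q \<Longrightarrow> cross a (disp P) \<ge> - E"
      "\<And>P Q. u = P @ Q \<Longrightarrow> cross b (disp P) \<ge> - E"
      "\<And>P Q. u = P @ Q \<Longrightarrow> cross c (disp P) \<ge> - E"
    and nn: "0 \<le> cross a b" "0 < cross b c" "0 \<le> cross c a"
    and H: "cross a b \<le> H" "cross b c \<le> H" "cross c a \<le> H" for a b c
  proof -
    have "\<bar>cross a (disp P)\<bar> \<le> 2 * (H * E)" if P: "u = P @ Q" for P Q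
    proof -
      let ?y = "disp P"
      have "cross b c * cross a ?y + cross c a * cross b ?y + cross a b * cross c ?y = 0"
        by (simp add: cross_def algebra_simps)
      moreover have "cross c a * cross b ?y \<ge> cross c a * (- E)"
        using half(2)[OF P] nn by (intro mult_left_mono)
      moreover have "cross a b * cross c ?y \<ge> cross a b * (- E)"
        using half(3)[OF P] nn by (intro mult_left_mono)
      moreover have "cross c a * E \<le> H * E" "cross a b * E \<le> H * E"
        using H E by (auto intro: mult_right_mono)
      ultimately have "cross b c * cross a ?y \<le> 2 * (H * E)" by simp
      moreover have "cross a ?y \<le> cross b c * cross a ?y \<or> cross a ?y \<le> 0"
        using nn(2) by (smt (verit) mult_le_cancel_right1)
      moreover have "1 * E \<le> H * E" using nn(2) H(2) E by (intro mult_right_mono) auto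
      ultimately show ?thesis using half(1)[OF P] E by linarith
    qed
    moreover have "0 \<le> H * E" using nn(2) H(2) E by simp
    ultimately show ?thesis using closed_area_strip[of u "2 * (H * E)" a] u abc by simp
  qed
  from pos show ?thesis
    using key[of a b c] key[of b c a] key[of c a b] abc half nn H by blast
qed

end

section \<open>Convexity of paths of maximal area\<close>

definition area_max :: "letter list \<Rightarrow> bool" where
  "area_max u \<longleftrightarrow> (\<forall>u'. mset u' = mset u \<longrightarrow> area u' \<le> area u)"

text \<open>Exchanging the two adjacent blocks lowers the area by \<open>2 * cross (disp B) (disp
C)\<close>.\<close>

lemma area_max_blocks:
  assumes "area_max (U @ B @ C @ Y)"
  shows "0 \<le> cross (disp B) (disp C)"
proof -
  have "area (U @ C @ B @ Y) \<le> area (U @ B @ C @ Y)"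
    using assms unfolding area_max_def by (elim allE[of _ "U @ C @ B @ Y"]) (simp add: ac_simps del: area_append)
  moreover have "area (U @ B @ C @ Y) - area (U @ C @ B @ Y) = 2 * cross (disp B) (disp C)"
    by (simp add: cross_simps cross_swap[of "disp C" "disp B"])
  ultimately show ?thesis by simp
qed

text \<open>The path lies on the left of the line through its step \<open>l\<close>: the step and the block that
leads from it to the point \<open>disp P\<close> (or from there to it) are adjacent blocks.\<close>

lemma area_max_left:
  assumes max: "area_max u" and u: "u = U @ l # Y" "u = P @ Q"
  shows "cross (fst l) (disp U) \<le> cross (fst l) (disp P)"
proof -
  have "U @ l # Y = P @ Q" using u by simp
  then consider U2 where "U = P @ U2" | P2 where "P = U @ l # P2" "Y = P2 @ Q"
    by (auto simp: append_eq_append_conv2 Cons_eq_append_conv)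
  then show ?thesis
  proof cases
    case 1
    then have "u = P @ U2 @ [l] @ Y" using u by simp
    then have "0 \<le> cross (disp U2) (fst l)" using area_max_blocks[of P U2 "[l]" Y] max by simp
    then show ?thesis using 1 by (simp add: cross_simps cross_swap[of "disp U2"])
  next
    case 2
    then have "u = U @ [l] @ P2 @ Q" using u by simp
    then have "0 \<le> cross (fst l) (disp P2)" using area_max_blocks[of U "[l]" P2 Q] max by simp
    then show ?thesis using 2 by (simp add: cross_simps)
  qed
qed

lemma ex_area_max:
  obtains u' where "mset u' = mset u" "area_max u'" "area u \<le> area u'"
proof -
  have fin: "finite {v. mset v = mset u}"
    by (rule finite_subset[OF _ finite_lists_length_eq[OF finite_set[of u], of "length u"]])
      (auto dest: mset_eq_setD mset_eq_length)
  define m where "m = Max (area ` {v. mset v = mset u})"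
  have "m \<in> area ` {v. mset v = mset u}" unfolding m_def using fin by (intro Max_in) auto
  then obtain u' where u': "mset u' = mset u" "area u' = m" by auto
  have le: "area v \<le> m" if "mset v = mset u" for v
    unfolding m_def using fin that by (intro Max_ge) auto
  show thesis using that[of u'] u' le unfolding area_max_def by auto
qed

text \<open>Rotating a closed word changes neither its letters nor its area, so the starting point of a path of
maximal area can be chosen where \<open>cross d\<close> is minimal.\<close>

lemma ex_area_max_based:
  assumes "disp u = 0"
  obtains u' where "mset u' = mset u" "area_max u'" "area u \<le> area u'"
    "\<And>P Q. u' = P @ Q \<Longrightarrow> 0 \<le> cross d (disp P)"
proof -
  obtain u1 where u1: "mset u1 = mset u" "area_max u1" "area u \<le> area u1" by (rule ex_area_max)
  have d1: "disp u1 = 0" using disp_mset[OF u1(1)] assms by simp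
  define K where "K = (\<lambda>i. cross d (disp (take i u1))) ` {..length u1}"
  have "Min K \<in> K" unfolding K_def by (intro Min_in) auto
  then obtain i where i: "Min K = cross d (disp (take i u1))"
    unfolding K_def by (elim imageE)
  define P0 Q0 where "P0 = take i u1" and "Q0 = drop i u1"
  have min: "cross d (disp P0) \<le> cross d (disp P)" if "u1 = P @ Q" for P Q
  proof -
    have "cross d (disp P) \<in> K" unfolding K_def using that
      by (intro image_eqI[of _ _ "length P"]) auto
    moreover have "finite K" by (simp add: K_def)
    ultimately show ?thesis using i by (metis Min_le P0_def)
  qed
  have split: "u1 = P0 @ Q0" by (simp add: P0_def Q0_def)
  then have P0: "disp P0 = - disp Q0" using d1 by (simp add: eq_neg_iff_add_eq_0)
  have ar: "area (Q0 @ P0) = area u1" using split P0 by (simp add: cross_simps)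
  have ms: "mset (Q0 @ P0) = mset u1" by (simp add: split)
  show thesis
  proof (rule that[of "Q0 @ P0"])
    show "mset (Q0 @ P0) = mset u" "area u \<le> area (Q0 @ P0)" "area_max (Q0 @ P0)"
      using ms ar u1 unfolding area_max_def by auto
    fix P Q assume "Q0 @ P0 = P @ Q"
    then consider Q1 where "Q0 = P @ Q1" | P1 P2 where "P = Q0 @ P1" "P0 = P1 @ P2"
      by (auto simp: append_eq_append_conv2)
    then show "0 \<le> cross d (disp P)"
    proof cases
      case 1
      then show ?thesis using min[of "P0 @ P" Q1] split by (simp add: cross_simps)
    next
      case 2
      have "cross d (disp P) = cross d (disp P1) - cross d (disp P0)"
        using 2 P0 by (simp add: cross_simps)
      then show ?thesis using min[of P1 "P2 @ Q0"] split 2 by simp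
    qed
  qed
qed

lemma frequent_element:
  assumes "finite A" "set xs \<subseteq> A" "xs \<noteq> []" "card A * J \<le> length xs"
  obtains s where "s \<in> set xs" "J \<le> count_list xs s"
proof (rule ccontr)
  assume "\<not> thesis"
  then have c: "\<And>s. s \<in> set xs \<Longrightarrow> count_list xs s < J" using that by (meson not_le)
  have "length xs = (\<Sum>s\<in>set xs. count_list xs s)" by (simp add: sum_count_set)
  also have "\<dots> < (\<Sum>s\<in>set xs. J)" using c assms by (intro sum_strict_mono) auto
  also have "\<dots> \<le> card A * J" using card_mono[OF assms(1,2)] by simp
  finally show False using assms(4) by simp
qed

lemma delete_copies_of_letter:
  assumes "a \<le> count_list xs s"
  shows "\<exists>xs'. set xs' \<subseteq> set xs \<and> length xs' \<le> length xs \<and>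
    disp xs = disp xs' + (int a * fst (fst s), int a * snd (fst s))"
  using assms
proof (induction xs arbitrary: a)
  case Nil
  then show ?case by (simp add: zero_prod_def)
next
  case (Cons x xs)
  show ?case
  proof (cases "x = s \<and> a > 0")
    case True
    then have "a - 1 \<le> count_list xs s" using Cons.prems by auto
    from Cons.IH[OF this] obtain xs' where "set xs' \<subseteq> set xs" "length xs' \<le> length xs"
      "disp xs = disp xs' + (int (a - 1) * fst (fst s), int (a - 1) * snd (fst s))" by blast
    then show ?thesis using True
      by (intro exI[of _ xs']) (auto simp: prod_eq_iff of_nat_diff algebra_simps)
  next
    case False
    then have "a \<le> count_list xs s" using Cons.prems by (auto split: if_splits)
    from Cons.IH[OF this] obtain xs' where "set xs' \<subseteq> set xs" "length xs' \<le> length xs"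
      "disp xs = disp xs' + (int a * fst (fst s), int a * snd (fst s))" by blast
    then show ?thesis
      by (intro exI[of _ "x # xs'"]) (auto simp: prod_eq_iff algebra_simps)
  qed
qed

text \<open>An integer vector in the cone of \<open>p\<close> and \<open>q\<close> is an integer combination up
to a bounded vector, the rational coefficients being rounded down.\<close>

lemma cone_rounding:
  fixes N a b :: int
  assumes "N > 0" "N * fst d = a * fst p + b * fst q" "N * snd d = a * snd p + b * snd q"
    "nrm1 p \<le> \<beta>" "nrm1 q \<le> \<beta>"
  shows "nrm1 (d - (a div N * fst p, a div N * snd p) - (b div N * fst q, b div N * snd q)) \<le> 2 * \<beta>"
proof -
  define r where "r = d - (a div N * fst p, a div N * snd p) - (b div N * fst q, b div N * snd q)"
  define a' b' where "a' = a mod N" and "b' = b mod N"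
  have ab: "0 \<le> a'" "a' < N" "0 \<le> b'" "b' < N" using assms(1) by (auto simp: a'_def b'_def)
  have a: "a = N * (a div N) + a'" and b: "b = N * (b div N) + b'" by (auto simp: a'_def b'_def)
  have eq: "N * fst r = a' * fst p + b' * fst q" "N * snd r = a' * snd p + b' * snd q"
  proof -
    have "a * x = (N * (a div N) + a') * x" "b * x = (N * (b div N) + b') * x" for x
      by (simp_all only: a[symmetric] b[symmetric])
    then have "a * x = N * (a div N * x) + a' * x" "b * x = N * (b div N * x) + b' * x" for x
      by (simp_all add: distrib_right mult.assoc)
    from this[of "fst p"] this[of "snd p"] this[of "fst q"] this[of "snd q"]
    show "N * fst r = a' * fst p + b' * fst q" "N * snd r = a' * snd p + b' * snd q"
      unfolding r_def using assms(2,3) by (simp_all add: right_diff_distrib)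
  qed
  have "N * nrm1 r = \<bar>N * fst r\<bar> + \<bar>N * snd r\<bar>" using assms(1) by (simp add: nrm1_def abs_mult algebra_simps)
  also have "\<dots> \<le> a' * nrm1 p + b' * nrm1 q"
  proof -
    have "\<bar>a' * x + b' * y\<bar> \<le> a' * \<bar>x\<bar> + b' * \<bar>y\<bar>" for x y
      using ab abs_triangle_ineq[of "a' * x" "b' * y"] by (simp add: abs_mult)
    from this[of "fst p" "fst q"] this[of "snd p" "snd q"] show ?thesis
      unfolding eq by (simp add: nrm1_def algebra_simps)
  qed
  also have "\<dots> \<le> N * \<beta> + N * \<beta>" using ab assms(4,5) nrm1_props(2)
    by (intro add_mono mult_mono) auto
  finally have "N * nrm1 r \<le> N * (2 * \<beta>)" by simp
  then show ?thesis using assms(1) unfolding r_def[symmetric] by simp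
qed

section \<open>Moving the endpoint of a closed path\<close>

context letters
begin

text \<open>The core of the proof. The closed convex path \<open>u\<close> starts at the vertex where the
direction \<open>d\<close> is supporting. Letters are deleted from the first and the last \<open>L = card A *
J\<close> steps only, which bounds the loss of area by \<open>O(L^2)\<close>. The bound on the area from below
excludes all degenerate positions: each step of the two windows passes within \<open>O(L)\<close> of the
starting point, so it contributes a half plane through the starting point that contains the path up to
\<open>O(L)\<close>, and so does \<open>d\<close>; a nonnegative dependency among such directions would pinch
the path into a strip.\<close>

lemma shift_endpoint_by_deletion:
  assumes uA: "set u \<subseteq> A" and closed: "disp u = 0" and max: "area_max u"
    and noncentral: "\<And>l. l \<in> set u \<Longrightarrow> fst l \<noteq> 0"
    and base: "\<And>P Q. u = P @ Q \<Longrightarrow> 0 \<le> cross d (disp P)"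
    and d: "d \<noteq> 0" "nrm1 d \<le> \<Delta>"
    and J: "int J = \<beta> * \<Delta>" and long: "2 * (card A * J) \<le> length u"
    and fat: "\<beta> * (1 + 4 * ((\<beta> * \<beta> * \<Delta>) * (\<beta> * \<beta> * int (card A * J)))) * int (length u) < area u"
  shows "\<exists>p. set p \<subseteq> A \<and> length p \<le> length u \<and> nrm1 (disp p + d) \<le> 2 * \<beta> \<and>
    area u - 14 * \<beta>\<^sup>2 * (int (card A * J))\<^sup>2 \<le> area p"
proof -
  define L where "L = card A * J"
  define E where "E = \<beta> * \<beta> * int L"
  define H where "H = \<beta> * \<beta> * \<Delta>"
  have E0: "E \<ge> 0" using beta_ge by (simp add: E_def)
  have D1: "1 \<le> \<Delta>" using nrm1_pos[OF d(1)] d(2) by simp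
  define w1 w2 w3 where "w1 = take L u" and "w2 = take (length u - 2 * L) (drop L u)"
    and "w3 = drop (length u - L) u"
  have len: "length w1 = L" "length w3 = L" using long by (auto simp: w1_def w3_def L_def)
  have u: "u = w1 @ w2 @ w3"
  proof -
    have "drop (length u - 2 * L) (drop L u) = w3"
      using long by (simp add: w3_def L_def mult.commute)
    then have "w2 @ w3 = drop L u" unfolding w2_def by (metis append_take_drop_id)
    then show ?thesis by (simp add: w1_def)
  qed
  have sub: "set w1 \<subseteq> A" "set w2 \<subseteq> A" "set w3 \<subseteq> A" using uA u by auto
  \<comment> \<open>the half plane on the left of the direction of \<open>l\<close> contains the path up to \<open>E\<close>\<close>
  define good where "good l \<longleftrightarrow> l \<in> A \<and> fst l \<noteq> 0 \<and>
    (\<forall>P Q. u = P @ Q \<longrightarrow> - E \<le> cross (fst l) (disp P))" for l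
  have good: "good l" if ul: "u = U @ l # Y" and short: "length U < L \<or> length Y < L" for l U Y
  proof -
    have lA: "l \<in> A" "fst l \<noteq> 0" using uA noncentral ul by auto
    have "nrm1 (disp U) \<le> \<beta> * int L"
      using short
    proof
      assume "length U < L"
      then have "\<beta> * int (length U) \<le> \<beta> * int L" using beta_ge by simp
      then show ?thesis using nrm_disp[of U] uA ul by simp
    next
      assume "length Y < L"
      then have "\<beta> * int (length (l # Y)) \<le> \<beta> * int L" using beta_ge by (intro mult_left_mono) auto
      then have "nrm1 (disp (l # Y)) \<le> \<beta> * int L" using nrm_disp[of "l # Y"] uA ul by simp
      moreover have "disp U + disp (l # Y) = 0" using closed ul by simp
      then have "disp U = - disp (l # Y)" by (simp only: eq_neg_iff_add_eq_0)
      ultimately show ?thesis by (simp only: nrm1_props)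
    qed
    then have "nrm1 (fst l) * nrm1 (disp U) \<le> \<beta> * (\<beta> * int L)"
      using nrm_letter[OF lA(1)] beta_ge nrm1_props(2) by (intro mult_mono) auto
    then have "- E \<le> cross (fst l) (disp U)"
      using abs_cross_le[of "fst l" "disp U"] unfolding E_def by (simp add: mult.assoc)
    then show ?thesis unfolding good_def using lA area_max_left[OF max ul] by force
  qed
  have not_pinched: "cross d (fst l) = 0 \<and> cross (fst l) (fst l') = 0 \<and> cross (fst l') d = 0"
    if g: "good l" "good l'" and nn: "0 \<le> cross d (fst l)" "0 \<le> cross (fst l) (fst l')"
      "0 \<le> cross (fst l') d" for l l'
  proof (rule ccontr)
    have lA: "l \<in> A" "l' \<in> A" using g by (auto simp: good_def)
    have "\<bar>cross d (fst k)\<bar> \<le> H" if "k \<in> A" for k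
    proof -
      have "nrm1 d * nrm1 (fst k) \<le> \<Delta> * \<beta>"
        using nrm_letter[OF that] d(2) D1 nrm1_props(2) by (intro mult_mono) auto
      also have "\<dots> \<le> \<Delta> * (\<beta> * \<beta>)" using beta_ge D1 by (intro mult_left_mono) auto
      finally show ?thesis using abs_cross_le[of d "fst k"] by (simp add: H_def ac_simps)
    qed
    from this[OF lA(1)] this[OF lA(2)]
    have H: "cross d (fst l) \<le> H" "cross (fst l') d \<le> H"
      by (auto simp: cross_swap[of "fst l'"])
    have "\<beta> * \<beta> * 1 \<le> H" unfolding H_def using D1 beta_ge by (intro mult_left_mono) auto
    then have H2: "cross (fst l) (fst l') \<le> H" using abs_cross_letters[OF lA] by simp
    assume "\<not> ?thesis"
    then have "0 < cross d (fst l) \<or> 0 < cross (fst l) (fst l') \<or> 0 < cross (fst l') d"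
      using nn by linarith
    moreover have "- E \<le> cross d (disp P)" if "u = P @ Q" for P Q using base[OF that] E0 by simp
    moreover note g[unfolded good_def]
    ultimately have "area u \<le> \<beta> * (1 + 4 * (H * E)) * int (length u)"
      using area_pinched[OF uA closed E0 d(1), of "fst l" "fst l'" H] nn H H2 by blast
    then show False using fat by (simp add: H_def E_def L_def)
  qed
  have good1: "good l" if "l \<in> set w1" for l
  proof -
    obtain U Y where "w1 = U @ l # Y" using split_list[OF \<open>l \<in> set w1\<close>] by auto
    then show ?thesis using good[of U l "Y @ w2 @ w3"] u len by auto
  qed
  have good3: "good l" if "l \<in> set w3" for l
  proof -
    obtain U Y where "w3 = U @ l # Y" using split_list[OF \<open>l \<in> set w3\<close>] by auto
    then show ?thesis using good[of "w1 @ w2 @ U" l "Y"] u len by auto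
  qed
  \<comment> \<open>Think of \<open>cross d\<close> as the height. The path starts at its lowest point, so a descending step
    among the first ones is not the very first, and the step before the first such one is level or
    ascending. By convexity the path turns left from that step into the descending one, hence by
    way of \<open>- d\<close>, and the two steps pinch the path together with \<open>d\<close>.\<close>
  have up: "0 \<le> cross d (fst l)" if "l \<in> set w1" for l
  proof (rule ccontr)
    assume "\<not> ?thesis"
    then have "\<exists>l\<in>set w1. cross d (fst l) < 0" using that by (intro bexI[of _ l]) auto
    then obtain U l Y where s: "w1 = U @ l # Y" "cross d (fst l) < 0"
      "\<forall>k\<in>set U. \<not> cross d (fst k) < 0" using split_list_first_prop[of w1 "\<lambda>l. cross d (fst l) < 0"] by auto
    have "U \<noteq> []"
      using base[of "[l]" "Y @ w2 @ w3"] s u by auto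
    then obtain U' k where U: "U = U' @ [k]" by (metis rev_exhaust)
    have "area_max (U' @ [k] @ [l] @ (Y @ w2 @ w3))" using max u s U by simp
    from area_max_blocks[OF this] have "0 \<le> cross (fst k) (fst l)" by simp
    moreover have "good k" "good l" using good1 s U by auto
    moreover have "0 \<le> cross d (fst k)" using s(3) U by auto
    moreover have "0 < cross (fst l) d" using s(2) by (simp add: cross_swap[of "fst l"])
    ultimately show False using not_pinched[of k l] by linarith
  qed
  have down: "cross d (fst l) \<le> 0" if "l \<in> set w3" for l
  proof (rule ccontr)
    assume "\<not> ?thesis"
    then have "\<exists>l\<in>set w3. cross d (fst l) > 0" using that by (intro bexI[of _ l]) auto
    then obtain U l Y where s: "w3 = U @ l # Y" "cross d (fst l) > 0"
      "\<forall>k\<in>set Y. \<not> cross d (fst k) > 0" using split_list_last_prop[of w3 "\<lambda>l. cross d (fst l) > 0"] by auto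
    have "Y \<noteq> []"
    proof
      assume "Y = []"
      then have "u = (w1 @ w2 @ U) @ [l]" using u s by simp
      then have "0 \<le> cross d (disp (w1 @ w2 @ U))" "disp (w1 @ w2 @ U) = - fst l"
        using base closed by (blast, simp add: eq_neg_iff_add_eq_0 add.assoc)
      then show False using s(2) by (simp only: cross_simps)
    qed
    then obtain k Y' where Y: "Y = k # Y'" by (metis neq_Nil_conv)
    have "area_max ((w1 @ w2 @ U) @ [l] @ [k] @ Y')" using max u s Y by simp
    from area_max_blocks[OF this] have "0 \<le> cross (fst l) (fst k)" by simp
    moreover have "good l" "good k" using good3 s Y by auto
    moreover have "0 \<le> cross (fst k) d" using s(3) Y by (auto simp: cross_swap[of "fst k"])
    ultimately show False using not_pinched[of l k] s(2) by linarith
  qed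
  have J1: "1 \<le> J"
  proof -
    have "1 * 1 \<le> \<beta> * \<Delta>" using beta_ge D1 by (intro mult_mono) auto
    then show ?thesis using J by linarith
  qed
  have L1: "1 \<le> L"
  proof -
    have "u \<noteq> []" using fat by auto
    then have "A \<noteq> {}" using uA by auto
    then have "1 \<le> card A" using finite_A by (simp add: Suc_le_eq card_gt_0_iff)
    then have "1 * 1 \<le> card A * J" using J1 by (intro mult_le_mono) auto
    then show ?thesis by (simp add: L_def)
  qed
  have ne: "w1 \<noteq> []" "w3 \<noteq> []" and long1: "card A * J \<le> length w1" "card A * J \<le> length w3"
    using len L1 by (auto simp: L_def)
  \<comment> \<open>By the pigeonhole principle some letter occurs at least \<open>J\<close> times in each window.\<close>
  obtain s where s: "s \<in> set w1" "J \<le> count_list w1 s"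
    by (rule frequent_element[OF finite_A sub(1) ne(1) long1(1)])
  obtain t where t: "t \<in> set w3" "J \<le> count_list w3 t"
    by (rule frequent_element[OF finite_A sub(3) ne(2) long1(2)])
  define S T where "S = fst s" and "T = fst t"
  have "s \<in> A" "t \<in> A" using s(1) t(1) sub by blast+
  then have ST: "nrm1 S \<le> \<beta>" "nrm1 T \<le> \<beta>" "S \<noteq> 0"
    using nrm_letter good1[OF s(1)] unfolding S_def T_def good_def by blast+
  \<comment> \<open>The direction \<open>d\<close> lies in the cone of the two frequent letters. If these turn left this is
    Cramer's rule; otherwise they pinch the path together with \<open>d\<close>, unless all three are parallel.\<close>
  have "\<exists>N a b. N > 0 \<and> 0 \<le> a \<and> 0 \<le> b \<and> a \<le> \<beta> * \<Delta> \<and> b \<le> \<beta> * \<Delta> \<and>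
    N * fst d = a * fst T + b * fst S \<and> N * snd d = a * snd T + b * snd S"
  proof (cases "0 < cross T S")
    case True
    have "\<bar>cross d k\<bar> \<le> \<beta> * \<Delta>" if "nrm1 k \<le> \<beta>" for k
    proof -
      have "nrm1 d * nrm1 k \<le> \<Delta> * \<beta>" using that d(2) D1 nrm1_props(2) by (intro mult_mono) auto
      then show ?thesis using abs_cross_le[of d k] by (simp add: ac_simps)
    qed
    then have "\<bar>cross d S\<bar> \<le> \<beta> * \<Delta>" "\<bar>cross d T\<bar> \<le> \<beta> * \<Delta>" using ST by auto
    moreover have "0 \<le> cross d S" "cross d T \<le> 0" using up[OF s(1)] down[OF t(1)] by (auto simp: S_def T_def)
    moreover have "cross T S * fst d = cross d S * fst T + (- cross d T) * fst S"
      "cross T S * snd d = cross d S * snd T + (- cross d T) * snd S"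
      by (simp_all add: cross_def algebra_simps)
    ultimately show ?thesis using True
      by (intro exI[of _ "cross T S"] exI[of _ "cross d S"] exI[of _ "- cross d T"]) auto
  next
    case False
    then have "0 \<le> cross S T" by (simp add: cross_swap[of S T])
    then have dS: "cross d S = 0"
      using not_pinched[of s t] good1[OF s(1)] good3[OF t(1)] up[OF s(1)] down[OF t(1)]
      by (simp add: S_def T_def cross_swap[of "fst t" d])
    have par: "dot S S * fst d = dot d S * fst S" "dot S S * snd d = dot d S * snd S"
    proof -
      have "dot S S * fst d - dot d S * fst S = snd S * cross d S"
        "dot S S * snd d - dot d S * snd S = - fst S * cross d S"
        by (simp_all add: dot_def cross_def algebra_simps)
      then show "dot S S * fst d = dot d S * fst S" "dot S S * snd d = dot d S * snd S"
        using dS by simp_all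
    qed
    have pos: "0 < dot S S" using nrm1_le_dot[of S] nrm1_pos[OF ST(3)] by linarith
    have "0 \<le> dot d S"
    proof (rule ccontr)
      assume neg: "\<not> ?thesis"
      have "\<bar>cross S (disp P)\<bar> \<le> E" if P: "u = P @ Q" for P Q
      proof -
        have "dot d S * cross S (disp P) = dot S S * cross d (disp P)"
        proof -
          have "dot S S * cross d (disp P) = (dot S S * fst d) * snd (disp P) - (dot S S * snd d) * fst (disp P)"
            by (simp add: cross_def algebra_simps)
          then show ?thesis unfolding par by (simp add: cross_def algebra_simps)
        qed
        also have "\<dots> \<ge> 0" using base[OF P] pos by simp
        finally have "cross S (disp P) \<le> 0" using neg by (simp add: zero_le_mult_iff)
        moreover have "- E \<le> cross S (disp P)" using good1[OF s(1)] P by (auto simp: good_def S_def)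
        ultimately show ?thesis using E0 by simp
      qed
      then have "area u \<le> \<beta> * (1 + 2 * E) * int (length u)"
        using closed_area_strip[of u E S] uA E0 closed ST(3) by simp
      also have "\<dots> \<le> \<beta> * (1 + 4 * (H * E)) * int (length u)"
      proof -
        have "1 * 1 * 1 \<le> \<beta> * \<beta> * \<Delta>" using beta_ge D1 by (intro mult_mono) auto
        then have "1 * E \<le> H * E" using E0 unfolding H_def by (intro mult_right_mono) auto
        then have "1 + 2 * E \<le> 1 + 4 * (H * E)" using E0 by linarith
        then show ?thesis using beta_ge by (intro mult_right_mono mult_left_mono) auto
      qed
      finally show False using fat by (simp add: H_def E_def L_def)
    qed
    moreover have "dot d S \<le> \<beta> * \<Delta>"
    proof -
      have "nrm1 d * nrm1 S \<le> \<Delta> * \<beta>" using ST d(2) D1 nrm1_props(2) by (intro mult_mono) auto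
      then show ?thesis using abs_dot_le[of d S] by (simp add: ac_simps)
    qed
    ultimately show ?thesis using pos par beta_ge D1
      by (intro exI[of _ "dot S S"] exI[of _ 0] exI[of _ "dot d S"]) auto
  qed
  then obtain N a b where N: "N > 0" and ab: "0 \<le> a" "0 \<le> b" "a \<le> \<beta> * \<Delta>" "b \<le> \<beta> * \<Delta>"
    and cone: "N * fst d = a * fst T + b * fst S" "N * snd d = a * snd T + b * snd S" by blast
  define a' b' where "a' = nat (a div N)" and "b' = nat (b div N)"
  have quot: "0 \<le> x div N" "x div N \<le> x" if "0 \<le> x" for x
    using that N by (auto simp: pos_imp_zdiv_nonneg_iff intro: div_le_dividend order_trans[OF zdiv_mono2[of x 1 N]])
  have ab': "int a' = a div N" "int b' = b div N" "a' \<le> J" "b' \<le> J"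
    using quot[OF ab(1)] quot[OF ab(2)] ab J by (auto simp: a'_def b'_def)
  obtain w1' where w1': "set w1' \<subseteq> set w1" "length w1' \<le> length w1"
    "disp w1 = disp w1' + (int b' * fst S, int b' * snd S)"
    using delete_copies_of_letter[of b' w1 s] s ab' unfolding S_def by auto
  obtain w3' where w3': "set w3' \<subseteq> set w3" "length w3' \<le> length w3"
    "disp w3 = disp w3' + (int a' * fst T, int a' * snd T)"
    using delete_copies_of_letter[of a' w3 t] t ab' unfolding T_def by auto
  have closed': "disp w1 + disp w2 + disp w3 = 0" using closed u by (simp add: add.assoc)
  define p where "p = w1' @ w2 @ w3'"
  have "disp p + d = d - (a div N * fst T, a div N * snd T) - (b div N * fst S, b div N * snd S)"
  proof -
    have "disp p = (disp w1 + disp w2 + disp w3) - (int a' * fst T, int a' * snd T) - (int b' * fst S, int b' * snd S)"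
      unfolding p_def w1'(3) w3'(3) by (simp add: algebra_simps)
    then show ?thesis unfolding closed' ab' by simp
  qed
  then have "nrm1 (disp p + d) \<le> 2 * \<beta>" using cone_rounding[OF N cone ST(2,1)] by (simp only:)
  moreover have "set p \<subseteq> A" "length p \<le> length u" using w1' w3' sub u by (auto simp: p_def)
  moreover have "area u - 14 * \<beta>\<^sup>2 * (int L)\<^sup>2 \<le> area p"
  proof -
    have "disp w2 = (disp w1 + disp w2 + disp w3) - disp w1 - disp w3" by simp
    then have d2: "disp w2 = - disp w1 - disp w3" unfolding closed' by simp
    \<comment> \<open>The displacement of the long middle part is minus the sum of the two windows, and its own area
      is common to both words, so the difference only involves words of length at most \<open>L\<close>.\<close>
    have eq: "area u = area w1 + area w2 + area w3 - cross (disp w1) (disp w3)"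
      "area p = area w1' + area w2 + area w3' - cross (disp w1') (disp w1) - cross (disp w1') (disp w3)
        + cross (disp w1') (disp w3') - cross (disp w1) (disp w3') - cross (disp w3) (disp w3')"
      unfolding u p_def by (simp_all add: d2 cross_simps cross_swap[of "disp w3" "disp w1"])
    have w: "set w1' \<subseteq> A" "set w3' \<subseteq> A" using w1' w3' sub by auto
    have A: "\<bar>area v\<bar> \<le> 2 * (\<beta>\<^sup>2 * (int L)\<^sup>2)" if "set v \<subseteq> A" "length v \<le> L" for v
    proof -
      have "\<beta>\<^sup>2 * (int (length v))\<^sup>2 \<le> \<beta>\<^sup>2 * (int L)\<^sup>2" using that(2) by (intro mult_left_mono power_mono) auto
      then show ?thesis using abs_area[OF that(1)] by simp
    qed
    have C: "\<bar>cross (disp v) (disp w)\<bar> \<le> \<beta>\<^sup>2 * (int L)\<^sup>2"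
      if "set v \<subseteq> A" "length v \<le> L" "set w \<subseteq> A" "length w \<le> L" for v w
    proof -
      have "nrm1 (disp x) \<le> \<beta> * int L" if "set x \<subseteq> A" "length x \<le> L" for x
      proof -
        have "\<beta> * int (length x) \<le> \<beta> * int L" using that(2) beta_ge by (intro mult_left_mono) auto
        then show ?thesis using nrm_disp[OF that(1)] by simp
      qed
      then have "nrm1 (disp v) * nrm1 (disp w) \<le> (\<beta> * int L) * (\<beta> * int L)"
        using that nrm1_props(2) beta_ge by (intro mult_mono) auto
      then show ?thesis using abs_cross_le[of "disp v" "disp w"] by (simp add: power2_eq_square algebra_simps)
    qed
    have l: "length w1 \<le> L" "length w3 \<le> L" "length w1' \<le> L" "length w3' \<le> L" using len w1' w3' by auto
    note A = A[unfolded abs_le_iff] and C = C[unfolded abs_le_iff]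
    show ?thesis
      using A[OF sub(1) l(1)] A[OF sub(3) l(2)] A[OF w(1) l(3)] A[OF w(2) l(4)]
        C[OF sub(1) l(1) sub(3) l(2)] C[OF w(1) l(3) sub(1) l(1)] C[OF w(1) l(3) sub(3) l(2)]
        C[OF w(1) l(3) w(2) l(4)] C[OF sub(1) l(1) w(2) l(4)] C[OF sub(3) l(2) w(2) l(4)]
      unfolding eq mult.assoc by linarith
  qed
  ultimately show ?thesis unfolding L_def by blast
qed

text \<open>The area is the sum over the steps of these contributions, so some step contributes more than the
average.\<close>

lemma heavy_split:
  assumes "q * int (length w) < area w"
  shows "\<exists>U l Y. w = U @ l # Y \<and> q < snd l + cross (disp U) (fst l)"
  using assms
proof (induction w rule: rev_induct)
  case (snoc l w)
  show ?case
  proof (cases "q * int (length w) < area w")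
    case True
    then obtain U k Y where "w = U @ k # Y" "q < snd k + cross (disp U) (fst k)" using snoc.IH by blast
    then show ?thesis by (intro exI[of _ U] exI[of _ k] exI[of _ "Y @ [l]"]) simp
  next
    case False
    then show ?thesis using snoc.prems
      by (intro exI[of _ w] exI[of _ l] exI[of _ "[]"]) (simp add: algebra_simps cross_simps)
  qed
qed simp

text \<open>At a step \<open>l\<close> with a large contribution the initial part \<open>U\<close> of the path
ends far away from the line through the origin in direction \<open>l\<close>. Translating \<open>U\<close> by
\<open>- M * l\<close>, with \<open>M\<close> inverse letters before and \<open>M\<close> copies of
\<open>l\<close> after it, adds a parallelogram of doubled area \<open>2 * M * cross (disp U) (fst
l)\<close>.\<close>

lemma enlarge_area:
  assumes sym: "\<And>l. l \<in> A \<Longrightarrow> - l \<in> A" and w: "set w \<subseteq> A" and q: "q * int (length w) < area w"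
  shows "\<exists>w'. set w' \<subseteq> A \<and> length w' = length w + 2 * M \<and> disp w' = disp w \<and>
    area w + 2 * int M * (q - \<beta>) \<le> area w'"
proof -
  obtain U l Y where s: "w = U @ l # Y" "q < snd l + cross (disp U) (fst l)"
    using heavy_split[OF q] by blast
  have l: "l \<in> A" using s w by auto
  define a where "a = word_power M [- l]"
  define w' where "w' = a @ U @ word_neg a @ l # Y"
  have a: "disp a = (- int M * fst (fst l), - int M * snd (fst l))" by (simp add: a_def disp_word_power)
  have "area w' = area w + 2 * cross (disp a) (disp U)"
    unfolding w'_def s by (simp add: cross_simps cross_swap[of "disp U" "disp a"])
  also have "cross (disp a) (disp U) = int M * cross (disp U) (fst l)"
    by (simp add: a cross_def algebra_simps)
  finally have "area w' = area w + 2 * int M * cross (disp U) (fst l)" by simp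
  moreover have "int M * (q - \<beta>) \<le> int M * cross (disp U) (fst l)"
    using s(2) abs_letter[OF l] by (intro mult_left_mono) auto
  moreover have "set a \<subseteq> A" "set (word_neg a) \<subseteq> A"
    using set_word_power[of M "[- l]"] sym[OF l] l by (auto simp: a_def word_neg_def)
  moreover have "length w' = length w + 2 * M" "disp w' = disp w"
    by (simp_all add: w'_def s a_def length_word_power algebra_simps)
  ultimately show ?thesis using w s by (intro exI[of _ w']) (auto simp: w'_def)
qed

end

section \<open>Tuning the area by permuting letters\<close>

lemma discrete_ivt:
  fixes f :: "nat \<Rightarrow> int"
  assumes "\<And>i. i < n \<Longrightarrow> \<bar>f (Suc i) - f i\<bar> \<le> B" "f n \<le> \<tau>" "\<tau> \<le> f 0" "0 \<le> B"
  shows "\<exists>i\<le>n. \<bar>f i - \<tau>\<bar> \<le> B"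
  using assms
proof (induction n)
  case (Suc n)
  show ?case
  proof (cases "f n \<le> \<tau>")
    case True
    then show ?thesis using Suc by (meson le_SucI less_SucI)
  next
    case False
    then show ?thesis using Suc.prems(1)[of n] Suc.prems(2) by (intro exI[of _ n]) auto
  qed
qed auto

text \<open>The letters of \<open>p\<close> can be moved one after the other to the front of \<open>q\<close> by
exchanging neighbours. One exchange changes the area by at most \<open>2 * \<beta>\<^sup>2\<close>, so the areas
on the way from \<open>q\<close> to \<open>p\<close> leave no larger gap.\<close>

lemma (in letters) permute_to_area:
  assumes "set p \<subseteq> A" "mset q = mset p" "area q \<le> \<tau>" "\<tau> \<le> area p"
  shows "\<exists>p'. mset p' = mset p \<and> \<bar>area p' - \<tau>\<bar> \<le> 2 * \<beta>\<^sup>2"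
  using assms
proof (induction p arbitrary: q \<tau>)
  case Nil
  then show ?case by simp
next
  case (Cons l p)
  then have "l \<in> set q" by (metis list.set_intros(1) mset_eq_setD)
  then obtain q1 q2 where q: "q = q1 @ l # q2" by (meson split_list)
  define q' where "q' = q1 @ q2"
  have q': "mset q' = mset p" using Cons.prems(2) by (simp add: q q'_def)
  then have q'A: "set q' \<subseteq> A" using Cons.prems(1) mset_eq_setD[of q' p] by simp
  define f where "f i = area (take i q' @ l # drop i q')" for i
  have f_n: "f (length q1) = area q" by (simp add: f_def q'_def q)
  show ?case
  proof (cases "\<tau> \<le> f 0")
    case True
    have "\<bar>f (Suc i) - f i\<bar> \<le> 2 * \<beta>\<^sup>2" if "i < length q1" for i
    proof -
      have i: "i < length q'" using that by (simp add: q'_def)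
      define k where "k = q' ! i"
      have k: "take (Suc i) q' = take i q' @ [k]" "drop i q' = k # drop (Suc i) q'"
        using i by (auto simp: k_def take_Suc_conv_app_nth Cons_nth_drop_Suc)
      have "f (Suc i) - f i = - 2 * cross (fst l) (fst k)"
        unfolding f_def k by (simp add: cross_simps cross_swap[of "fst k" "fst l"])
      moreover have "k \<in> A" using i q'A by (auto simp: k_def)
      ultimately show ?thesis using abs_cross_letters[of l k] Cons.prems(1)
        by (simp add: power2_eq_square abs_mult)
    qed
    then obtain i where i: "\<bar>f i - \<tau>\<bar> \<le> 2 * \<beta>\<^sup>2"
      using discrete_ivt[of "length q1" f "2 * \<beta>\<^sup>2" \<tau>] f_n Cons.prems(3) True by auto
    have "mset (take i q' @ l # drop i q') = mset (l # q')"
      by (metis append_take_drop_id mset.simps(2) mset_append union_mset_add_mset_right)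
    then show ?thesis using i q' unfolding f_def by (intro exI[of _ "take i q' @ l # drop i q'"]) simp
  next
    case False
    define \<tau>' where "\<tau>' = \<tau> - snd l - cross (fst l) (disp p)"
    have "area q' \<le> \<tau>'" using False disp_mset[OF q'] by (simp add: f_def \<tau>'_def)
    moreover have "\<tau>' \<le> area p" using Cons.prems(4) by (simp add: \<tau>'_def)
    ultimately obtain p' where p': "mset p' = mset p" "\<bar>area p' - \<tau>'\<bar> \<le> 2 * \<beta>\<^sup>2"
      using Cons.IH[OF _ q'] Cons.prems(1) by (meson set_subset_Cons subset_trans)
    then show ?thesis using disp_mset[OF p'(1)]
      by (intro exI[of _ "l # p'"]) (simp add: \<tau>'_def)
  qed
qed

section \<open>Alphabets of generating sets\<close>

text \<open>What the coordinates of a finite symmetric generating set of \<open>H3\<close> satisfy. The parity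
condition describes the image of the coordinates, and the three words represent \<open>H3_x\<close>,
\<open>H3_y\<close> and \<open>H3_z\<close>.\<close>

definition alphabet :: "letter set \<Rightarrow> bool" where
  "alphabet A \<longleftrightarrow> finite A \<and> (\<forall>l\<in>A. - l \<in> A) \<and> (\<forall>l\<in>A. even (snd l - fst (fst l) * snd (fst l))) \<and>
    (\<exists>w. set w \<subseteq> A \<and> disp w = (1, 0) \<and> area w = 0) \<and>
    (\<exists>w. set w \<subseteq> A \<and> disp w = (0, 1) \<and> area w = 0) \<and>
    (\<exists>w. set w \<subseteq> A \<and> disp w = 0 \<and> area w = 2)"

lemma set_word_neg_alphabet:
  assumes "alphabet A" "set w \<subseteq> A"
  shows "set (word_neg w) \<subseteq> A"
proof
  fix l assume "l \<in> set (word_neg w)"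
  then obtain k where "k \<in> set w" "l = - k" by (auto simp: word_neg_def simp del: uminus_prod_def)
  then show "l \<in> A" using assms by (auto simp: alphabet_def)
qed

lemma alphabet_letters:
  assumes "alphabet A"
  obtains b where "\<And>\<beta>. b \<le> \<beta> \<Longrightarrow> letters A \<beta>"
proof -
  define b where "b = 1 + (\<Sum>l\<in>A. nrm1 (fst l) + \<bar>snd l\<bar>)"
  have fin: "finite A" using assms by (simp add: alphabet_def)
  have le: "nrm1 (fst l) + \<bar>snd l\<bar> \<le> (\<Sum>l\<in>A. nrm1 (fst l) + \<bar>snd l\<bar>)" if "l \<in> A" for l
    using fin that nrm1_props(2) by (intro member_le_sum) auto
  have nn: "0 \<le> (\<Sum>l\<in>A. nrm1 (fst l) + \<bar>snd l\<bar>)" using nrm1_props(2) by (intro sum_nonneg) auto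
  show thesis
  proof (rule that[of b])
    fix \<beta> assume b: "b \<le> \<beta>"
    show "letters A \<beta>"
    proof
      fix l assume "l \<in> A"
      then show "nrm1 (fst l) \<le> \<beta>" "\<bar>snd l\<bar> \<le> \<beta>"
        using le[of l] b nrm1_props(2)[of "fst l"] unfolding b_def by linarith+
    qed (use fin nn b in \<open>simp_all add: b_def\<close>)
  qed
qed

lemma alphabet_short_words:
  assumes "alphabet A"
  obtains \<rho> where "\<And>r. \<exists>w. set w \<subseteq> A \<and> disp w = r \<and> int (length w) \<le> int \<rho> * nrm1 r"
proof -
  obtain wx wy where x: "set wx \<subseteq> A" "disp wx = (1, 0)" and y: "set wy \<subseteq> A" "disp wy = (0, 1)"
    using assms unfolding alphabet_def by auto
  have inv: "set w \<subseteq> A \<Longrightarrow> set (word_neg w) \<subseteq> A" for w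
    using set_word_neg_alphabet[OF assms] .
  have pw: "\<exists>w. set w \<subseteq> A \<and> disp w = (c * fst (disp v), c * snd (disp v)) \<and> length w = nat \<bar>c\<bar> * length v"
    if "set v \<subseteq> A" for c :: int and v
  proof (cases "c \<ge> 0")
    case True
    then show ?thesis using that set_word_power[of "nat c" v]
      by (intro exI[of _ "word_power (nat c) v"]) (auto simp: disp_word_power length_word_power)
  next
    case False
    then show ?thesis using inv[OF that] set_word_power[of "nat (- c)" "word_neg v"]
      by (intro exI[of _ "word_power (nat (- c)) (word_neg v)"]) (auto simp: disp_word_power length_word_power)
  qed
  show thesis
  proof (rule that[of "length wx + length wy"])
    fix r :: "int \<times> int"
    obtain u where u: "set u \<subseteq> A" "disp u = (fst r, 0)" "length u = nat \<bar>fst r\<bar> * length wx"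
      using pw[OF x(1), of "fst r"] x by auto
    obtain v where v: "set v \<subseteq> A" "disp v = (0, snd r)" "length v = nat \<bar>snd r\<bar> * length wy"
      using pw[OF y(1), of "snd r"] y by auto
    have "int (length (u @ v)) \<le> int (length wx + length wy) * nrm1 r"
      using u v by (simp add: nrm1_def algebra_simps)
    then show "\<exists>w. set w \<subseteq> A \<and> disp w = r \<and> int (length w) \<le> int (length wx + length wy) * nrm1 r"
      using u v by (intro exI[of _ "u @ v"]) auto
  qed
qed

text \<open>Commutators of powers of words for \<open>(1, 0)\<close> and \<open>(0, 1)\<close> are
parallelograms, of area quadratic in the length.\<close>

lemma alphabet_fat_loop:
  assumes "alphabet A"
  obtains \<gamma> :: nat where "1 \<le> \<gamma>" "\<And>K. \<gamma> \<le> K \<Longrightarrow>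
    \<exists>w. set w \<subseteq> A \<and> length w \<le> K \<and> disp w = 0 \<and> (int K)\<^sup>2 \<le> int \<gamma> * area w"
proof -
  obtain wx wy where x: "set wx \<subseteq> A" "disp wx = (1, 0)" and y: "set wy \<subseteq> A" "disp wy = (0, 1)"
    using assms unfolding alphabet_def by auto
  have inv: "set w \<subseteq> A \<Longrightarrow> set (word_neg w) \<subseteq> A" for w
    using set_word_neg_alphabet[OF assms] .
  define l where "l = 2 * (length wx + length wy)"
  have "wx \<noteq> []" using x by (auto simp: zero_prod_def)
  then have l1: "1 \<le> l" by (cases wx) (auto simp: l_def)
  show thesis
  proof (rule that[of "2 * l\<^sup>2"])
    show "1 \<le> 2 * l\<^sup>2" using l1 by (simp add: Suc_le_eq)
    fix K assume K: "2 * l\<^sup>2 \<le> K"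
    define a where "a = K div l"
    define u v where "u = word_power a wx" and "v = word_power a wy"
    have u: "set u \<subseteq> A" "disp u = (int a, 0)" "length u = a * length wx"
      using set_word_power[of a wx] x by (auto simp: u_def disp_word_power length_word_power)
    have v: "set v \<subseteq> A" "disp v = (0, int a)" "length v = a * length wy"
      using set_word_power[of a wy] y by (auto simp: v_def disp_word_power length_word_power)
    define w where "w = u @ v @ word_neg u @ word_neg v"
    have len: "length w \<le> K"
    proof -
      have "length w = l * a" by (simp add: w_def u v l_def algebra_simps)
      then show ?thesis by (simp add: a_def)
    qed
    have ar: "area w = 2 * (int a)\<^sup>2"
      by (simp add: w_def cross_simps u v) (simp add: cross_def power2_eq_square)
    have "l * 1 \<le> l * (2 * l)" using l1 by (intro mult_le_mono) auto
    then have "l \<le> K" using K unfolding power2_eq_square by linarith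
    then have "1 \<le> a" using l1 by (simp add: a_def Suc_le_eq div_greater_zero_iff)
    have "K mod l < l" using l1 by simp
    then have "K \<le> l * a + l" unfolding a_def using mult_div_mod_eq[of l K] by linarith
    also have "\<dots> \<le> l * a + l * a" using \<open>1 \<le> a\<close> by simp
    finally have "K \<le> 2 * l * a" by simp
    then have "K\<^sup>2 \<le> (2 * l * a)\<^sup>2" by (intro power_mono) auto
    then have "int (K\<^sup>2) \<le> int ((2 * l * a)\<^sup>2)" by (simp only: of_nat_le_iff)
    then have "(int K)\<^sup>2 \<le> int (2 * l\<^sup>2) * area w" by (simp add: ar power_mult_distrib)
    then show "\<exists>w. set w \<subseteq> A \<and> length w \<le> K \<and> disp w = 0 \<and> (int K)\<^sup>2 \<le> int (2 * l\<^sup>2) * area w"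
      using len u v inv by (intro exI[of _ w]) (auto simp: w_def zero_prod_def)
  qed
qed

text \<open>Letters without displacement have no direction and could fill the windows around the starting point;
leaving them out costs only a linear amount of area.\<close>

lemma (in letters) drop_central_letters:
  assumes "set w \<subseteq> A"
  shows "disp (filter (\<lambda>l. fst l \<noteq> 0) w) = disp w"
    "area w - \<beta> * int (length w) \<le> area (filter (\<lambda>l. fst l \<noteq> 0) w)"
proof -
  show *: "disp (filter (\<lambda>l. fst l \<noteq> 0) w) = disp w" for w by (induction w) auto
  show "area w - \<beta> * int (length w) \<le> area (filter (\<lambda>l. fst l \<noteq> 0) w)" using assms
  proof (induction w)
    case (Cons l w)
    then show ?case using abs_letter[of l] beta_ge *[of w] by (auto simp: algebra_simps cross_simps)
  qed simp
qed

text \<open>The quantitative form for a path \<open>u\<close> whose area is quadratic in the bound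
\<open>K\<close> of its length. The constant \<open>c\<close> is chosen such that
\<open>\<Delta>\<^sup>2\<close> is so small compared with \<open>K\<close> that the windows, whose length is
proportional to \<open>\<Delta>\<close>, are disjoint and the path is too fat to be pinched. The error of the
endpoint is repaired by a short word at the end.\<close>

lemma (in letters) move_endpoint:
  assumes \<rho>: "\<And>r. \<exists>w. set w \<subseteq> A \<and> disp w = r \<and> int (length w) \<le> int \<rho> * nrm1 r"
    and uA: "set u \<subseteq> A" "disp u = 0" "length u \<le> K" and nc: "\<And>l. l \<in> set u \<Longrightarrow> fst l \<noteq> 0"
    and fat: "(int K)\<^sup>2 \<le> 2 * int \<gamma> * area u"
    and v: "nrm1 v \<le> int \<Delta>" "v \<noteq> 0"
    and big: "c \<le> int K" "c * (int \<Delta>)\<^sup>2 \<le> int K"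
      "4 * int \<gamma> * \<beta> + 2 \<le> c" "16 * int \<gamma> * int (card A) * \<beta>^6 \<le> c"
      "16 * int \<gamma> * (int (card A))\<^sup>2 * \<beta>^4 \<le> c" "14 * (int (card A))\<^sup>2 * \<beta>^4 \<le> c"
      "8 * \<beta>^4 * (int \<rho>)\<^sup>2 + 4 * \<beta>\<^sup>2 \<le> c" "2 * \<beta> \<le> c"
  shows "\<exists>p. set p \<subseteq> A \<and> int (length p) \<le> int K + 2 * \<beta> * int \<rho> \<and> disp p = v \<and>
    area u - 3 * int K \<le> area p"
proof -
  define k where "k = int K"
  define D where "D = int \<Delta>"
  define n where "n = int (card A)"
  define J where "J = nat \<beta> * \<Delta>"
  have b0: "0 \<le> \<beta>" using beta_ge by simp
  have D1: "1 \<le> D" using nrm1_pos[OF v(2)] v(1) by (simp add: D_def)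
  have J: "int J = \<beta> * D" using b0 by (simp add: J_def D_def)
  have L: "int (card A * J) = n * (\<beta> * D)" by (simp add: J n_def)
  have k2: "2 \<le> k" 
  proof -
    have "0 \<le> 4 * int \<gamma> * \<beta>" using b0 by simp
    then show ?thesis using big(1,3) unfolding k_def by linarith
  qed
  have cD: "x * D\<^sup>2 \<le> k" if "x \<le> c" for x
  proof -
    have "x * D\<^sup>2 \<le> c * D\<^sup>2" using that by (intro mult_right_mono) auto
    then show ?thesis using big(2) by (simp add: k_def D_def)
  qed
  obtain u' where u': "mset u' = mset u" "area_max u'" "area u \<le> area u'"
    and base: "\<And>P Q. u' = P @ Q \<Longrightarrow> 0 \<le> cross (- v) (disp P)"
    using ex_area_max_based[OF uA(2), of "- v"] by blast
  have su: "set u' = set u" "length u' = length u" "disp u' = 0"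
    using u'(1) disp_mset[OF u'(1)] uA(2) by (auto dest: mset_eq_setD mset_eq_length)
  have fat': "k\<^sup>2 \<le> 2 * int \<gamma> * area u'"
    using fat mult_left_mono[OF u'(3), of "2 * int \<gamma>"] by (simp add: k_def)
  have lenk: "int (length u') \<le> k" using uA(3) su(2) by (simp add: k_def)
  have long: "2 * (card A * J) \<le> length u'"
  proof (rule ccontr)
    assume "\<not> ?thesis"
    then have "int (length u') \<le> 2 * (n * (\<beta> * D))" using L by linarith
    then have "(int (length u'))\<^sup>2 \<le> (2 * (n * (\<beta> * D)))\<^sup>2" by (intro power_mono) auto
    then have "2 * \<beta>\<^sup>2 * (int (length u'))\<^sup>2 \<le> 2 * \<beta>\<^sup>2 * (2 * (n * (\<beta> * D)))\<^sup>2"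
      by (intro mult_left_mono) auto
    also have "\<dots> = 8 * n\<^sup>2 * \<beta>^4 * D\<^sup>2" by (simp add: power_mult_distrib power2_eq_square power4_eq_xxxx)
    finally have le: "2 * \<beta>\<^sup>2 * (int (length u'))\<^sup>2 \<le> 8 * n\<^sup>2 * \<beta>^4 * D\<^sup>2" .
    have "set u' \<subseteq> A" using uA(1) su(1) by simp
    from abs_area[OF this] le have "area u' \<le> 8 * n\<^sup>2 * \<beta>^4 * D\<^sup>2" by linarith
    from mult_left_mono[OF this, of "2 * int \<gamma>"]
    have "2 * int \<gamma> * area u' \<le> (16 * int \<gamma> * n\<^sup>2 * \<beta>^4) * D\<^sup>2" by (simp add: ac_simps)
    with fat' have "k\<^sup>2 \<le> (16 * int \<gamma> * n\<^sup>2 * \<beta>^4) * D\<^sup>2" by linarith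
    also have "\<dots> \<le> k" using cD[OF big(5)] by (simp add: n_def)
    finally have "k * k \<le> k * 1" by (simp add: power2_eq_square)
    then show False using k2 by simp
  qed
  have fat'': "\<beta> * (1 + 4 * ((\<beta> * \<beta> * D) * (\<beta> * \<beta> * int (card A * J)))) * int (length u') < area u'"
  proof -
    define W where "W = \<beta> * (1 + 4 * ((\<beta> * \<beta> * D) * (\<beta> * \<beta> * int (card A * J))))"
    have W: "W = \<beta> + 4 * n * \<beta>^6 * D\<^sup>2"
      unfolding W_def L by (simp add: algebra_simps power2_eq_square eval_nat_numeral)
    have W0: "0 \<le> W" unfolding W using b0 by (simp add: n_def)
    have "2 * (2 * int \<gamma> * W) = 4 * int \<gamma> * \<beta> + (16 * int \<gamma> * n * \<beta>^6) * D\<^sup>2"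
      unfolding W by (simp add: algebra_simps)
    also have "\<dots> < k + k" using cD[OF big(4)] big(1,3) by (simp add: n_def k_def)
    finally have "2 * int \<gamma> * W < k" by linarith
    then have "(2 * int \<gamma> * W) * k < k * k" using k2 by (intro mult_strict_right_mono) auto
    moreover have "2 * int \<gamma> * (W * int (length u')) \<le> 2 * int \<gamma> * (W * k)"
      using lenk W0 by (intro mult_left_mono) auto
    ultimately have "2 * int \<gamma> * (W * int (length u')) < 2 * int \<gamma> * area u'"
      using fat' unfolding power2_eq_square mult.assoc by linarith
    then have "W * int (length u') < area u'" by (rule mult_left_less_imp_less) simp
    then show ?thesis by (simp add: W_def)
  qed
  have "\<exists>p. set p \<subseteq> A \<and> length p \<le> length u' \<and> nrm1 (disp p + - v) \<le> 2 * \<beta> \<and>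
    area u' - 14 * \<beta>\<^sup>2 * (int (card A * J))\<^sup>2 \<le> area p"
    using uA su nc u' base v nrm1_props(3)[of v] J long fat''
    by (intro shift_endpoint_by_deletion[where \<Delta> = D]) (auto simp: D_def)
  then obtain p where p: "set p \<subseteq> A" "length p \<le> length u'" "nrm1 (disp p + - v) \<le> 2 * \<beta>"
    "area u' - 14 * \<beta>\<^sup>2 * (int (card A * J))\<^sup>2 \<le> area p" by blast
  define r where "r = v - disp p"
  have r: "nrm1 r \<le> 2 * \<beta>" using p(3) nrm1_props(3)[of r] by (simp add: r_def)
  obtain q where q: "set q \<subseteq> A" "disp q = r" "int (length q) \<le> int \<rho> * nrm1 r" using \<rho> by blast
  have lq: "int (length q) \<le> 2 * \<beta> * int \<rho>"
    using q(3) mult_left_mono[OF r, of "int \<rho>"] by (simp add: ac_simps)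
  have "14 * \<beta>\<^sup>2 * (int (card A * J))\<^sup>2 = (14 * n\<^sup>2 * \<beta>^4) * D\<^sup>2"
    unfolding L by (simp add: power_mult_distrib power2_eq_square power4_eq_xxxx)
  also have "\<dots> \<le> k" using cD[OF big(6)] by (simp add: n_def)
  finally have 1: "area u - k \<le> area p" using p(4) u'(3) by linarith
  have 2: "\<bar>area q\<bar> \<le> 8 * \<beta>^4 * (int \<rho>)\<^sup>2"
  proof -
    have "2 * \<beta>\<^sup>2 * (int (length q))\<^sup>2 \<le> 2 * \<beta>\<^sup>2 * (2 * \<beta> * int \<rho>)\<^sup>2"
      using lq by (intro mult_left_mono power_mono) auto
    then show ?thesis using abs_area[OF q(1)]
      by (simp add: power_mult_distrib power2_eq_square power4_eq_xxxx)
  qed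
  have 3: "\<bar>cross (disp p) (disp q)\<bar> \<le> 2 * \<beta> * D"
  proof -
    have "cross (disp p) (disp q) = cross v r" unfolding q r_def by (simp add: cross_simps cross_swap[of "disp p" v])
    moreover have "nrm1 v * nrm1 r \<le> D * (2 * \<beta>)"
      using v(1) r nrm1_props(2) by (intro mult_mono) (auto simp: D_def)
    ultimately show ?thesis using abs_cross_le[of v r] by (simp add: ac_simps)
  qed
  have "D * 1 \<le> D * D" using D1 by (intro mult_left_mono) auto
  then have "(2 * \<beta>) * D \<le> (2 * \<beta>) * D\<^sup>2" using b0 unfolding power2_eq_square
    by (intro mult_left_mono) auto
  then have 4: "2 * \<beta> * D \<le> k" using cD[OF big(8)] by linarith
  have "8 * \<beta>^4 * (int \<rho>)\<^sup>2 \<le> k" using big(1,7) zero_le_power2[of \<beta>] unfolding k_def by linarith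
  then have "area u - 3 * k \<le> area (p @ q)" using 1 2 3 4 by simp
  moreover have "int (length (p @ q)) \<le> k + 2 * \<beta> * int \<rho>" using lq p(2) lenk by simp
  moreover have "disp (p @ q) = v" by (simp add: q r_def)
  ultimately show ?thesis using p q by (intro exI[of _ "p @ q"]) (auto simp: k_def)
qed

section \<open>Reaching a prescribed endpoint and area\<close>

text \<open>A closed path enclosing little area is first replaced by a fat one, so that
\<open>move_endpoint\<close> applies; the \<open>O(K)\<close> area that this and the removal of central letters
cost is won back, with a surplus of \<open>K\<close>, by \<open>enlarge_area\<close>. As the resulting area is
quadratic in \<open>K\<close>, the reversed word has area at most 0, so the areas of the two words enclose all
relevant targets.\<close>

lemma alphabet_move_endpoint_gain_area:
  assumes alph: "alphabet A"
  shows "\<exists>C::nat. \<forall>K \<Delta> v w. C \<le> K \<longrightarrow> C * \<Delta>\<^sup>2 \<le> K \<longrightarrow> nrm1 v \<le> int \<Delta> \<longrightarrow>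
    set w \<subseteq> A \<longrightarrow> length w \<le> K \<longrightarrow> disp w = 0 \<longrightarrow>
    (\<exists>p. set p \<subseteq> A \<and> length p \<le> K + C \<and> disp p = v \<and> area w + int K \<le> area p \<and> 0 \<le> area p \<and> area (rev p) \<le> 0)"
proof -
  obtain b where "\<And>\<beta>. b \<le> \<beta> \<Longrightarrow> letters A \<beta>" using alphabet_letters[OF alph] by blast
  then interpret letters A b by blast
  obtain \<rho> where \<rho>: "\<And>r. \<exists>w. set w \<subseteq> A \<and> disp w = r \<and> int (length w) \<le> int \<rho> * nrm1 r"
    using alphabet_short_words[OF alph] by blast
  obtain \<gamma> :: nat where \<gamma>: "1 \<le> \<gamma>" "\<And>K. \<gamma> \<le> K \<Longrightarrow>
    \<exists>w. set w \<subseteq> A \<and> length w \<le> K \<and> disp w = 0 \<and> (int K)\<^sup>2 \<le> int \<gamma> * area w"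
    using alphabet_fat_loop[OF alph] by blast
  define n where "n = int (card A)"
  define g where "g = int \<gamma>"
  define \<tau> where "\<tau> = 2 * b * int \<rho>"
  have g1: "1 \<le> g" using \<gamma>(1) by (simp add: g_def)
  have b1: "1 \<le> b" by (rule beta_ge)
  define c1 c2 c3 c4 c5 c6 where "c1 = 4 * g * b + 2" and "c2 = 16 * g * n * b^6"
    and "c3 = 16 * g * n\<^sup>2 * b^4" and "c4 = 14 * n\<^sup>2 * b^4"
    and "c5 = 8 * b^4 * (int \<rho>)\<^sup>2 + 4 * b\<^sup>2" and "c6 = 8 * g * (b + 4)"
  have nn: "0 \<le> c1" "0 \<le> c2" "0 \<le> c3" "0 \<le> c4" "0 \<le> c5" "0 \<le> c6" "0 \<le> \<tau>"
    using g1 b1 by (simp_all add: c1_def c2_def c3_def c4_def c5_def c6_def \<tau>_def n_def)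
  define c where "c = c1 + c2 + c3 + c4 + c5 + 2 * b + \<tau> + c6"
  have c: "c1 \<le> c" "c2 \<le> c" "c3 \<le> c" "c4 \<le> c" "c5 \<le> c" "2 * b \<le> c" "\<tau> \<le> c" "\<tau> + c6 \<le> c" "0 \<le> c"
    using nn b1 unfolding c_def by linarith+
  have gb: "b \<le> g * b" using mult_right_mono[OF g1, of b] b1 by simp
  show ?thesis
  proof (intro exI[of _ "nat c"] allI impI)
    fix K \<Delta> v w
    assume K: "nat c \<le> K" "nat c * \<Delta>\<^sup>2 \<le> K" and v: "nrm1 v \<le> int \<Delta>"
      and w: "set w \<subseteq> A" "length w \<le> K" "disp w = 0"
    define k where "k = int K"
    have ck: "c \<le> k" using K(1) by (simp add: k_def)
    have cD: "c * (int \<Delta>)\<^sup>2 \<le> k"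
    proof -
      have "int (nat c * \<Delta>\<^sup>2) \<le> k" using K(2) unfolding k_def by (simp only: of_nat_le_iff)
      then show ?thesis using c(9) by simp
    qed
    have c6k: "8 * (g * b) + 32 * g \<le> k" using ck c(8) nn(7) by (simp add: c6_def algebra_simps)
    have k1: "1 \<le> k" using c6k gb b1 g1 by linarith
    have "\<gamma> \<le> K" using c6k gb b1 g1 unfolding k_def g_def by linarith
    then obtain w0 where w0: "set w0 \<subseteq> A" "length w0 \<le> K" "disp w0 = 0" "k\<^sup>2 \<le> g * area w0"
      using \<gamma>(2)[of K] unfolding k_def g_def by auto
    obtain w1 where w1: "set w1 \<subseteq> A" "length w1 \<le> K" "disp w1 = 0" "k\<^sup>2 \<le> g * area w1" "area w \<le> area w1"
    proof (cases "area w \<le> area w0")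
      case True
      then show ?thesis using that[of w0] w0 by simp
    next
      case False
      then have "g * area w0 \<le> g * area w" using g1 by (intro mult_left_mono) auto
      then show ?thesis using that[of w] w w0(4) by linarith
    qed
    define u where "u = filter (\<lambda>l. fst l \<noteq> 0) w1"
    have u: "set u \<subseteq> A" "disp u = 0" "length u \<le> K" "\<And>l. l \<in> set u \<Longrightarrow> fst l \<noteq> 0"
      using w1 drop_central_letters(1)[OF w1(1)] by (auto simp: u_def intro: le_trans[OF length_filter_le])
    have "b * int (length w1) \<le> b * k" using b1 w1(2) unfolding k_def by (intro mult_left_mono) auto
    then have ua: "area w1 - b * k \<le> area u"
      using drop_central_letters(2)[OF w1(1)] unfolding u_def by linarith
    have fat: "k\<^sup>2 \<le> 2 * g * area u"
    proof -
      have "2 * g * (area w1 - b * k) \<le> 2 * g * area u" using ua g1 by (intro mult_left_mono) auto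
      moreover have "2 * (g * b) * k \<le> k * k" using c6k g1 k1 gb b1 by (intro mult_right_mono) linarith+
      ultimately show ?thesis using w1(4) by (simp add: power2_eq_square right_diff_distrib mult.assoc)
    qed
    obtain p where p: "set p \<subseteq> A" "int (length p) \<le> k + \<tau>" "disp p = v" "area u - 3 * k \<le> area p"
    proof (cases "v = 0")
      case True
      then show ?thesis using that[of u] u k1 nn(7) unfolding k_def by auto
    next
      case False
      have "\<exists>p. set p \<subseteq> A \<and> int (length p) \<le> int K + 2 * b * int \<rho> \<and> disp p = v \<and>
        area u - 3 * int K \<le> area p"
        using move_endpoint[OF \<rho> u(1,2,3,4) fat[unfolded k_def g_def] v False ck[unfolded k_def] cD[unfolded k_def]]
          c[unfolded c1_def c2_def c3_def c4_def c5_def n_def g_def] by blast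
      then show ?thesis using that unfolding k_def \<tau>_def by blast
    qed
    have lp: "int (length p) \<le> 2 * k" using p(2) c(7) ck by linarith
    define M where "M = nat (4 * g * (b + 4))"
    have M: "int M = 4 * g * (b + 4)" using g1 b1 by (simp add: M_def)
    \<comment> \<open>\<open>q\<close> is a lower bound, proportional to \<open>k\<close>, for the average contribution of a step to the
      area; with it \<open>M\<close> copies win at least \<open>(b + 4) * k\<close>, while at most \<open>(b + 3) * k\<close> is lost.\<close>
    define q where "q = k div (4 * g)"
    have q: "4 * g * q \<le> k" "k < 4 * g * q + 4 * g"
    proof -
      have "k = 4 * g * q + k mod (4 * g)" by (simp add: q_def)
      moreover have "0 \<le> k mod (4 * g)" "k mod (4 * g) < 4 * g" using g1 by auto
      ultimately show "4 * g * q \<le> k" "k < 4 * g * q + 4 * g" by linarith+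
    qed
    have q0: "0 \<le> q" using k1 g1 by (simp add: q_def pos_imp_zdiv_nonneg_iff)
    have pw: "area w1 - (b + 3) * k \<le> area p" using p(4) ua by (simp add: algebra_simps)
    have "q * int (length p) < area p"
    proof -
      have "2 * g * (q * int (length p)) \<le> 2 * g * (q * (2 * k))"
        using lp q0 g1 by (intro mult_left_mono) auto
      also have "\<dots> = (4 * g * q) * k" by simp
      also have "\<dots> \<le> k * k" using q(1) k1 by (intro mult_right_mono) auto
      finally have 1: "2 * g * (q * int (length p)) \<le> k * k" by simp
      have "(2 * (g * b) + 6 * g) * k < k * k" using c6k gb b1 g1 k1 by (intro mult_strict_right_mono) linarith+
      then have 2: "2 * g * ((b + 3) * k) < k * k" by (simp add: algebra_simps)
      have "2 * g * (area w1 - (b + 3) * k) \<le> 2 * g * area p" using pw g1 by (intro mult_left_mono) auto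
      then have "2 * (g * area w1) - 2 * g * ((b + 3) * k) \<le> 2 * g * area p" by (simp add: right_diff_distrib mult.assoc)
      then have "2 * g * (q * int (length p)) < 2 * g * area p"
        using 1 2 w1(4) unfolding power2_eq_square by linarith
      then show ?thesis by (rule mult_left_less_imp_less) (use g1 in simp)
    qed
    moreover have "\<And>l. l \<in> A \<Longrightarrow> - l \<in> A" using alph by (simp add: alphabet_def)
    ultimately obtain p' where p': "set p' \<subseteq> A" "length p' = length p + 2 * M" "disp p' = disp p"
      "area p + 2 * int M * (q - b) \<le> area p'"
      using enlarge_area[of p q M] p(1) by blast
    have gain: "(b + 4) * k \<le> 2 * int M * (q - b)"
    proof -
      have "k \<le> 8 * (g * q) - 8 * (g * b)" using q(2) c6k gb b1 g1 by (simp add: mult.assoc)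
      then have "k \<le> 8 * g * (q - b)" by (simp add: algebra_simps)
      then have "(b + 4) * k \<le> (b + 4) * (8 * g * (q - b))" using b1 by (intro mult_left_mono) auto
      moreover have "2 * int M * (q - b) = (b + 4) * (8 * g * (q - b))"
        by (simp add: M algebra_simps)
      ultimately show ?thesis by (simp only:)
    qed
    have area: "area w1 + k \<le> area p'" using gain pw p'(4) by (simp add: algebra_simps)
    have len: "int (length p') \<le> k + \<tau> + c6" using p(2) p'(2) M by (simp add: c6_def)
    have "area (rev p') \<le> 0"
    proof -
      have "int (length p') \<le> 4 * k" using len c(8) ck nn k1 by linarith
      then have le: "2 * b * int (length p') \<le> 2 * b * (4 * k)" using b1 by (intro mult_left_mono) auto
      have "g * (2 * b * int (length p')) \<le> g * (2 * b * (4 * k))"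
        by (rule mult_left_mono[OF le]) (use g1 in simp)
      also have "\<dots> = (8 * (g * b)) * k" by simp
      also have "\<dots> \<le> k * k" using c6k g1 k1 by (intro mult_right_mono) linarith+
      also have "\<dots> \<le> g * area w1" using w1(4) by (simp add: power2_eq_square)
      also have "\<dots> \<le> g * area p'" using area k1 g1 by (intro mult_left_mono) auto
      finally have "2 * b * int (length p') \<le> area p'" using g1 by simp
      then show ?thesis using area_rev_le[OF p'(1)] by linarith
    qed
    moreover have "0 \<le> area w1"
    proof -
      have "0 \<le> g * area w1" using w1(4) zero_le_power2[of k] by linarith
      then show ?thesis using g1 by (simp add: zero_le_mult_iff)
    qed
    moreover have "length p' \<le> K + nat c"
      using len c(8) c(9) unfolding k_def by linarith
    ultimately show "\<exists>p. set p \<subseteq> A \<and> length p \<le> K + nat c \<and> disp p = v \<and> area w + int K \<le> area p \<and> 0 \<le> area p \<and> area (rev p) \<le> 0"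
      using p' p(3) area w1(5) k1 unfolding k_def by (intro exI[of _ p']) auto
  qed
qed

lemma area_parity:
  assumes "\<And>l. l \<in> set w \<Longrightarrow> even (snd l - fst (fst l) * snd (fst l))"
  shows "even (area w - fst (disp w) * snd (disp w))"
  using assms
proof (induction w)
  case (Cons l w)
  have "even (snd l - fst (fst l) * snd (fst l))" using Cons.prems by simp
  moreover have "even (area w - fst (disp w) * snd (disp w))" using Cons by simp
  moreover have "area (l # w) - fst (disp (l # w)) * snd (disp (l # w)) =
    (snd l - fst (fst l) * snd (fst l)) + (area w - fst (disp w) * snd (disp w)) - 2 * (snd (fst l) * fst (disp w))"
    by (simp add: cross_def algebra_simps)
  ultimately show ?case by (metis dvd_add dvd_diff dvd_triv_left)
qed simp

lemma split_target:
  fixes lo hi :: "nat \<Rightarrow> int"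
  assumes "\<And>i. i < m \<Longrightarrow> lo i \<le> hi i" "(\<Sum>i<m. lo i) \<le> \<tau>" "\<tau> \<le> (\<Sum>i<m. hi i)"
  shows "\<exists>t. (\<forall>i<m. lo i \<le> t i \<and> t i \<le> hi i) \<and> (\<Sum>i<m. t i) = \<tau>"
  using assms
proof (induction m arbitrary: \<tau>)
  case (Suc m)
  define x where "x = max (lo m) (\<tau> - (\<Sum>i<m. hi i))"
  have x: "lo m \<le> x" "x \<le> hi m" "\<tau> - x \<le> (\<Sum>i<m. hi i)"
    using Suc.prems by (auto simp: x_def)
  have "(\<Sum>i<m. lo i) \<le> \<tau> - x"
  proof -
    have "(\<Sum>i<m. lo i) \<le> (\<Sum>i<m. hi i)" using Suc.prems(1) by (intro sum_mono) auto
    then show ?thesis using Suc.prems(2) by (auto simp: x_def)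
  qed
  with x obtain t where t: "\<forall>i<m. lo i \<le> t i \<and> t i \<le> hi i" "(\<Sum>i<m. t i) = \<tau> - x"
    using Suc.IH[of "\<tau> - x"] Suc.prems(1) by auto
  show ?case
    by (rule exI[of _ "t(m := x)"]) (use t x in \<open>auto simp: less_Suc_eq\<close>)
qed auto

text \<open>The element with vectors \<open>V\<close> and integer \<open>\<tau>\<close> has word length at most
\<open>k\<close>, in coordinates: each factor has its own word, and only the sum of the areas matters because
the centres are identified.\<close>

definition reach :: "nat \<Rightarrow> (nat \<Rightarrow> letter set) \<Rightarrow> nat \<Rightarrow> (nat \<Rightarrow> int \<times> int) \<Rightarrow> int \<Rightarrow> bool" where
  "reach m \<A> k V \<tau> \<longleftrightarrow> (\<exists>ws. (\<forall>i<m. set (ws i) \<subseteq> \<A> i \<and> length (ws i) \<le> k \<and> disp (ws i) = V i) \<and>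
    (\<Sum>i<m. area (ws i)) = \<tau>)"

lemma reach_parity:
  assumes "\<And>i. i < m \<Longrightarrow> alphabet (\<A> i)" "reach m \<A> k V \<tau>"
  shows "even (\<tau> - (\<Sum>i<m. fst (V i) * snd (V i)))"
proof -
  obtain ws where ws: "\<And>i. i < m \<Longrightarrow> set (ws i) \<subseteq> \<A> i \<and> disp (ws i) = V i" "(\<Sum>i<m. area (ws i)) = \<tau>"
    using assms(2) unfolding reach_def by blast
  have "\<tau> - (\<Sum>i<m. fst (V i) * snd (V i)) = (\<Sum>i<m. area (ws i) - fst (disp (ws i)) * snd (disp (ws i)))"
    using ws by (simp add: sum_subtractf flip: ws(2))
  moreover
  have "even (area (ws i) - fst (disp (ws i)) * snd (disp (ws i)))" if "i < m" for i
    using assms(1)[OF that] ws(1)[OF that] unfolding alphabet_def by (intro area_parity) blast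
  then have "even (\<Sum>i<m. area (ws i) - fst (disp (ws i)) * snd (disp (ws i)))"
    by (intro dvd_sum) blast
  ultimately show ?thesis by (simp only:)
qed

lemma alphabet_central_words:
  assumes "alphabet A"
  obtains z :: nat where "\<And>c. \<exists>w. set w \<subseteq> A \<and> disp w = 0 \<and> area w = 2 * c \<and> length w \<le> z * nat \<bar>c\<bar>"
proof -
  obtain wz where wz: "set wz \<subseteq> A" "disp wz = 0" "area wz = 2"
    using assms unfolding alphabet_def by auto
  show thesis
  proof (rule that[of "length wz"])
    fix c :: int
    show "\<exists>w. set w \<subseteq> A \<and> disp w = 0 \<and> area w = 2 * c \<and> length w \<le> length wz * nat \<bar>c\<bar>"
    proof (cases "c \<ge> 0")
      case True
      then show ?thesis using wz set_word_power[of "nat c" wz]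
        by (intro exI[of _ "word_power (nat c) wz"]) (auto simp: disp_word_power area_word_power length_word_power zero_prod_def)
    next
      case False
      then show ?thesis using wz set_word_power[of "nat (- c)" "word_neg wz"] set_word_neg_alphabet[OF assms wz(1)]
        by (intro exI[of _ "word_power (nat (- c)) (word_neg wz)"]) (auto simp: disp_word_power area_word_power length_word_power zero_prod_def)
    qed
  qed
qed

text \<open>The theorem in coordinates. From \<open>n = O(k^2)\<close> and \<open>n \<ge> C * D ^ 4\<close>
follows that \<open>k\<close> is at least a large multiple of \<open>D\<^sup>2\<close>, so in each factor the
endpoint can be moved with a surplus \<open>k\<close> of area, which pays for \<open>\<tau>\<close>. The total
area is then lowered to \<open>2 * n + \<tau>\<close>; the remaining error is even and is repaired by central
words in factor 0.\<close>

lemma reach_translate: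
  assumes m: "1 \<le> m" and alph: "\<And>i. i < m \<Longrightarrow> alphabet (\<A> i)"
  shows "\<exists>C M :: nat. \<forall>D k j n V \<tau>. 1 \<le> D \<longrightarrow> int (C * D ^ 4) \<le> n \<longrightarrow> j \<le> D \<longrightarrow>
    reach m \<A> k (\<lambda>_. 0) (2 * n) \<longrightarrow> reach m \<A> j V \<tau> \<longrightarrow> reach m \<A> (k + M) V (2 * n + \<tau>)"
proof -
  define P where "P A C \<longleftrightarrow> (\<forall>K \<Delta> v w. C \<le> K \<longrightarrow> C * \<Delta>\<^sup>2 \<le> K \<longrightarrow> nrm1 v \<le> int \<Delta> \<longrightarrow>
    set w \<subseteq> A \<longrightarrow> length w \<le> K \<longrightarrow> disp w = 0 \<longrightarrow>
    (\<exists>p. set p \<subseteq> A \<and> length p \<le> K + C \<and> disp p = v \<and> area w + int K \<le> area p \<and> 0 \<le> area p \<and>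
      area (rev p) \<le> 0))" for A and C :: nat
  have "\<exists>C. \<forall>i<m. P (\<A> i) (C i)"
    using alphabet_move_endpoint_gain_area[OF alph] unfolding P_def by (intro choice allI) blast
  then obtain Cf where Cf: "\<And>i. i < m \<Longrightarrow> P (\<A> i) (Cf i)" by blast
  have "\<exists>b. \<forall>\<beta>. b \<le> \<beta> \<longrightarrow> letters (\<A> i) \<beta>" if "i < m" for i
    using alphabet_letters[OF alph[OF that]] by metis
  then have "\<exists>b. \<forall>i<m. \<forall>\<beta>. b i \<le> \<beta> \<longrightarrow> letters (\<A> i) \<beta>" by (intro choice allI) blast
  then obtain b where b: "\<And>i \<beta>. i < m \<Longrightarrow> b i \<le> \<beta> \<Longrightarrow> letters (\<A> i) \<beta>" by blast
  define B where "B = 1 + (\<Sum>i<m. nat \<bar>b i\<bar>)"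
  define E where "E = (\<Sum>i<m. Cf i)"
  have letB: "letters (\<A> i) (int B)" if "i < m" for i
  proof -
    have "nat \<bar>b i\<bar> \<le> (\<Sum>i<m. nat \<bar>b i\<bar>)" using that by (intro member_le_sum) auto
    then have "b i \<le> int B" unfolding B_def by linarith
    then show ?thesis using b that by blast
  qed
  have CE: "Cf i \<le> E" if "i < m" for i
    unfolding E_def using that by (intro member_le_sum) auto
  obtain z :: nat where z: "\<And>c. \<exists>w. set w \<subseteq> \<A> 0 \<and> disp w = 0 \<and> area w = 2 * c \<and> length w \<le> z * nat \<bar>c\<bar>"
    using alphabet_central_words[OF alph[of 0]] m by auto
  define Q where "Q = (E + 2 * m) * B\<^sup>2"
  have B1: "1 \<le> B" by (simp add: B_def)
  have mB: "1 \<le> m * B\<^sup>2" using m B1 by (simp add: Suc_le_eq)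
  define C where "C = Q\<^sup>2 * (m * B\<^sup>2)"
  define M where "M = E + z * (m * B\<^sup>2)"
  have Q: "E * B\<^sup>2 \<le> Q" "2 * (m * B\<^sup>2) \<le> Q" by (simp_all add: Q_def algebra_simps)
  have QC: "Q \<le> C"
  proof -
    have "1 \<le> Q" using Q(2) mB by linarith
    then have "1 * 1 \<le> Q * (m * B\<^sup>2)" using mB by (intro mult_le_mono) auto
    then have "Q * 1 \<le> Q * (Q * (m * B\<^sup>2))" by (intro mult_left_mono) auto
    then show ?thesis by (simp add: C_def power2_eq_square ac_simps)
  qed
  show ?thesis
  proof (rule exI[of _ C], rule exI[of _ M], intro allI impI)
    fix D k j :: nat and n :: int and V \<tau>
    assume D: "1 \<le> D" and n: "int (C * D ^ 4) \<le> n" and j: "j \<le> D"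
      and rk: "reach m \<A> k (\<lambda>_. 0) (2 * n)" and rj: "reach m \<A> j V \<tau>"
    obtain ws where ws: "\<And>i. i < m \<Longrightarrow> set (ws i) \<subseteq> \<A> i \<and> length (ws i) \<le> k \<and> disp (ws i) = 0"
      "(\<Sum>i<m. area (ws i)) = 2 * n" using rk unfolding reach_def by blast
    obtain vs where vs: "\<And>i. i < m \<Longrightarrow> set (vs i) \<subseteq> \<A> i \<and> length (vs i) \<le> j \<and> disp (vs i) = V i"
      "(\<Sum>i<m. area (vs i)) = \<tau>" using rj unfolding reach_def by blast
    have area_le: "\<bar>area w\<bar> \<le> int (2 * B\<^sup>2 * l\<^sup>2)" if "i < m" "set w \<subseteq> \<A> i" "length w \<le> l" for i w l
    proof -
      have "(length w)\<^sup>2 \<le> l\<^sup>2" using that(3) by (intro power_mono) auto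
      then have "2 * B\<^sup>2 * (length w)\<^sup>2 \<le> 2 * B\<^sup>2 * l\<^sup>2" by (intro mult_left_mono) auto
      then have "int (2 * B\<^sup>2 * (length w)\<^sup>2) \<le> int (2 * B\<^sup>2 * l\<^sup>2)" by (simp only: of_nat_le_iff)
      then show ?thesis using letters.abs_area[OF letB[OF that(1)] that(2)] by simp
    qed
    have "2 * n \<le> (\<Sum>i<m. int (2 * B\<^sup>2 * k\<^sup>2))"
      unfolding ws(2)[symmetric] using area_le ws(1) by (intro sum_mono) (meson abs_le_D1 lessThan_iff)
    then have "n \<le> int ((m * B\<^sup>2) * k\<^sup>2)" by simp
    then have "int ((m * B\<^sup>2) * (Q * D\<^sup>2)\<^sup>2) \<le> int ((m * B\<^sup>2) * k\<^sup>2)"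
      using n by (simp add: C_def power_mult_distrib ac_simps flip: power_mult)
    then have "(Q * D\<^sup>2)\<^sup>2 \<le> k\<^sup>2" using mB B1 by (simp only: of_nat_le_iff) (simp del: power2_nat_le_eq_le)
    then have QD: "Q * D\<^sup>2 \<le> k" by (simp add: power2_nat_le_eq_le)
    have ED: "E * (B * D)\<^sup>2 \<le> k"
    proof -
      have "E * (B * D)\<^sup>2 = E * B\<^sup>2 * D\<^sup>2" by (simp add: power_mult_distrib)
      also have "\<dots> \<le> Q * D\<^sup>2" using Q(1) by (intro mult_right_mono) auto
      finally show ?thesis using QD by linarith
    qed
    have Ek: "E \<le> k"
    proof -
      have "1 \<le> (B * D)\<^sup>2" using B1 D by (simp add: Suc_le_eq)
      then have "E * 1 \<le> E * (B * D)\<^sup>2" by (intro mult_left_mono) auto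
      then show ?thesis using ED by linarith
    qed
    have tau: "\<bar>\<tau>\<bar> \<le> int (Q * D\<^sup>2)"
    proof -
      have "\<bar>\<tau>\<bar> \<le> (\<Sum>i<m. \<bar>area (vs i)\<bar>)" unfolding vs(2)[symmetric] by (rule sum_abs)
      also have "\<dots> \<le> (\<Sum>i<m. int (2 * B\<^sup>2 * D\<^sup>2))"
        using area_le vs(1) j by (intro sum_mono) (meson lessThan_iff le_trans)
      also have "\<dots> = int (2 * (m * B\<^sup>2) * D\<^sup>2)" by simp
      also have "\<dots> \<le> int (Q * D\<^sup>2)" unfolding of_nat_le_iff using Q(2) by (intro mult_right_mono) auto
      finally show ?thesis by simp
    qed
    then have tauk: "\<tau> \<le> int k" using QD by linarith
    have taun: "- \<tau> \<le> n" "0 \<le> n"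
    proof -
      have "D ^ 2 \<le> D ^ 4" using D by (intro power_increasing) auto
      then have "Q * D\<^sup>2 \<le> C * D ^ 4" using QC by (intro mult_mono) auto
      then show "- \<tau> \<le> n" "0 \<le> n" using tau n by linarith+
    qed
    have "\<exists>p. set p \<subseteq> \<A> i \<and> length p \<le> k + E \<and> disp p = V i \<and> area (ws i) + int k \<le> area p \<and>
      0 \<le> area p \<and> area (rev p) \<le> 0" if i: "i < m" for i
    proof -
      have "nrm1 (V i) \<le> int (B * D)"
      proof -
        have "nrm1 (V i) \<le> int B * int (length (vs i))"
          using letters.nrm_disp[OF letB[OF i], of "vs i"] vs(1)[OF i] by simp
        also have "\<dots> \<le> int B * int D" using vs(1)[OF i] j by (intro mult_left_mono) auto
        finally show ?thesis by simp
      qed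
      moreover have "Cf i * (B * D)\<^sup>2 \<le> E * (B * D)\<^sup>2" using CE[OF i] by (intro mult_right_mono) auto
      ultimately obtain p where "set p \<subseteq> \<A> i" "length p \<le> k + Cf i" "disp p = V i"
        "area (ws i) + int k \<le> area p" "0 \<le> area p" "area (rev p) \<le> 0"
        using Cf[OF i] ws(1)[OF i] CE[OF i] Ek ED unfolding P_def by (meson le_trans)
      then show ?thesis using CE[OF i] by (intro exI[of _ p]) auto
    qed
    then have "\<exists>p. \<forall>i<m. set (p i) \<subseteq> \<A> i \<and> length (p i) \<le> k + E \<and> disp (p i) = V i \<and>
      area (ws i) + int k \<le> area (p i) \<and> 0 \<le> area (p i) \<and> area (rev (p i)) \<le> 0"
      by (intro choice allI) blast
    then obtain p where p: "\<And>i. i < m \<Longrightarrow> set (p i) \<subseteq> \<A> i \<and> length (p i) \<le> k + E \<and> disp (p i) = V i \<and>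
      area (ws i) + int k \<le> area (p i) \<and> 0 \<le> area (p i) \<and> area (rev (p i)) \<le> 0" by blast
    have lo: "(\<Sum>i<m. area (rev (p i))) \<le> 2 * n + \<tau>"
    proof -
      have "(\<Sum>i<m. area (rev (p i))) \<le> 0" using p by (intro sum_nonpos) auto
      then show ?thesis using taun by linarith
    qed
    have hi: "2 * n + \<tau> \<le> (\<Sum>i<m. area (p i))"
    proof -
      have "1 * int k \<le> int m * int k" using m by (intro mult_right_mono) auto
      then have "2 * n + \<tau> \<le> 2 * n + int m * int k" using tauk by linarith
      also have "\<dots> = (\<Sum>i<m. area (ws i) + int k)" by (simp add: sum.distrib ws(2))
      also have "\<dots> \<le> (\<Sum>i<m. area (p i))" using p by (intro sum_mono) auto
      finally show ?thesis by simp
    qed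
    obtain t where t: "\<And>i. i < m \<Longrightarrow> area (rev (p i)) \<le> t i \<and> t i \<le> area (p i)" "(\<Sum>i<m. t i) = 2 * n + \<tau>"
      using split_target[OF _ lo hi] p by (meson order_trans)
    have "\<exists>q. mset q = mset (p i) \<and> \<bar>area q - t i\<bar> \<le> 2 * (int B)\<^sup>2" if i: "i < m" for i
      using letters.permute_to_area[OF letB[OF i], of "p i" "rev (p i)" "t i"] p[OF i] t(1)[OF i] by simp
    then have "\<exists>q. \<forall>i<m. mset (q i) = mset (p i) \<and> \<bar>area (q i) - t i\<bar> \<le> 2 * (int B)\<^sup>2"
      by (intro choice allI) blast
    then obtain q where q: "\<And>i. i < m \<Longrightarrow> mset (q i) = mset (p i) \<and> \<bar>area (q i) - t i\<bar> \<le> 2 * (int B)\<^sup>2" by blast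
    have qp: "set (q i) \<subseteq> \<A> i \<and> length (q i) \<le> k + E \<and> disp (q i) = V i" if "i < m" for i
      using q[OF that] p[OF that] mset_eq_setD[of "q i" "p i"] mset_eq_length[of "q i" "p i"] disp_mset[of "q i" "p i"] by auto
    define e where "e = 2 * n + \<tau> - (\<Sum>i<m. area (q i))"
    have "reach m \<A> (k + E) V (\<Sum>i<m. area (q i))" unfolding reach_def using qp by blast
    from dvd_diff[OF reach_parity[OF alph rj] reach_parity[OF alph this]]
    have "even (\<tau> - (\<Sum>i<m. area (q i)))" by simp
    then have "even e" unfolding e_def by simp
    then obtain c where c: "e = 2 * c" by blast
    have "\<bar>e\<bar> \<le> (\<Sum>i<m. \<bar>t i - area (q i)\<bar>)"
      unfolding e_def t(2)[symmetric] sum_subtractf[symmetric] by (rule sum_abs)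
    also have "\<dots> \<le> (\<Sum>i<m. 2 * (int B)\<^sup>2)" using q by (intro sum_mono) (simp add: abs_minus_commute)
    finally have "\<bar>c\<bar> \<le> int (m * B\<^sup>2)" using c by simp
    then have cM: "z * nat \<bar>c\<bar> \<le> z * (m * B\<^sup>2)" by (intro mult_left_mono) linarith+
    obtain w where w: "set w \<subseteq> \<A> 0" "disp w = 0" "area w = 2 * c" "length w \<le> z * nat \<bar>c\<bar>" using z by blast
    define r where "r i = (if i = 0 then q 0 @ w else q i)" for i
    have "area (r i) = area (q i) + (if i = 0 then 2 * c else 0)" for i by (simp add: r_def w cross_simps)
    then have "(\<Sum>i<m. area (r i)) = 2 * n + \<tau>"
      using m c by (simp add: sum.distrib e_def)
    moreover have "set (r i) \<subseteq> \<A> i \<and> length (r i) \<le> k + M \<and> disp (r i) = V i" if "i < m" for i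
      using qp[OF that] w(1,2) le_trans[OF w(4) cM] by (auto simp: r_def M_def)
    ultimately show "reach m \<A> (k + M) V (2 * n + \<tau>)" unfolding reach_def by blast
  qed
qed

section \<open>Coordinates on the Heisenberg group\<close>

text \<open>The generators become \<open>(1, 0)\<close> and \<open>(0, 1)\<close> with second entry 0. In these
symmetric coordinates the commutator of the generators is \<open>(0, 2)\<close>.\<close>

definition heis_letter :: "heis_gen \<times> bool \<Rightarrow> letter" where
  "heis_letter l = (let v = (case fst l of gen_x \<Rightarrow> (1, 0) | gen_y \<Rightarrow> (0, 1))
    in (if snd l then v else - v, 0))"

abbreviation heis_letters :: "heis_gen word \<Rightarrow> letter list" where
  "heis_letters \<equiv> map heis_letter"

lemma heis_letter_not [simp]: "heis_letter (a, \<not> s) = - heis_letter (a, s)"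
  by (simp add: heis_letter_def Let_def uminus_prod_def)

lemma heis_letters_inv: "heis_letters (word_inv u) = word_neg (heis_letters u)"
proof -
  have "heis_letter (case l of (a, s) \<Rightarrow> (a, \<not> s)) = - heis_letter l" for l
    by (cases l) simp
  then show ?thesis by (simp add: word_inv_def word_neg_def rev_map comp_def del: uminus_prod_def)
qed

text \<open>A commutator has no displacement, and a word without displacement commutes with every word in
coordinates; so the relators are trivial.\<close>

lemma pres_eq_heis:
  assumes "pres_eq heis_relators u v"
  shows "disp (heis_letters u) = disp (heis_letters v) \<and> area (heis_letters u) = area (heis_letters v)"
  using assms
proof (induction rule: pres_eq.induct)
  case (pres_cancel a s)
  then show ?case by (simp add: cross_simps del: uminus_prod_def)
next
  case (pres_relator r)
  have comm: "disp (heis_letters (word_comm u v)) = 0"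
    "area (heis_letters (word_comm u v)) = 2 * cross (disp (heis_letters u)) (disp (heis_letters v))" for u v
    by (simp_all add: word_comm_def heis_letters_inv cross_simps cross_swap[of "disp (heis_letters v)"])
  obtain w where "r = word_comm (word_comm [(gen_x, True)] [(gen_y, True)]) w"
    using pres_relator by (auto simp: heis_relators_def)
  then show ?case by (simp add: comm cross_simps)
qed auto

definition coords :: "heis_gen word set \<Rightarrow> letter" where
  "coords g = (let u = (SOME u. g = pres_class heis_relators u)
    in (disp (heis_letters u), area (heis_letters u)))"

lemma coords_class: "coords (pres_class heis_relators u) = (disp (heis_letters u), area (heis_letters u))"
proof -
  define u' where "u' = (SOME v. pres_class heis_relators u = pres_class heis_relators v)"
  have "pres_class heis_relators u = pres_class heis_relators u'"
    unfolding u'_def by (rule someI[of _ u]) simp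
  then have "pres_eq heis_relators u u'" by (simp only: pres_class_eq_iff)
  moreover have "coords (pres_class heis_relators u) = (disp (heis_letters u'), area (heis_letters u'))"
    by (simp only: coords_def Let_def u'_def)
  ultimately show ?thesis using pres_eq_heis by simp
qed

lemma H3_classE:
  assumes "g \<in> carrier H3"
  obtains u where "g = pres_class heis_relators u"
  using assms by (auto simp: H3_def carrier_pres_group)

interpretation H3: group H3 by (rule group_H3)

lemma coords_mult:
  assumes "g \<in> carrier H3" "h \<in> carrier H3"
  shows "fst (coords (g \<otimes>\<^bsub>H3\<^esub> h)) = fst (coords g) + fst (coords h)"
    "snd (coords (g \<otimes>\<^bsub>H3\<^esub> h)) = snd (coords g) + snd (coords h) + cross (fst (coords g)) (fst (coords h))"
proof -
  obtain u v where "g = pres_class heis_relators u" "h = pres_class heis_relators v"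
    using assms by (auto elim!: H3_classE)
  then show "fst (coords (g \<otimes>\<^bsub>H3\<^esub> h)) = fst (coords g) + fst (coords h)"
    "snd (coords (g \<otimes>\<^bsub>H3\<^esub> h)) = snd (coords g) + snd (coords h) + cross (fst (coords g)) (fst (coords h))"
    by (simp_all add: H3_def mult_pres_group coords_class)
qed

lemma coords_one [simp]: "coords \<one>\<^bsub>H3\<^esub> = 0"
  by (simp add: H3_def one_pres_group coords_class zero_prod_def)

lemma coords_inv:
  assumes "g \<in> carrier H3"
  shows "coords (inv\<^bsub>H3\<^esub> g) = - coords g"
proof -
  obtain u where "g = pres_class heis_relators u" using assms by (elim H3_classE)
  then show ?thesis by (simp add: H3_def inv_pres_group coords_class heis_letters_inv)
qed

lemma H3_gens_closed: "H3_x \<in> carrier H3" "H3_y \<in> carrier H3"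
  by (simp_all add: H3_x_def H3_y_def H3_def carrier_pres_group)

lemma coords_gens: "coords H3_x = ((1, 0), 0)" "coords H3_y = ((0, 1), 0)" "coords H3_z = (0, 2)"
  by (simp_all add: H3_x_def H3_y_def H3_z_word coords_class heis_letter_def word_comm_def word_inv_def
      cross_def zero_prod_def)

lemma coords_int_pow:
  fixes n :: int
  assumes "g \<in> carrier H3"
  shows "coords (g [^]\<^bsub>H3\<^esub> n) = ((n * fst (fst (coords g)), n * snd (fst (coords g))), n * snd (coords g))"
proof -
  have nat: "coords (g [^]\<^bsub>H3\<^esub> k) =
    ((int k * fst (fst (coords g)), int k * snd (fst (coords g))), int k * snd (coords g))" for k :: nat
  proof (induction k)
    case (Suc k)
    then show ?case using assms
      by (intro prod_eqI) (simp_all add: coords_mult cross_def algebra_simps prod_eq_iff)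
  qed (simp add: zero_prod_def)
  show ?thesis
  proof (cases "n < 0")
    case True
    then have "g [^]\<^bsub>H3\<^esub> n = inv\<^bsub>H3\<^esub> (g [^]\<^bsub>H3\<^esub> nat (- n))" by (simp only: int_pow_def2 if_True)
    then show ?thesis using assms nat[of "nat (- n)"] True by (simp add: coords_inv)
  next
    case False
    then have "g [^]\<^bsub>H3\<^esub> n = g [^]\<^bsub>H3\<^esub> nat n" by (simp only: int_pow_def2 if_False)
    then show ?thesis using nat[of "nat n"] False by simp
  qed
qed

lemma coords_parity:
  assumes "g \<in> carrier H3"
  shows "even (snd (coords g) - fst (fst (coords g)) * snd (fst (coords g)))"
proof -
  obtain u where u: "g = pres_class heis_relators u" using assms by (elim H3_classE)
  have "even (snd l - fst (fst l) * snd (fst l))" if "l \<in> set (heis_letters u)" for l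
    using that by (auto simp: heis_letter_def Let_def split: heis_gen.splits if_splits)
  then show ?thesis using area_parity[of "heis_letters u"] by (simp add: u coords_class)
qed

text \<open>Conjugation by \<open>y\<close> is a homomorphism that sends \<open>x\<close> to \<open>x \<otimes>
z\<close>, hence powers to powers.\<close>

lemma (in group) int_pow_past_central_commutator:
  assumes c: "x \<in> carrier G" "y \<in> carrier G" "z \<in> carrier G" and zx: "z \<otimes> x = x \<otimes> z"
    and xy: "x \<otimes> y = y \<otimes> x \<otimes> z"
  shows "x [^] (a::int) \<otimes> y = y \<otimes> x [^] a \<otimes> z [^] a"
proof -
  define \<phi> where "\<phi> h = inv y \<otimes> h \<otimes> y" for h
  have canc: "y \<otimes> (inv y \<otimes> h) = h" if "h \<in> carrier G" for h
    using c that by (simp add: m_assoc[symmetric])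
  then have "\<phi> \<in> hom G G" using c by (auto simp: hom_def \<phi>_def m_assoc)
  then have hom: "group_hom G G \<phi>" using is_group by (simp add: group_hom_def group_hom_axioms_def)
  have "\<phi> x = x \<otimes> z" using c xy by (simp add: \<phi>_def m_assoc inv_solve_left')
  then have "\<phi> (x [^] a) = x [^] a \<otimes> z [^] a"
    using group_hom.hom_int_pow[OF hom c(1), of a] int_pow_mult_distrib[OF zx[symmetric] c(1,3)] by simp
  then have "y \<otimes> \<phi> (x [^] a) = y \<otimes> (x [^] a \<otimes> z [^] a)" by simp
  then show ?thesis using c by (simp add: \<phi>_def m_assoc[symmetric])
qed

text \<open>The elements of this form are closed under multiplication by the generators and their inverses from
the left. The coordinates determine the three exponents, which makes them injective.\<close>

lemma H3_normal_form:
  assumes "g \<in> carrier H3"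
  obtains a b c :: int where "g = H3_x [^]\<^bsub>H3\<^esub> a \<otimes>\<^bsub>H3\<^esub> H3_y [^]\<^bsub>H3\<^esub> b \<otimes>\<^bsub>H3\<^esub> H3_z [^]\<^bsub>H3\<^esub> c"
proof -
  define N where "N a b c = H3_x [^]\<^bsub>H3\<^esub> a \<otimes>\<^bsub>H3\<^esub> H3_y [^]\<^bsub>H3\<^esub> b \<otimes>\<^bsub>H3\<^esub> H3_z [^]\<^bsub>H3\<^esub> c" for a b c :: int
  note cl = H3_gens_closed H3_z_closed
  have zpow: "H3_z [^]\<^bsub>H3\<^esub> (c::int) \<otimes>\<^bsub>H3\<^esub> h = h \<otimes>\<^bsub>H3\<^esub> H3_z [^]\<^bsub>H3\<^esub> c" if "h \<in> carrier H3" for c h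
    using generate_H3_z_central[OF _ that] H3.generate_pow[OF H3_z_closed] by blast
  have xy: "H3_x \<otimes>\<^bsub>H3\<^esub> H3_y = H3_y \<otimes>\<^bsub>H3\<^esub> H3_x \<otimes>\<^bsub>H3\<^esub> H3_z"
  proof -
    have "H3_z \<otimes>\<^bsub>H3\<^esub> (H3_y \<otimes>\<^bsub>H3\<^esub> H3_x) = H3_x \<otimes>\<^bsub>H3\<^esub> H3_y"
      unfolding H3_z_def using H3_gens_closed by (simp add: H3.m_assoc H3.inv_solve_left')
    then show ?thesis using H3_z_central[of "H3_y \<otimes>\<^bsub>H3\<^esub> H3_x"] cl by simp
  qed
  have xyi: "H3_x \<otimes>\<^bsub>H3\<^esub> inv\<^bsub>H3\<^esub> H3_y = inv\<^bsub>H3\<^esub> H3_y \<otimes>\<^bsub>H3\<^esub> H3_x \<otimes>\<^bsub>H3\<^esub> inv\<^bsub>H3\<^esub> H3_z"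
  proof -
    have "inv\<^bsub>H3\<^esub> H3_y \<otimes>\<^bsub>H3\<^esub> (H3_x \<otimes>\<^bsub>H3\<^esub> H3_y) \<otimes>\<^bsub>H3\<^esub> inv\<^bsub>H3\<^esub> H3_y = H3_x \<otimes>\<^bsub>H3\<^esub> H3_z \<otimes>\<^bsub>H3\<^esub> inv\<^bsub>H3\<^esub> H3_y"
      unfolding xy using cl by (simp add: H3.m_assoc H3.inv_solve_left')
    also have "\<dots> = H3_x \<otimes>\<^bsub>H3\<^esub> inv\<^bsub>H3\<^esub> H3_y \<otimes>\<^bsub>H3\<^esub> H3_z"
      using cl H3_z_central[of "inv\<^bsub>H3\<^esub> H3_y"] by (simp add: H3.m_assoc)
    finally have "inv\<^bsub>H3\<^esub> H3_y \<otimes>\<^bsub>H3\<^esub> H3_x = H3_x \<otimes>\<^bsub>H3\<^esub> inv\<^bsub>H3\<^esub> H3_y \<otimes>\<^bsub>H3\<^esub> H3_z"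
      using cl by (simp add: H3.m_assoc)
    then show ?thesis using cl by (simp add: H3.m_assoc)
  qed
  have step: "\<exists>a' b' c'. h \<otimes>\<^bsub>H3\<^esub> N a b c = N a' b' c'"
    if "h \<in> {H3_x, inv\<^bsub>H3\<^esub> H3_x, H3_y, inv\<^bsub>H3\<^esub> H3_y}" for h a b c
  proof -
    have X: "H3_x [^]\<^bsub>H3\<^esub> e \<otimes>\<^bsub>H3\<^esub> N a b c = N (e + a) b c" for e
      using cl by (simp add: N_def H3.int_pow_mult H3.m_assoc[symmetric])
    have Y: "H3_y [^]\<^bsub>H3\<^esub> e \<otimes>\<^bsub>H3\<^esub> N a b c = N a (e + b) (d + c)"
      if "H3_x [^]\<^bsub>H3\<^esub> a \<otimes>\<^bsub>H3\<^esub> H3_y [^]\<^bsub>H3\<^esub> e = H3_y [^]\<^bsub>H3\<^esub> e \<otimes>\<^bsub>H3\<^esub> H3_x [^]\<^bsub>H3\<^esub> a \<otimes>\<^bsub>H3\<^esub> H3_z [^]\<^bsub>H3\<^esub> (- d)" for e d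
    proof -
      let ?x = "H3_x [^]\<^bsub>H3\<^esub> a" and ?e = "H3_y [^]\<^bsub>H3\<^esub> e" and ?b = "H3_y [^]\<^bsub>H3\<^esub> b"
      have "?x \<otimes>\<^bsub>H3\<^esub> ?e \<otimes>\<^bsub>H3\<^esub> H3_z [^]\<^bsub>H3\<^esub> d = ?e \<otimes>\<^bsub>H3\<^esub> ?x \<otimes>\<^bsub>H3\<^esub> (H3_z [^]\<^bsub>H3\<^esub> (- d) \<otimes>\<^bsub>H3\<^esub> H3_z [^]\<^bsub>H3\<^esub> d)"
        unfolding that using cl by (simp add: H3.m_assoc)
      then have ex: "?e \<otimes>\<^bsub>H3\<^esub> ?x = ?x \<otimes>\<^bsub>H3\<^esub> ?e \<otimes>\<^bsub>H3\<^esub> H3_z [^]\<^bsub>H3\<^esub> d"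
        using cl by (simp add: H3.int_pow_mult[symmetric])
      have "?e \<otimes>\<^bsub>H3\<^esub> N a b c = ?e \<otimes>\<^bsub>H3\<^esub> ?x \<otimes>\<^bsub>H3\<^esub> ?b \<otimes>\<^bsub>H3\<^esub> H3_z [^]\<^bsub>H3\<^esub> c"
        using cl by (simp add: N_def H3.m_assoc)
      also have "\<dots> = ?x \<otimes>\<^bsub>H3\<^esub> ?e \<otimes>\<^bsub>H3\<^esub> (H3_z [^]\<^bsub>H3\<^esub> d \<otimes>\<^bsub>H3\<^esub> ?b) \<otimes>\<^bsub>H3\<^esub> H3_z [^]\<^bsub>H3\<^esub> c"
        unfolding ex using cl by (simp add: H3.m_assoc)
      also have "\<dots> = ?x \<otimes>\<^bsub>H3\<^esub> (?e \<otimes>\<^bsub>H3\<^esub> ?b) \<otimes>\<^bsub>H3\<^esub> (H3_z [^]\<^bsub>H3\<^esub> d \<otimes>\<^bsub>H3\<^esub> H3_z [^]\<^bsub>H3\<^esub> c)"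
        using cl zpow[of ?b d] by (simp add: H3.m_assoc)
      finally show ?thesis using cl by (simp add: N_def H3.int_pow_mult)
    qed
    have y1: "H3_y \<otimes>\<^bsub>H3\<^esub> N a b c = N a (1 + b) (- a + c)"
      using Y[of 1 "- a"] H3.int_pow_past_central_commutator[OF cl, of a] xy H3_z_central[of H3_x] cl by simp
    have m1: "g [^]\<^bsub>H3\<^esub> (- 1 :: int) = inv\<^bsub>H3\<^esub> g" if "g \<in> carrier H3" for g
      using H3.int_pow_neg[OF that, of 1] that by simp
    have zi: "(inv\<^bsub>H3\<^esub> H3_z) [^]\<^bsub>H3\<^esub> a = H3_z [^]\<^bsub>H3\<^esub> (- a)"
      using cl by (simp add: H3.int_pow_inv H3.int_pow_neg)
    have "inv\<^bsub>H3\<^esub> H3_z \<otimes>\<^bsub>H3\<^esub> H3_x = H3_x \<otimes>\<^bsub>H3\<^esub> inv\<^bsub>H3\<^esub> H3_z"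
      using zpow[of H3_x "- 1"] cl m1 by simp
    then have "H3_x [^]\<^bsub>H3\<^esub> a \<otimes>\<^bsub>H3\<^esub> inv\<^bsub>H3\<^esub> H3_y =
        inv\<^bsub>H3\<^esub> H3_y \<otimes>\<^bsub>H3\<^esub> H3_x [^]\<^bsub>H3\<^esub> a \<otimes>\<^bsub>H3\<^esub> H3_z [^]\<^bsub>H3\<^esub> (- a)"
      using H3.int_pow_past_central_commutator[of H3_x "inv\<^bsub>H3\<^esub> H3_y" "inv\<^bsub>H3\<^esub> H3_z" a] xyi cl zi by simp
    then have y2: "inv\<^bsub>H3\<^esub> H3_y \<otimes>\<^bsub>H3\<^esub> N a b c = N a (- 1 + b) (a + c)"
      using Y[of "- 1" a] m1 cl by simp
    have x12: "H3_x \<otimes>\<^bsub>H3\<^esub> N a b c = N (1 + a) b c" "inv\<^bsub>H3\<^esub> H3_x \<otimes>\<^bsub>H3\<^esub> N a b c = N (- 1 + a) b c"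
      using X[of 1] X[of "- 1"] m1 cl by simp_all
    show ?thesis using that y1 y2 x12 by blast
  qed
  have "\<exists>a b c. pres_class heis_relators u = N a b c" for u
  proof (induction u)
    case Nil
    have "pres_class heis_relators [] = N 0 0 0" by (simp add: N_def one_pres_group flip: H3_def)
        (simp add: H3_def one_pres_group)
    then show ?case by blast
  next
    case (Cons l u)
    then obtain a b c where u: "pres_class heis_relators u = N a b c" by blast
    have "pres_class heis_relators (l # u) = pres_class heis_relators [l] \<otimes>\<^bsub>H3\<^esub> N a b c"
      using mult_pres_group[of heis_relators "[l]" u] u by (simp add: H3_def)
    moreover have "pres_class heis_relators [l] \<in> {H3_x, inv\<^bsub>H3\<^esub> H3_x, H3_y, inv\<^bsub>H3\<^esub> H3_y}"
    proof (cases l)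
      case (Pair g s)
      then show ?thesis
        by (cases g; cases s) (simp_all add: H3_x_def H3_y_def H3_def inv_pres_group word_inv_def)
    qed
    ultimately show ?case using step by metis
  qed
  then show thesis using that assms unfolding N_def by (metis H3_classE)
qed

lemma coords_eq_iff:
  assumes "g \<in> carrier H3" "h \<in> carrier H3"
  shows "coords g = coords h \<longleftrightarrow> g = h"
proof
  assume eq: "coords g = coords h"
  define k where "k = g \<otimes>\<^bsub>H3\<^esub> inv\<^bsub>H3\<^esub> h"
  have k: "k \<in> carrier H3" using assms by (simp add: k_def)
  have "coords k = 0"
    using assms eq by (intro prod_eqI) (simp_all add: k_def coords_mult coords_inv cross_simps)
  obtain a b c :: int where n: "k = H3_x [^]\<^bsub>H3\<^esub> a \<otimes>\<^bsub>H3\<^esub> H3_y [^]\<^bsub>H3\<^esub> b \<otimes>\<^bsub>H3\<^esub> H3_z [^]\<^bsub>H3\<^esub> c"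
    by (rule H3_normal_form[OF k])
  have "fst (coords k) = (a, b)" "snd (coords k) = a * b + 2 * c"
    unfolding n using H3_gens_closed H3_z_closed
    by (simp_all add: coords_mult coords_int_pow coords_gens cross_def)
  with \<open>coords k = 0\<close> have "a = 0" "b = 0" "c = 0" by (auto simp: zero_prod_def)
  then have "k = \<one>\<^bsub>H3\<^esub>" unfolding n by simp
  then show "g = h" using assms unfolding k_def using H3.inv_equality[of g "inv\<^bsub>H3\<^esub> h"] by simp
qed simp

section \<open>Words and word length\<close>

context monoid
begin

lemma foldr_mult_closed [simp]: "set ws \<subseteq> carrier G \<Longrightarrow> foldr (\<otimes>) ws \<one> \<in> carrier G"
  by (induction ws) auto

lemma foldr_mult_append:
  "set us \<subseteq> carrier G \<Longrightarrow> set ws \<subseteq> carrier G \<Longrightarrow>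
    foldr (\<otimes>) (us @ ws) \<one> = foldr (\<otimes>) us \<one> \<otimes> foldr (\<otimes>) ws \<one>"
  by (induction us) (auto simp: m_assoc)

lemma foldr_mult_filter_one:
  "set ws \<subseteq> carrier G \<Longrightarrow> foldr (\<otimes>) (filter (\<lambda>g. g \<noteq> \<one>) ws) \<one> = foldr (\<otimes>) ws \<one>"
  by (induction ws) auto

lemma foldr_mult_replicate_one: "foldr (\<otimes>) (replicate k \<one>) \<one> = \<one>"
  by (induction k) auto

end

lemma generate_eq_words:
  assumes G: "group G" and S: "S \<subseteq> carrier G" "\<forall>s\<in>S. inv\<^bsub>G\<^esub> s \<in> S" and g: "g \<in> generate G S"
  shows "\<exists>ws. set ws \<subseteq> S \<and> foldr (\<otimes>\<^bsub>G\<^esub>) ws \<one>\<^bsub>G\<^esub> = g"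
proof -
  interpret group G by (rule G)
  show ?thesis using g
  proof (induction rule: generate.induct)
    case one
    show ?case by (rule exI[of _ "[]"]) simp
  next
    case (incl h)
    then show ?case using S by (intro exI[of _ "[h]"]) auto
  next
    case (inv h)
    then show ?case using S by (intro exI[of _ "[inv\<^bsub>G\<^esub> h]"]) auto
  next
    case (eng g h)
    then obtain us ws where "set us \<subseteq> S" "foldr (\<otimes>\<^bsub>G\<^esub>) us \<one>\<^bsub>G\<^esub> = g"
      "set ws \<subseteq> S" "foldr (\<otimes>\<^bsub>G\<^esub>) ws \<one>\<^bsub>G\<^esub> = h" by blast
    then show ?case using foldr_mult_append[of us ws] S(1) by (intro exI[of _ "us @ ws"]) auto
  qed
qed

lemma word_length_le:
  "set ws \<subseteq> S \<Longrightarrow> foldr (\<otimes>\<^bsub>G\<^esub>) ws \<one>\<^bsub>G\<^esub> = g \<Longrightarrow> word_length G S g \<le> length ws"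
  unfolding word_length_def by (rule Least_le) blast

lemma word_length_attained:
  assumes "set ws \<subseteq> S" "foldr (\<otimes>\<^bsub>G\<^esub>) ws \<one>\<^bsub>G\<^esub> = g"
  obtains us where "length us = word_length G S g" "set us \<subseteq> S" "foldr (\<otimes>\<^bsub>G\<^esub>) us \<one>\<^bsub>G\<^esub> = g"
proof -
  have "\<exists>us. length us = word_length G S g \<and> set us \<subseteq> S \<and> foldr (\<otimes>\<^bsub>G\<^esub>) us \<one>\<^bsub>G\<^esub> = g"
    unfolding word_length_def by (rule LeastI[of _ "length ws"]) (use assms in blast)
  then show thesis using that by blast
qed

lemma coords_foldr:
  assumes "set ws \<subseteq> carrier H3"
  shows "coords (foldr (\<otimes>\<^bsub>H3\<^esub>) ws \<one>\<^bsub>H3\<^esub>) = (disp (map coords ws), area (map coords ws))"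
  using assms
proof (induction ws)
  case (Cons g ws)
  then show ?case by (intro prod_eqI) (simp_all add: coords_mult)
qed (simp add: zero_prod_def)

lemma H3_words:
  assumes "fin_sym_generating H3 S" "g \<in> carrier H3"
  obtains ws where "set ws \<subseteq> S" "foldr (\<otimes>\<^bsub>H3\<^esub>) ws \<one>\<^bsub>H3\<^esub> = g"
  using generate_eq_words[OF group_H3, of S g] assms unfolding fin_sym_generating_def by auto

lemma alphabet_coords:
  assumes S: "fin_sym_generating H3 S"
  shows "alphabet (coords ` S)"
proof -
  have SH: "S \<subseteq> carrier H3" and inv: "\<forall>s\<in>S. inv\<^bsub>H3\<^esub> s \<in> S" and fin: "finite S"
    using S by (auto simp: fin_sym_generating_def)
  have word: "\<exists>w. set w \<subseteq> coords ` S \<and> disp w = fst (coords g) \<and> area w = snd (coords g)"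
    if g: "g \<in> carrier H3" for g
  proof -
    obtain ws where ws: "set ws \<subseteq> S" "foldr (\<otimes>\<^bsub>H3\<^esub>) ws \<one>\<^bsub>H3\<^esub> = g" by (rule H3_words[OF S g])
    then show ?thesis using coords_foldr[of ws] SH by (intro exI[of _ "map coords ws"]) auto
  qed
  show ?thesis unfolding alphabet_def
  proof (intro conjI ballI)
    fix l assume "l \<in> coords ` S"
    then obtain s where s: "s \<in> S" "l = coords s" by blast
    then show "even (snd l - fst (fst l) * snd (fst l))" using coords_parity SH by blast
    have "- l = coords (inv\<^bsub>H3\<^esub> s)" using s SH coords_inv by auto
    then show "- l \<in> coords ` S" using s inv by blast
  next
    show "\<exists>w. set w \<subseteq> coords ` S \<and> disp w = (1, 0) \<and> area w = 0"
      using word[OF H3_gens_closed(1)] by (simp add: coords_gens)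
    show "\<exists>w. set w \<subseteq> coords ` S \<and> disp w = (0, 1) \<and> area w = 0"
      using word[OF H3_gens_closed(2)] by (simp add: coords_gens)
    show "\<exists>w. set w \<subseteq> coords ` S \<and> disp w = 0 \<and> area w = 2"
      using word[OF H3_z_closed] by (simp add: coords_gens)
  qed (use fin in simp)
qed

lemma lift_letters:
  assumes "set us \<subseteq> f ` S"
  obtains gs where "set gs \<subseteq> S" "map f gs = us"
proof -
  have "us \<in> lists (f ` S)" using assms by auto
  then have "us \<in> map f ` lists S" by (simp add: lists_image)
  then show thesis using that by auto
qed

section \<open>From coordinates to word length\<close>

lemma reach_cong:
  assumes "reach m \<A> k V \<tau>" "\<And>i. i < m \<Longrightarrow> V i = V' i"
  shows "reach m \<A> k V' \<tau>"
  using assms unfolding reach_def by metis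

text \<open>Reduces both parts of the theorem to the existence of coordinates in which \<open>reach\<close> is a
bound for the word length. Only the integer part of \<open>D\<close> matters, as word lengths are
integers.\<close>

lemma almost_dead_ends_of_reach:
  fixes G :: "('g, 'b) monoid_scheme" and V :: "'g \<Rightarrow> nat \<Rightarrow> int \<times> int" and T :: "'g \<Rightarrow> int"
  assumes m: "1 \<le> m" and alph: "\<And>i. i < m \<Longrightarrow> alphabet (\<A> i)"
    and reach: "\<And>g k. g \<in> carrier G \<Longrightarrow> reach m \<A> k (V g) (T g) \<longleftrightarrow> word_length G S g \<le> k"
    and z: "\<And>n :: int. Z n \<in> carrier G" "\<And>n i. i < m \<Longrightarrow> V (Z n) i = 0" "\<And>n. T (Z n) = 2 * n"
    and zh: "\<And>n h. h \<in> carrier G \<Longrightarrow> Z n \<otimes>\<^bsub>G\<^esub> h \<in> carrier G"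
      "\<And>n h i. h \<in> carrier G \<Longrightarrow> i < m \<Longrightarrow> V (Z n \<otimes>\<^bsub>G\<^esub> h) i = V h i"
      "\<And>n h. h \<in> carrier G \<Longrightarrow> T (Z n \<otimes>\<^bsub>G\<^esub> h) = 2 * n + T h"
  shows "\<exists>C M D0 :: real. C > 0 \<and> M > 0 \<and> D0 > 0 \<and>
        (\<forall>(D :: real) (n :: int). D \<ge> D0 \<longrightarrow> real_of_int n \<ge> C * D ^ 4 \<longrightarrow>
          (\<forall>h \<in> carrier G. real (word_length G S h) \<le> D \<longrightarrow>
            real (word_length G S (Z n \<otimes>\<^bsub>G\<^esub> h)) \<le> real (word_length G S (Z n)) + M))"
proof -
  have "\<exists>C M :: nat. \<forall>D k j n V \<tau>. 1 \<le> D \<longrightarrow> int (C * D ^ 4) \<le> n \<longrightarrow> j \<le> D \<longrightarrow>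
    reach m \<A> k (\<lambda>_. 0) (2 * n) \<longrightarrow> reach m \<A> j V \<tau> \<longrightarrow> reach m \<A> (k + M) V (2 * n + \<tau>)"
    using alph by (rule reach_translate[OF m])
  then obtain C M :: nat where CM: "\<forall>D k j n V \<tau>. 1 \<le> D \<longrightarrow> int (C * D ^ 4) \<le> n \<longrightarrow> j \<le> D \<longrightarrow>
    reach m \<A> k (\<lambda>_. 0) (2 * n) \<longrightarrow> reach m \<A> j V \<tau> \<longrightarrow> reach m \<A> (k + M) V (2 * n + \<tau>)"
    by (elim exE)
  show ?thesis
  proof (rule exI[of _ "real C + 1"], rule exI[of _ "real M + 1"], rule exI[of _ 1], intro conjI allI impI ballI)
    fix D :: real and n :: int and h
    assume D: "1 \<le> D" and n: "(real C + 1) * D ^ 4 \<le> real_of_int n"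
      and h: "h \<in> carrier G" and len: "real (word_length G S h) \<le> D"
    define d where "d = nat \<lfloor>D\<rfloor>"
    have d: "1 \<le> d" "real d \<le> D" "word_length G S h \<le> d"
      using D len by (auto simp: d_def le_nat_floor le_floor_iff)
    have "real d ^ 4 \<le> D ^ 4" using d by (intro power_mono) auto
    then have "real C * real d ^ 4 \<le> (real C + 1) * D ^ 4" using D by (intro mult_mono) auto
    then have "real_of_int (int (C * d ^ 4)) \<le> real_of_int n" using n by simp
    then have Cd: "int (C * d ^ 4) \<le> n" by (simp only: of_int_le_iff)
    have "reach m \<A> (word_length G S (Z n)) (V (Z n)) (T (Z n))" using reach[OF z(1)] by simp
    then have rz: "reach m \<A> (word_length G S (Z n)) (\<lambda>_. 0) (2 * n)"
      using z(2) unfolding z(3) by (rule reach_cong)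
    have rh: "reach m \<A> (word_length G S h) (V h) (T h)" using reach[OF h] by simp
    have "reach m \<A> (word_length G S (Z n) + M) (V (Z n \<otimes>\<^bsub>G\<^esub> h)) (T (Z n \<otimes>\<^bsub>G\<^esub> h))"
      using CM[rule_format, OF d(1) Cd d(3) rz rh] unfolding zh(3)[OF h]
      by (rule reach_cong) (simp add: zh(2)[OF h])
    then have "word_length G S (Z n \<otimes>\<^bsub>G\<^esub> h) \<le> word_length G S (Z n) + M" using reach[OF zh(1)[OF h]] by simp
    then show "real (word_length G S (Z n \<otimes>\<^bsub>G\<^esub> h)) \<le> real (word_length G S (Z n)) + (real M + 1)" by linarith
  qed auto
qed

lemma H3_reach_iff:
  assumes S: "fin_sym_generating H3 S" and g: "g \<in> carrier H3"
  shows "reach 1 (\<lambda>_. coords ` S) k (\<lambda>_. fst (coords g)) (snd (coords g)) \<longleftrightarrow> word_length H3 S g \<le> k"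
proof
  have SH: "S \<subseteq> carrier H3" using S by (simp add: fin_sym_generating_def)
  {
    assume "reach 1 (\<lambda>_. coords ` S) k (\<lambda>_. fst (coords g)) (snd (coords g))"
    then obtain us where us: "set us \<subseteq> coords ` S" "length us \<le> k" "disp us = fst (coords g)" "area us = snd (coords g)"
      unfolding reach_def by auto
    obtain gs where gs: "set gs \<subseteq> S" "map coords gs = us" using lift_letters[OF us(1)] by blast
    have "coords (foldr (\<otimes>\<^bsub>H3\<^esub>) gs \<one>\<^bsub>H3\<^esub>) = coords g"
      using coords_foldr[of gs] gs SH us by (simp add: prod_eq_iff)
    then have "foldr (\<otimes>\<^bsub>H3\<^esub>) gs \<one>\<^bsub>H3\<^esub> = g" using coords_eq_iff[OF _ g] gs SH by simp
    then have "word_length H3 S g \<le> length gs" by (rule word_length_le[OF gs(1)])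
    moreover have "length gs \<le> k" using gs(2) us(2) by (metis length_map)
    ultimately show "word_length H3 S g \<le> k" by simp
  }
  assume k: "word_length H3 S g \<le> k"
  obtain ws where "set ws \<subseteq> S" "foldr (\<otimes>\<^bsub>H3\<^esub>) ws \<one>\<^bsub>H3\<^esub> = g" by (rule H3_words[OF S g])
  then obtain us where us: "length us = word_length H3 S g" "set us \<subseteq> S" "foldr (\<otimes>\<^bsub>H3\<^esub>) us \<one>\<^bsub>H3\<^esub> = g"
    by (rule word_length_attained)
  then show "reach 1 (\<lambda>_. coords ` S) k (\<lambda>_. fst (coords g)) (snd (coords g))"
    unfolding reach_def using coords_foldr[of us] SH k by (intro exI[of _ "\<lambda>_. map coords us"]) auto
qed

lemma H3_almost_dead_ends:
  assumes S: "fin_sym_generating H3 S"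
  shows "\<exists>C M D0 :: real. C > 0 \<and> M > 0 \<and> D0 > 0 \<and>
        (\<forall>(D :: real) (n :: int). D \<ge> D0 \<longrightarrow> real_of_int n \<ge> C * D ^ 4 \<longrightarrow>
          (\<forall>h \<in> carrier H3. real (word_length H3 S h) \<le> D \<longrightarrow>
            real (word_length H3 S ((H3_z [^]\<^bsub>H3\<^esub> n) \<otimes>\<^bsub>H3\<^esub> h))
              \<le> real (word_length H3 S (H3_z [^]\<^bsub>H3\<^esub> n)) + M))"
  by (rule almost_dead_ends_of_reach[where m = 1 and \<A> = "\<lambda>_. coords ` S" and V = "\<lambda>g _. fst (coords g)"
        and T = "\<lambda>g. snd (coords g)"])
    (use H3_z_closed in \<open>simp_all add: alphabet_coords[OF S] H3_reach_iff[OF S] coords_mult coords_int_pow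
      coords_gens cross_simps zero_prod_def[symmetric] del: One_nat_def\<close>)

section \<open>The centrally amalgamated product\<close>

definition total_height :: "nat \<Rightarrow> (nat \<Rightarrow> heis_gen word set) \<Rightarrow> int" where
  "total_height m f = (\<Sum>i<m. snd (coords (f i)))"

lemma H3_pow_component: "f \<in> carrier (H3_pow m) \<Longrightarrow> i < m \<Longrightarrow> f i \<in> carrier H3"
  by (auto simp: H3_pow_def PiE_iff)

lemma H3_pow_component_mult: "i < m \<Longrightarrow> (f \<otimes>\<^bsub>H3_pow m\<^esub> g) i = f i \<otimes>\<^bsub>H3\<^esub> g i"
  by (simp add: H3_pow_def)

lemma H3_pow_component_inv:
  "f \<in> carrier (H3_pow m) \<Longrightarrow> i < m \<Longrightarrow> (inv\<^bsub>H3_pow m\<^esub> f) i = inv\<^bsub>H3\<^esub> (f i)"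
  by (simp add: H3_pow_def group_H3)

lemma H3_pow_component_one: "i < m \<Longrightarrow> \<one>\<^bsub>H3_pow m\<^esub> i = \<one>\<^bsub>H3\<^esub>"
  by (simp add: H3_pow_def)

lemma H3_pow_component_int_pow:
  assumes "f \<in> carrier (H3_pow m)" "i < m"
  shows "(f [^]\<^bsub>H3_pow m\<^esub> (n::int)) i = f i [^]\<^bsub>H3\<^esub> n"
proof -
  have "(\<lambda>f. f i) \<in> hom (H3_pow m) H3"
    using assms(2) by (auto simp: hom_def H3_pow_component H3_pow_component_mult)
  then show ?thesis using hom_int_pow[OF _ assms(1) group_H3_pow group_H3] by blast
qed

lemma H3_pow_component_foldr:
  "i < m \<Longrightarrow> foldr (\<otimes>\<^bsub>H3_pow m\<^esub>) fs \<one>\<^bsub>H3_pow m\<^esub> i = foldr (\<otimes>\<^bsub>H3\<^esub>) (map (\<lambda>f. f i) fs) \<one>\<^bsub>H3\<^esub>"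
  by (induction fs) (simp_all add: H3_pow_component_mult H3_pow_component_one)

lemma H3_inj_closed: "c \<in> carrier H3 \<Longrightarrow> H3_inj m i c \<in> carrier (H3_pow m)"
  by (auto simp: H3_inj_def H3_pow_def)

text \<open>The tuples that become trivial in the amalgamated product: each component is central, and the
exponents of \<open>z\<close> add up to 0.\<close>

definition null_coords :: "nat \<Rightarrow> (nat \<Rightarrow> heis_gen word set) \<Rightarrow> bool" where
  "null_coords m f \<longleftrightarrow> f \<in> carrier (H3_pow m) \<and> (\<forall>i<m. fst (coords (f i)) = 0) \<and> total_height m f = 0"

lemma null_coords_mult:
  assumes "null_coords m f" "null_coords m g"
  shows "null_coords m (f \<otimes>\<^bsub>H3_pow m\<^esub> g)"
proof -
  interpret P: group "H3_pow m" by (rule group_H3_pow)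
  have cl: "f i \<in> carrier H3" "g i \<in> carrier H3" if "i < m" for i
    using assms that by (auto simp: null_coords_def H3_pow_component)
  have "total_height m (f \<otimes>\<^bsub>H3_pow m\<^esub> g) = total_height m f + total_height m g"
    unfolding total_height_def sum.distrib[symmetric] using assms cl
    by (intro sum.cong) (auto simp: null_coords_def H3_pow_component_mult coords_mult cross_simps)
  then show ?thesis using assms cl by (simp add: null_coords_def H3_pow_component_mult coords_mult)
qed

lemma null_coords_inv:
  assumes "null_coords m f"
  shows "null_coords m (inv\<^bsub>H3_pow m\<^esub> f)"
proof -
  interpret P: group "H3_pow m" by (rule group_H3_pow)
  have f: "f \<in> carrier (H3_pow m)" using assms by (simp add: null_coords_def)
  have "total_height m (inv\<^bsub>H3_pow m\<^esub> f) = - total_height m f"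
    unfolding total_height_def sum_negf[symmetric]
    by (intro sum.cong) (auto simp: H3_pow_component_inv[OF f] coords_inv H3_pow_component[OF f])
  then show ?thesis using assms f
    by (simp add: null_coords_def H3_pow_component_inv[OF f] coords_inv H3_pow_component[OF f])
qed

lemma H3_z_pow_iff:
  assumes "g \<in> carrier H3"
  shows "fst (coords g) = 0 \<longleftrightarrow> (\<exists>c :: int. g = H3_z [^]\<^bsub>H3\<^esub> c)"
proof
  assume *: "fst (coords g) = 0"
  then obtain c where "snd (coords g) = 2 * c" using coords_parity[OF assms] by (auto elim: evenE)
  with * have "coords g = coords (H3_z [^]\<^bsub>H3\<^esub> c)"
    by (simp add: coords_int_pow[OF H3_z_closed] coords_gens prod_eq_iff)
  then show "\<exists>c :: int. g = H3_z [^]\<^bsub>H3\<^esub> c"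
    using coords_eq_iff[OF assms, of "H3_z [^]\<^bsub>H3\<^esub> c"] H3_z_closed by auto
next
  assume "\<exists>c :: int. g = H3_z [^]\<^bsub>H3\<^esub> c"
  then show "fst (coords g) = 0"
    using coords_int_pow[OF H3_z_closed] by (auto simp: coords_gens zero_prod_def)
qed

lemma heis_amalg_null:
  assumes "f \<in> heis_amalg m"
  shows "null_coords m f"
proof -
  interpret P: group "H3_pow m" by (rule group_H3_pow)
  have gen: "null_coords m (H3_inj m i c \<otimes>\<^bsub>H3_pow m\<^esub> inv\<^bsub>H3_pow m\<^esub> (H3_inj m j c))"
    if ij: "i < m" "j < m" and c: "c \<in> generate H3 {H3_z}" for i j c
  proof -
    obtain n :: int where n: "c = H3_z [^]\<^bsub>H3\<^esub> n" using c H3.generate_pow[OF H3_z_closed] by auto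
    then have cH: "c \<in> carrier H3" using H3_z_closed by simp
    define t where "t = snd (coords c)"
    have ct: "coords c = (0, t)" using H3_z_pow_iff[OF cH] n by (auto simp: t_def prod_eq_iff)
    have inj: "coords (H3_inj m i c k) = (0, if k = i then t else 0)" if "k < m" for i k
      using that ct by (simp add: H3_inj_def zero_prod_def)
    note cl = H3_inj_closed[OF cH]
    have co: "coords ((H3_inj m i c \<otimes>\<^bsub>H3_pow m\<^esub> inv\<^bsub>H3_pow m\<^esub> (H3_inj m j c)) k)
        = (0, (if k = i then t else 0) - (if k = j then t else 0))" if "k < m" for k
      using that cl[THEN H3_pow_component, OF that]
      by (intro prod_eqI) (simp_all add: H3_pow_component_mult H3_pow_component_inv[OF cl] coords_mult coords_inv inj cross_simps)
    show ?thesis unfolding null_coords_def total_height_def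
      using cl ij by (simp add: co sum_subtractf)
  qed
  show ?thesis using assms unfolding heis_amalg_def
  proof (induction rule: generate.induct)
    case one
    then show ?case by (simp add: null_coords_def total_height_def H3_pow_component_one)
  next
    case (incl h)
    then show ?case using gen by blast
  next
    case (inv h)
    then show ?case using gen null_coords_inv by blast
  next
    case (eng f g)
    then show ?case by (simp add: null_coords_mult)
  qed
qed

definition central_tuple :: "nat \<Rightarrow> (nat \<Rightarrow> int) \<Rightarrow> nat \<Rightarrow> heis_gen word set" where
  "central_tuple m c = (\<lambda>i\<in>{..<m}. H3_z [^]\<^bsub>H3\<^esub> c i)"

text \<open>Induction on the support: the last nontrivial component is moved to component 0 by one of the
generators of the amalgamated subgroup.\<close>

lemma central_tuple_in_amalg:
  assumes "j \<le> m" "\<And>i. j \<le> i \<Longrightarrow> c i = 0" "(\<Sum>i<m. c i) = 0"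
  shows "central_tuple m c \<in> heis_amalg m"
  using assms
proof (induction j arbitrary: c)
  case 0
  then have "central_tuple m c = \<one>\<^bsub>H3_pow m\<^esub>"
    by (auto simp: central_tuple_def H3_pow_def intro!: restrict_ext)
  then show ?case unfolding heis_amalg_def by (simp add: generate.one)
next
  case (Suc j)
  let ?t = "H3_z [^]\<^bsub>H3\<^esub> c j"
  define c' where "c' i = c i - (if i = j then c j else 0) + (if i = 0 then c j else 0)" for i
  have t: "?t \<in> generate H3 {H3_z}" using H3.generate_pow[OF H3_z_closed] by auto
  have 1: "H3_inj m j ?t \<otimes>\<^bsub>H3_pow m\<^esub> inv\<^bsub>H3_pow m\<^esub> (H3_inj m 0 ?t) \<in> heis_amalg m"
    unfolding heis_amalg_def
    by (rule generate.incl, rule CollectI, rule exI[of _ j], rule exI[of _ 0], rule exI[of _ ?t])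
      (use Suc.prems(1) t in simp)
  have 2: "central_tuple m c' \<in> heis_amalg m"
  proof (cases "j = 0")
    case True
    then have "c i = 0" if "i \<noteq> 0" for i using Suc.prems(2)[of i] that by auto
    then have "(\<Sum>i<m. c i) = c 0"
      using Suc.prems(1) by (subst sum.remove[of _ 0]) auto
    then have "c 0 = 0" using Suc.prems(3) by simp
    then have "c i = 0" for i using \<open>\<And>i. i \<noteq> 0 \<Longrightarrow> c i = 0\<close> by (cases "i = 0") auto
    then have "\<And>i. 0 \<le> i \<Longrightarrow> c' i = 0" by (simp add: c'_def)
    then have "c' = (\<lambda>_. 0)" by (intro ext) simp
    then show ?thesis using True Suc.IH[of c'] by simp
  next
    case False
    show ?thesis
    proof (rule Suc.IH)
      show "(\<Sum>i<m. c' i) = 0"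
        using Suc.prems(1,3) by (simp add: c'_def sum.distrib sum_subtractf)
    qed (use Suc.prems False in \<open>auto simp: c'_def\<close>)
  qed
  have tH: "?t \<in> carrier H3" using H3_z_closed by simp
  have "central_tuple m c = central_tuple m c' \<otimes>\<^bsub>H3_pow m\<^esub> (H3_inj m j ?t \<otimes>\<^bsub>H3_pow m\<^esub> inv\<^bsub>H3_pow m\<^esub> (H3_inj m 0 ?t))"
  proof -
    have "H3_z [^]\<^bsub>H3\<^esub> c i = H3_z [^]\<^bsub>H3\<^esub> c' i \<otimes>\<^bsub>H3\<^esub> ((if i = j then ?t else \<one>\<^bsub>H3\<^esub>) \<otimes>\<^bsub>H3\<^esub> inv\<^bsub>H3\<^esub> (if i = 0 then ?t else \<one>\<^bsub>H3\<^esub>))" for i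
    proof -
      have "(if i = j then ?t else \<one>\<^bsub>H3\<^esub>) = H3_z [^]\<^bsub>H3\<^esub> (if i = j then c j else 0)"
        "inv\<^bsub>H3\<^esub> (if i = 0 then ?t else \<one>\<^bsub>H3\<^esub>) = H3_z [^]\<^bsub>H3\<^esub> (- (if i = 0 then c j else 0))"
        using H3_z_closed by (simp_all add: H3.int_pow_neg)
      then show ?thesis using H3_z_closed by (simp only: H3.int_pow_mult[symmetric]) (simp add: c'_def)
    qed
    note key = this
    show ?thesis
    proof
      fix i
      show "central_tuple m c i = (central_tuple m c' \<otimes>\<^bsub>H3_pow m\<^esub>
        (H3_inj m j ?t \<otimes>\<^bsub>H3_pow m\<^esub> inv\<^bsub>H3_pow m\<^esub> (H3_inj m 0 ?t))) i"
      proof (cases "i < m")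
        case True
        have "H3_inj m k ?t i = (if i = k then ?t else \<one>\<^bsub>H3\<^esub>)" for k
          using True by (simp add: H3_inj_def)
        moreover have "central_tuple m d i = H3_z [^]\<^bsub>H3\<^esub> d i" for d
          using True by (simp add: central_tuple_def)
        ultimately show ?thesis unfolding H3_pow_component_mult[OF True]
          H3_pow_component_inv[OF H3_inj_closed[OF tH] True] using key[of i] by (simp only:)
      next
        case False
        then show ?thesis by (simp add: central_tuple_def H3_pow_def)
      qed
    qed
  qed
  moreover have "subgroup (heis_amalg m) (H3_pow m)"
    using heis_amalg_normal by (rule normal_imp_subgroup)
  ultimately show ?case using 1 2 by (metis subgroup.m_closed)
qed

lemma heis_amalg_iff: "f \<in> heis_amalg m \<longleftrightarrow> null_coords m f"
proof
  assume n: "null_coords m f"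
  then have f: "f \<in> carrier (H3_pow m)" by (simp add: null_coords_def)
  have "\<exists>c. \<forall>i<m. f i = H3_z [^]\<^bsub>H3\<^esub> (c i :: int)"
    using n H3_z_pow_iff[OF H3_pow_component[OF f]] by (intro choice allI) (auto simp: null_coords_def)
  then obtain c0 :: "nat \<Rightarrow> int" where c0: "\<And>i. i < m \<Longrightarrow> f i = H3_z [^]\<^bsub>H3\<^esub> c0 i" by blast
  define c where "c i = (if i < m then c0 i else 0)" for i
  have fc: "f i = H3_z [^]\<^bsub>H3\<^esub> c i" if "i < m" for i using c0 that by (simp add: c_def)
  have "f = central_tuple m c"
  proof
    fix i
    show "f i = central_tuple m c i" using f fc[of i]
      by (cases "i < m") (auto simp: central_tuple_def H3_pow_def PiE_iff extensional_def)
  qed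
  moreover have "(\<Sum>i<m. c i) = 0"
  proof -
    have "total_height m f = (\<Sum>i<m. 2 * c i)"
      unfolding total_height_def using fc by (intro sum.cong) (auto simp: coords_int_pow H3_z_closed coords_gens)
    then show ?thesis using n by (simp add: null_coords_def flip: sum_distrib_left)
  qed
  ultimately show "f \<in> heis_amalg m" using central_tuple_in_amalg[of m m c] by (simp add: c_def)
qed (rule heis_amalg_null)

lemma Heis_proj_eq_iff:
  assumes f: "f \<in> carrier (H3_pow m)" and g: "g \<in> carrier (H3_pow m)"
  shows "Heis_proj m f = Heis_proj m g \<longleftrightarrow>
    (\<forall>i<m. fst (coords (f i)) = fst (coords (g i))) \<and> total_height m f = total_height m g"
proof -
  interpret P: group "H3_pow m" by (rule group_H3_pow)
  have sub: "subgroup (heis_amalg m) (H3_pow m)" using heis_amalg_normal by (rule normal_imp_subgroup)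
  have "Heis_proj m f = Heis_proj m g \<longleftrightarrow> f \<in> heis_amalg m #>\<^bsub>H3_pow m\<^esub> g"
    unfolding Heis_proj_def using P.rcos_self[OF f sub] P.repr_independence[OF _ g sub] by auto
  also have "\<dots> \<longleftrightarrow> null_coords m (f \<otimes>\<^bsub>H3_pow m\<^esub> inv\<^bsub>H3_pow m\<^esub> g)"
    using subgroup.rcos_module[OF sub group_H3_pow g f] by (simp add: heis_amalg_iff)
  finally have 1: "Heis_proj m f = Heis_proj m g \<longleftrightarrow> null_coords m (f \<otimes>\<^bsub>H3_pow m\<^esub> inv\<^bsub>H3_pow m\<^esub> g)" by simp
  note cl = H3_pow_component[OF f] H3_pow_component[OF g]
  have d: "fst (coords ((f \<otimes>\<^bsub>H3_pow m\<^esub> inv\<^bsub>H3_pow m\<^esub> g) i)) = fst (coords (f i)) - fst (coords (g i))"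
    "fst (coords (f i)) = fst (coords (g i)) \<Longrightarrow>
      snd (coords ((f \<otimes>\<^bsub>H3_pow m\<^esub> inv\<^bsub>H3_pow m\<^esub> g) i)) = snd (coords (f i)) - snd (coords (g i))"
    if "i < m" for i
    using that by (simp_all add: H3_pow_component_mult H3_pow_component_inv[OF g] coords_mult coords_inv cl cross_simps)
  have "total_height m (f \<otimes>\<^bsub>H3_pow m\<^esub> inv\<^bsub>H3_pow m\<^esub> g) = total_height m f - total_height m g"
    if "\<forall>i<m. fst (coords (f i)) = fst (coords (g i))"
    unfolding total_height_def sum_subtractf[symmetric] using d(2) that by (intro sum.cong) auto
  then show ?thesis unfolding 1 null_coords_def using f g d(1) by auto
qed

lemma Heis_proj_mult:
  "f \<in> carrier (H3_pow m) \<Longrightarrow> g \<in> carrier (H3_pow m) \<Longrightarrow>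
    Heis_proj m f \<otimes>\<^bsub>Heis m\<^esub> Heis_proj m g = Heis_proj m (f \<otimes>\<^bsub>H3_pow m\<^esub> g)"
  unfolding Heis_def Heis_proj_def by (simp add: normal.rcos_sum[OF heis_amalg_normal])

lemma Heis_proj_one: "Heis_proj m \<one>\<^bsub>H3_pow m\<^esub> = \<one>\<^bsub>Heis m\<^esub>"
proof -
  interpret P: group "H3_pow m" by (rule group_H3_pow)
  have "heis_amalg m \<subseteq> carrier (H3_pow m)"
    using normal_imp_subgroup[OF heis_amalg_normal] by (rule subgroup.subset)
  then show ?thesis unfolding Heis_def Heis_proj_def by simp
qed

lemma Heis_proj_closed: "f \<in> carrier (H3_pow m) \<Longrightarrow> Heis_proj m f \<in> carrier (Heis m)"
  by (auto simp: Heis_def Heis_proj_def carrier_FactGroup)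

lemma Heis_projE:
  assumes "a \<in> carrier (Heis m)"
  obtains f where "f \<in> carrier (H3_pow m)" "a = Heis_proj m f"
  using assms by (auto simp: Heis_def Heis_proj_def carrier_FactGroup)

lemma Heis_proj_foldr:
  "set fs \<subseteq> carrier (H3_pow m) \<Longrightarrow>
    foldr (\<otimes>\<^bsub>Heis m\<^esub>) (map (Heis_proj m) fs) \<one>\<^bsub>Heis m\<^esub> = Heis_proj m (foldr (\<otimes>\<^bsub>H3_pow m\<^esub>) fs \<one>\<^bsub>H3_pow m\<^esub>)"
proof (induction fs)
  case Nil
  then show ?case by (simp add: Heis_proj_one)
next
  case (Cons f fs)
  interpret P: group "H3_pow m" by (rule group_H3_pow)
  show ?case using Cons by (simp add: Heis_proj_mult)
qed

lemma Heis_proj_int_pow: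
  assumes "f \<in> carrier (H3_pow m)"
  shows "Heis_proj m f [^]\<^bsub>Heis m\<^esub> (n::int) = Heis_proj m (f [^]\<^bsub>H3_pow m\<^esub> n)"
  unfolding Heis_def Heis_proj_def using normal.FactGroup_int_pow[OF heis_amalg_normal assms] .

definition Heis_rep :: "nat \<Rightarrow> (nat \<Rightarrow> heis_gen word set) set \<Rightarrow> nat \<Rightarrow> heis_gen word set" where
  "Heis_rep m a = (SOME f. f \<in> carrier (H3_pow m) \<and> Heis_proj m f = a)"

definition Heis_disp :: "nat \<Rightarrow> (nat \<Rightarrow> heis_gen word set) set \<Rightarrow> nat \<Rightarrow> int \<times> int" where
  "Heis_disp m a i = fst (coords (Heis_rep m a i))"

definition Heis_height :: "nat \<Rightarrow> (nat \<Rightarrow> heis_gen word set) set \<Rightarrow> int" where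
  "Heis_height m a = total_height m (Heis_rep m a)"

lemma Heis_coords:
  assumes f: "f \<in> carrier (H3_pow m)"
  shows "i < m \<Longrightarrow> Heis_disp m (Heis_proj m f) i = fst (coords (f i))"
    "Heis_height m (Heis_proj m f) = total_height m f"
proof -
  have "Heis_rep m (Heis_proj m f) \<in> carrier (H3_pow m) \<and> Heis_proj m (Heis_rep m (Heis_proj m f)) = Heis_proj m f"
    unfolding Heis_rep_def by (rule someI[of _ f]) (use f in simp)
  then show "i < m \<Longrightarrow> Heis_disp m (Heis_proj m f) i = fst (coords (f i))"
    "Heis_height m (Heis_proj m f) = total_height m f"
    using Heis_proj_eq_iff[OF _ f] by (auto simp: Heis_disp_def Heis_height_def)
qed

lemma total_height_mult:
  assumes "f \<in> carrier (H3_pow m)" "g \<in> carrier (H3_pow m)" "\<And>i. i < m \<Longrightarrow> fst (coords (f i)) = 0"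
  shows "total_height m (f \<otimes>\<^bsub>H3_pow m\<^esub> g) = total_height m f + total_height m g"
  unfolding total_height_def sum.distrib[symmetric]
  using assms by (intro sum.cong) (auto simp: H3_pow_component_mult coords_mult H3_pow_component cross_simps)

lemma PiE_subset_H3_pow:
  assumes "\<And>i. i < m \<Longrightarrow> S i \<subseteq> carrier H3"
  shows "(\<Pi>\<^sub>E i\<in>{..<m}. S i \<union> {\<one>\<^bsub>H3\<^esub>}) \<subseteq> carrier (H3_pow m)"
proof -
  have "(\<Pi>\<^sub>E i\<in>{..<m}. S i \<union> {\<one>\<^bsub>H3\<^esub>}) \<subseteq> (\<Pi>\<^sub>E i\<in>{..<m}. carrier H3)"
    using assms by (intro PiE_mono) auto
  then show ?thesis by (simp add: H3_pow_def)
qed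

text \<open>The words of the single factors are padded with the identity to the common length \<open>k\<close>.
Reading them column by column gives \<open>k\<close> elements of the product of the generating sets.\<close>

lemma Heis_reach_words:
  assumes gen: "\<forall>i<m. fin_sym_generating H3 (S i)" and f: "f \<in> carrier (H3_pow m)"
    and reach: "reach m (\<lambda>i. coords ` S i) k (\<lambda>i. fst (coords (f i))) (total_height m f)"
  obtains ws where "length ws = k" "set ws \<subseteq> Heis_proj m ` (\<Pi>\<^sub>E i\<in>{..<m}. S i \<union> {\<one>\<^bsub>H3\<^esub>})"
    "foldr (\<otimes>\<^bsub>Heis m\<^esub>) ws \<one>\<^bsub>Heis m\<^esub> = Heis_proj m f"
proof -
  interpret P: group "H3_pow m" by (rule group_H3_pow)
  have SH: "S i \<subseteq> carrier H3" if "i < m" for i using gen[rule_format, OF that] by (simp add: fin_sym_generating_def)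
  obtain us where us: "\<And>i. i < m \<Longrightarrow> set (us i) \<subseteq> coords ` S i \<and> length (us i) \<le> k \<and> disp (us i) = fst (coords (f i))"
    "(\<Sum>i<m. area (us i)) = total_height m f" using reach unfolding reach_def by blast
  have "\<exists>gs. set gs \<subseteq> S i \<and> map coords gs = us i" if "i < m" for i
    using lift_letters[of "us i" coords "S i"] us(1)[OF that] by metis
  then have "\<exists>gs. \<forall>i<m. set (gs i) \<subseteq> S i \<and> map coords (gs i) = us i" by (intro choice allI) blast
  then obtain gs where gs: "\<And>i. i < m \<Longrightarrow> set (gs i) \<subseteq> S i \<and> map coords (gs i) = us i" by blast
  define hs where "hs i = gs i @ replicate (k - length (gs i)) \<one>\<^bsub>H3\<^esub>" for i
  have lg: "length (gs i) \<le> k" if "i < m" for i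
    using gs[OF that] us(1)[OF that] by (metis length_map)
  have hs: "length (hs i) = k" "set (hs i) \<subseteq> S i \<union> {\<one>\<^bsub>H3\<^esub>}" if "i < m" for i
    using gs[OF that] lg[OF that] by (auto simp: hs_def)
  have co: "coords (foldr (\<otimes>\<^bsub>H3\<^esub>) (hs i) \<one>\<^bsub>H3\<^esub>) = (disp (us i), area (us i))" if i: "i < m" for i
  proof -
    have "foldr (\<otimes>\<^bsub>H3\<^esub>) (hs i) \<one>\<^bsub>H3\<^esub> = foldr (\<otimes>\<^bsub>H3\<^esub>) (gs i) \<one>\<^bsub>H3\<^esub>"
      unfolding hs_def by (simp add: H3.foldr_mult_replicate_one del: foldr_replicate)
    then show ?thesis using coords_foldr[of "gs i"] gs[OF i] SH[OF i] by auto
  qed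
  define fs where "fs = map (\<lambda>j. \<lambda>i\<in>{..<m}. hs i ! j) [0..<k]"
  have fsS: "set fs \<subseteq> (\<Pi>\<^sub>E i\<in>{..<m}. S i \<union> {\<one>\<^bsub>H3\<^esub>})"
  proof
    fix x assume "x \<in> set fs"
    then obtain j where "j < k" "x = (\<lambda>i\<in>{..<m}. hs i ! j)" by (auto simp: fs_def)
    then show "x \<in> (\<Pi>\<^sub>E i\<in>{..<m}. S i \<union> {\<one>\<^bsub>H3\<^esub>})"
      using hs nth_mem by (auto simp: subset_iff)
  qed
  then have fsP: "set fs \<subseteq> carrier (H3_pow m)"
    using PiE_subset_H3_pow[of m S] SH by blast
  have row: "map (\<lambda>f. f i) fs = hs i" if "i < m" for i
    using that hs(1)[OF that] by (auto simp: fs_def intro: nth_equalityI)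
  define p where "p = foldr (\<otimes>\<^bsub>H3_pow m\<^esub>) fs \<one>\<^bsub>H3_pow m\<^esub>"
  have p: "p \<in> carrier (H3_pow m)" unfolding p_def using fsP by simp
  have pc: "coords (p i) = (disp (us i), area (us i))" if "i < m" for i
    using co[OF that] row[OF that] that by (simp add: p_def H3_pow_component_foldr)
  have "total_height m p = total_height m f"
    unfolding total_height_def[of m p] us(2)[symmetric] using pc by (intro sum.cong) auto
  then have "Heis_proj m p = Heis_proj m f" using Heis_proj_eq_iff[OF p f] pc us(1) by simp
  then have "foldr (\<otimes>\<^bsub>Heis m\<^esub>) (map (Heis_proj m) fs) \<one>\<^bsub>Heis m\<^esub> = Heis_proj m f"
    using Heis_proj_foldr[OF fsP] by (simp only: p_def)
  moreover have "length (map (Heis_proj m) fs) = k" by (simp add: fs_def)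
  moreover have "set (map (Heis_proj m) fs) \<subseteq> Heis_proj m ` (\<Pi>\<^sub>E i\<in>{..<m}. S i \<union> {\<one>\<^bsub>H3\<^esub>})"
    using image_mono[OF fsS] by (simp only: set_map)
  ultimately show thesis using that by blast
qed

text \<open>Conversely, a word in the cubical-like generating set is read row by row, and the identity is
dropped because it need not belong to the generating set of the factor.\<close>

lemma Heis_words_reach:
  assumes gen: "\<forall>i<m. fin_sym_generating H3 (S i)" and f: "f \<in> carrier (H3_pow m)"
    and ws: "set ws \<subseteq> Heis_proj m ` (\<Pi>\<^sub>E i\<in>{..<m}. S i \<union> {\<one>\<^bsub>H3\<^esub>})"
    "foldr (\<otimes>\<^bsub>Heis m\<^esub>) ws \<one>\<^bsub>Heis m\<^esub> = Heis_proj m f" "length ws \<le> k"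
  shows "reach m (\<lambda>i. coords ` S i) k (\<lambda>i. fst (coords (f i))) (total_height m f)"
proof -
  interpret P: group "H3_pow m" by (rule group_H3_pow)
  have SH: "S i \<subseteq> carrier H3" if "i < m" for i using gen[rule_format, OF that] by (simp add: fin_sym_generating_def)
  obtain fs where fs: "set fs \<subseteq> (\<Pi>\<^sub>E i\<in>{..<m}. S i \<union> {\<one>\<^bsub>H3\<^esub>})" "map (Heis_proj m) fs = ws"
    by (rule lift_letters[OF ws(1)])
  have fsP: "set fs \<subseteq> carrier (H3_pow m)"
    using PiE_subset_H3_pow[of m S] SH fs(1) by blast
  define p where "p = foldr (\<otimes>\<^bsub>H3_pow m\<^esub>) fs \<one>\<^bsub>H3_pow m\<^esub>"
  have p: "p \<in> carrier (H3_pow m)" unfolding p_def using fsP by simp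
  have "Heis_proj m p = Heis_proj m f" using Heis_proj_foldr[OF fsP] fs(2) ws(2) by (simp add: p_def)
  then have pf: "\<forall>i<m. fst (coords (p i)) = fst (coords (f i))" "total_height m p = total_height m f"
    using Heis_proj_eq_iff[OF p f] by auto
  define gs where "gs i = filter (\<lambda>g. g \<noteq> \<one>\<^bsub>H3\<^esub>) (map (\<lambda>f. f i) fs)" for i
  have gS: "set (gs i) \<subseteq> S i" if "i < m" for i
    using fs(1) that by (fastforce simp: gs_def PiE_iff)
  have gl: "length (gs i) \<le> k" for i
  proof -
    have "length (gs i) \<le> length fs" unfolding gs_def by (metis length_filter_le length_map)
    then show ?thesis using fs(2) ws(3) by (metis le_trans length_map)
  qed
  have gc: "(disp (map coords (gs i)), area (map coords (gs i))) = coords (p i)" if i: "i < m" for i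
  proof -
    have "set (map (\<lambda>f. f i) fs) \<subseteq> carrier H3" using fsP i H3_pow_component by auto
    then have "foldr (\<otimes>\<^bsub>H3\<^esub>) (gs i) \<one>\<^bsub>H3\<^esub> = p i"
      unfolding gs_def p_def H3_pow_component_foldr[OF i] by (rule H3.foldr_mult_filter_one)
    then show ?thesis using coords_foldr[of "gs i"] gS[OF i] SH[OF i] by auto
  qed
  have row: "set (map coords (gs i)) \<subseteq> coords ` S i \<and> length (map coords (gs i)) \<le> k \<and>
    disp (map coords (gs i)) = fst (coords (f i))" if "i < m" for i
    using gS[OF that] gl[of i] gc[OF that] pf(1) that by (metis fst_conv image_mono length_map list.set_map)
  have "(\<Sum>i<m. area (map coords (gs i))) = total_height m p"
    unfolding total_height_def using gc by (intro sum.cong) (auto simp: prod_eq_iff)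
  then have "(\<Sum>i<m. area (map coords (gs i))) = total_height m f" by (simp only: pf(2))
  then show ?thesis unfolding reach_def using row by (intro exI[of _ "\<lambda>i. map coords (gs i)"]) simp
qed

lemma Heis_words_exist:
  assumes gen: "\<forall>i<m. fin_sym_generating H3 (S i)" and f: "f \<in> carrier (H3_pow m)"
  shows "\<exists>k. reach m (\<lambda>i. coords ` S i) k (\<lambda>i. fst (coords (f i))) (total_height m f)"
proof -
  have "\<exists>gs. set gs \<subseteq> S i \<and> foldr (\<otimes>\<^bsub>H3\<^esub>) gs \<one>\<^bsub>H3\<^esub> = f i" if "i < m" for i
    using H3_words[OF gen[rule_format, OF that] H3_pow_component[OF f that]] by metis
  then have "\<exists>gs. \<forall>i<m. set (gs i) \<subseteq> S i \<and> foldr (\<otimes>\<^bsub>H3\<^esub>) (gs i) \<one>\<^bsub>H3\<^esub> = f i"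
    by (intro choice allI) blast
  then obtain gs where gs: "\<And>i. i < m \<Longrightarrow> set (gs i) \<subseteq> S i \<and> foldr (\<otimes>\<^bsub>H3\<^esub>) (gs i) \<one>\<^bsub>H3\<^esub> = f i" by blast
  have gc: "(disp (map coords (gs i)), area (map coords (gs i))) = coords (f i)" if "i < m" for i
    using gs[OF that] coords_foldr[of "gs i"] gen[rule_format, OF that] unfolding fin_sym_generating_def by auto
  have gk: "length (gs i) \<le> (\<Sum>i<m. length (gs i))" if "i < m" for i
    using that by (intro member_le_sum) auto
  show ?thesis unfolding reach_def total_height_def
  proof (intro exI[of _ "\<Sum>i<m. length (gs i)"] exI[of _ "\<lambda>i. map coords (gs i)"] conjI allI impI)
    fix i assume i: "i < m"
    show "set (map coords (gs i)) \<subseteq> coords ` S i" using gs[OF i] by auto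
    show "length (map coords (gs i)) \<le> (\<Sum>i<m. length (gs i))" using gk[OF i] by simp
    show "disp (map coords (gs i)) = fst (coords (f i))" using gc[OF i] by (metis fst_conv)
  next
    show "(\<Sum>i<m. area (map coords (gs i))) = (\<Sum>i<m. snd (coords (f i)))"
      using gc by (intro sum.cong) (auto simp: prod_eq_iff)
  qed
qed

lemma Heis_reach_iff:
  assumes gen: "\<forall>i<m. fin_sym_generating H3 (S i)" and a: "a \<in> carrier (Heis m)"
  shows "reach m (\<lambda>i. coords ` S i) k (Heis_disp m a) (Heis_height m a) \<longleftrightarrow>
    word_length (Heis m) (Heis_proj m ` (\<Pi>\<^sub>E i\<in>{..<m}. S i \<union> {\<one>\<^bsub>H3\<^esub>})) a \<le> k" (is "_ \<longleftrightarrow> word_length _ ?S _ \<le> k")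
proof -
  obtain f where f: "f \<in> carrier (H3_pow m)" and af: "a = Heis_proj m f" by (rule Heis_projE[OF a])
  let ?R = "\<lambda>k. reach m (\<lambda>i. coords ` S i) k (\<lambda>i. fst (coords (f i))) (total_height m f)"
  have eq: "reach m (\<lambda>i. coords ` S i) k (Heis_disp m a) (Heis_height m a) = ?R k"
    using Heis_coords[OF f] unfolding af by (auto elim!: reach_cong)
  show ?thesis unfolding eq
  proof
    assume "?R k"
    then obtain ws where "length ws = k" "set ws \<subseteq> ?S"
      "foldr (\<otimes>\<^bsub>Heis m\<^esub>) ws \<one>\<^bsub>Heis m\<^esub> = a" unfolding af by (rule Heis_reach_words[OF gen f])
    then show "word_length (Heis m) ?S a \<le> k" using word_length_le by metis
  next
    assume k: "word_length (Heis m) ?S a \<le> k"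
    obtain k' where "?R k'" using Heis_words_exist[OF gen f] by blast
    then obtain ws where "length ws = k'" "set ws \<subseteq> ?S"
      "foldr (\<otimes>\<^bsub>Heis m\<^esub>) ws \<one>\<^bsub>Heis m\<^esub> = a" unfolding af by (rule Heis_reach_words[OF gen f])
    from this(2,3) obtain us where "length us = word_length (Heis m) ?S a" "set us \<subseteq> ?S"
      "foldr (\<otimes>\<^bsub>Heis m\<^esub>) us \<one>\<^bsub>Heis m\<^esub> = a" by (rule word_length_attained)
    then show "?R k" using k Heis_words_reach[OF gen f, of us k] unfolding af by simp
  qed
qed

lemma Heis_almost_dead_ends:
  assumes m: "1 \<le> m" and S: "cubical_like m S"
  shows "\<exists>C M D0 :: real. C > 0 \<and> M > 0 \<and> D0 > 0 \<and>
        (\<forall>(D :: real) (n :: int). D \<ge> D0 \<longrightarrow> real_of_int n \<ge> C * D ^ 4 \<longrightarrow>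
          (\<forall>h \<in> carrier (Heis m). real (word_length (Heis m) S h) \<le> D \<longrightarrow>
            real (word_length (Heis m) S ((Heis_z m [^]\<^bsub>Heis m\<^esub> n) \<otimes>\<^bsub>Heis m\<^esub> h))
              \<le> real (word_length (Heis m) S (Heis_z m [^]\<^bsub>Heis m\<^esub> n)) + M))"
proof -
  interpret P: group "H3_pow m" by (rule group_H3_pow)
  interpret Q: group "Heis m" by (rule group_Heis)
  obtain T where T: "\<forall>i<m. fin_sym_generating H3 (T i)"
    and ST: "S = Heis_proj m ` (\<Pi>\<^sub>E i\<in>{..<m}. T i \<union> {\<one>\<^bsub>H3\<^esub>})" using S unfolding cubical_like_def by blast
  define \<zeta> where "\<zeta> n = H3_inj m 0 H3_z [^]\<^bsub>H3_pow m\<^esub> n" for n :: int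
  note injz = H3_inj_closed[OF H3_z_closed, of m 0]
  have \<zeta>: "\<zeta> n \<in> carrier (H3_pow m)" "Heis_z m [^]\<^bsub>Heis m\<^esub> n = Heis_proj m (\<zeta> n)" for n
    using injz by (simp_all add: \<zeta>_def Heis_z_def Heis_proj_int_pow)
  have \<zeta>c: "coords (\<zeta> n i) = (0, if i = 0 then 2 * n else 0)" if "i < m" for n i
    using that by (simp add: \<zeta>_def H3_pow_component_int_pow[OF injz])
      (simp add: H3_inj_def coords_int_pow H3_z_closed coords_gens zero_prod_def)
  have \<zeta>h: "total_height m (\<zeta> n) = 2 * n" for n
    unfolding total_height_def using m \<zeta>c by simp
  show ?thesis
  proof (rule almost_dead_ends_of_reach[where \<A> = "\<lambda>i. coords ` T i" and V = "Heis_disp m" and T = "Heis_height m", OF m])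
    show "alphabet (coords ` T i)" if "i < m" for i using alphabet_coords[OF T[rule_format, OF that]] .
    show "reach m (\<lambda>i. coords ` T i) k (Heis_disp m g) (Heis_height m g) \<longleftrightarrow> word_length (Heis m) S g \<le> k"
      if "g \<in> carrier (Heis m)" for g k using Heis_reach_iff[OF T that] unfolding ST .
    fix n :: int
    show "Heis_z m [^]\<^bsub>Heis m\<^esub> n \<in> carrier (Heis m)" using \<zeta> by (simp add: Heis_proj_closed)
    show "Heis_disp m (Heis_z m [^]\<^bsub>Heis m\<^esub> n) i = 0" if "i < m" for i
      using \<zeta>(1) that by (simp add: \<zeta>(2) Heis_coords \<zeta>c)
    show "Heis_height m (Heis_z m [^]\<^bsub>Heis m\<^esub> n) = 2 * n"
      using \<zeta>(1) by (simp add: \<zeta>(2) Heis_coords \<zeta>h)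
    fix h assume "h \<in> carrier (Heis m)"
    then obtain f where f: "f \<in> carrier (H3_pow m)" and hf: "h = Heis_proj m f" by (rule Heis_projE)
    have zh: "Heis_z m [^]\<^bsub>Heis m\<^esub> n \<otimes>\<^bsub>Heis m\<^esub> h = Heis_proj m (\<zeta> n \<otimes>\<^bsub>H3_pow m\<^esub> f)"
      using \<zeta> f by (simp add: hf Heis_proj_mult)
    have cl: "\<zeta> n \<otimes>\<^bsub>H3_pow m\<^esub> f \<in> carrier (H3_pow m)" using \<zeta> f by simp
    show "Heis_z m [^]\<^bsub>Heis m\<^esub> n \<otimes>\<^bsub>Heis m\<^esub> h \<in> carrier (Heis m)" using cl by (simp add: zh Heis_proj_closed)
    show "Heis_disp m (Heis_z m [^]\<^bsub>Heis m\<^esub> n \<otimes>\<^bsub>Heis m\<^esub> h) i = Heis_disp m h i" if "i < m" for i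
      unfolding zh unfolding hf using that
      by (simp add: Heis_coords[OF cl] Heis_coords[OF f] H3_pow_component_mult coords_mult \<zeta>c
          H3_pow_component[OF \<zeta>(1)] H3_pow_component[OF f])
    show "Heis_height m (Heis_z m [^]\<^bsub>Heis m\<^esub> n \<otimes>\<^bsub>Heis m\<^esub> h) = 2 * n + Heis_height m h"
      unfolding zh unfolding hf by (simp add: Heis_coords[OF cl] Heis_coords[OF f] total_height_mult[OF \<zeta>(1) f] \<zeta>c \<zeta>h)
  qed
qed

theorem theorem3p13:
  shows "(\<forall>S. fin_sym_generating H3 S \<longrightarrow>
      (\<exists>C M D0 :: real. C > 0 \<and> M > 0 \<and> D0 > 0 \<and>
        (\<forall>(D :: real) (n :: int). D \<ge> D0 \<longrightarrow> real_of_int n \<ge> C * D ^ 4 \<longrightarrow>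
          (\<forall>h \<in> carrier H3. real (word_length H3 S h) \<le> D \<longrightarrow>
            real (word_length H3 S ((H3_z [^]\<^bsub>H3\<^esub> n) \<otimes>\<^bsub>H3\<^esub> h))
              \<le> real (word_length H3 S (H3_z [^]\<^bsub>H3\<^esub> n)) + M))))
    \<and> (\<forall>(m :: nat) S. m \<ge> 1 \<longrightarrow> cubical_like m S \<longrightarrow>
      (\<exists>C M D0 :: real. C > 0 \<and> M > 0 \<and> D0 > 0 \<and>
        (\<forall>(D :: real) (n :: int). D \<ge> D0 \<longrightarrow> real_of_int n \<ge> C * D ^ 4 \<longrightarrow>
          (\<forall>h \<in> carrier (Heis m). real (word_length (Heis m) S h) \<le> D \<longrightarrow>
            real (word_length (Heis m) S ((Heis_z m [^]\<^bsub>Heis m\<^esub> n) \<otimes>\<^bsub>Heis m\<^esub> h))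
              \<le> real (word_length (Heis m) S (Heis_z m [^]\<^bsub>Heis m\<^esub> n)) + M))))"
  using H3_almost_dead_ends Heis_almost_dead_ends by blast

end
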